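(* Suppose $z$ is a $5$-vertex. Then there is a short exact sequence of $A$-modules $$0\to b_1A+b_2A\to e_zA\to\bar b_4A\to0.$$ Hence $e_zA$ has a rhombus filtration. Moreover, $\Omega(\bar b_4A)\cong b_1A+b_2A$.
   Context: Tiling. Let $\mathrm p:\mathbb R^3\to\mathbb R^2$ be linear with $\mathrm p(\mathbf e_1)=(-\frac{\sqrt3}{2},-\frac12)$, $\mathrm p(\mathbf e_2)=(\frac{\sqrt3}{2},-\frac12)$, $\mathrm p(\mathbf e_3)=(0,1)$. For $\{i,j,k\}=\{1,2,3\}$ let $R_k=\{\lambda \mathrm p(\mathbf e_i)+\mu \mathrm p(\mathbf e_j):0\le\lambda,\mu\le1\}$. Let $\mathbf M=\begin{pmatrix}0&1&0\\0&0&1\\1&-1&-1\end{pmatrix}$ with columns $\mathbf c_1,\mathbf c_2,\mathbf c_3$. A pair $(z,k)$, $z\in\mathbb Z^3$, represents the rhombus $\mathrm p(z)+R_k$. Put $\mathcal P_0=\{(0,1),(0,2),(0,3)\}$ and $\mathcal P_{i+1}=\bigcup_{(z,k)\in\mathcal P_i}\mathcal R(z,k)$, where $\mathcal R(z,1)=\{(\mathbf Mz,3),(\mathbf Mz+\mathbf c_2,1),(\mathbf Mz+\mathbf c_3,2)\}$, $\mathcal R(z,2)=\{(\mathbf Mz,1)\}$, $\mathcal R(z,3)=\{(\mathbf Mz,2)\}$. Then $\mathcal P_i\subset\mathcal P_{i+1}$ and $\bigcup_i\mathcal P_i$ is a tiling of the plane by rhombi (the Rauzy tiling). Algebra $A$.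 Let $Q$ be the quiver whose vertices are the vertices of the Rauzy tiling, with each edge replaced by two arrows in opposite directions; $\bar b$ is the arrow opposite to $b$. Let $k$ be a field. Paths are composed left to right and modules are right modules. The Rauzy algebra is $A=kQ/I$, where $I$ is generated by: (1) a path of length two along two distinct edges that are not both edges of one rhombus is zero; (2) the two paths of length two joining opposite vertices of a rhombus (along its boundary) are equal; (3) for each vertex $z$, $s_1(z)D_1(z)=s_2(z)D_2(z)=s_3(z)D_3(z)$, where $D_a(z)=L_a^+(z)-L_a^-(z)$, $L_a^{\pm}(z)=g\bar g$ if there is an arrow $g:z\to z\pm\mathrm p(\mathbf e_a)$ and $L_a^\pm(z)=0$ otherwise, and $s_a(z)\in\{\pm1\}$ is a fixed choice of signs such that whenever $z,x$ are joined by an edge parallel to $\mathrm p(\mathbf e_a)$, $s_a(x)=-s_a(z)$ and $s_c(x)=s_c(z)$ for $c\ne a$ (such signs are determined by their values at one vertex). $e_z$ is the trivial path at $z$ and $S_z$ the simple module at $z$. Local notation. An $n$-vertex is a vertex $z$ with exactly $n$ edges. Its neighbours are labelled $x_1,\dots,x_n$ counterclockwise (starting anywhere), and $b_j:z\to x_j$ is the corresponding arrow. $\Omega(M)$ is the kernel of a projective cover of $M$. Rhombus modules. For a rhombus of the tiling with opposite vertices $z,y$ and remaining vertices $u,v$, the rhombus module $R^y_z$ is the (unique up to isomorphism) $A$-module with top $S_y$, socle $S_z$ and $\mathrm{rad}/\mathrm{soc}\cong S_u\oplus S_v$; explicitly $R^y_z=pA$ with $p$ the path of length two from $z$ to $y$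 around the rhombus. A module $M$ has a rhombus filtration if there are submodules $0=M_0\subset M_1\subset\dots\subset M_r=M$ with each $M_j/M_{j-1}$ a rhombus module. *)

theory Defs
  imports "HOL-Analysis.Analysis" "HOL-Library.Poly_Mapping"
    "HOL-Algebra.Module" "HOL-Algebra.QuotRing"
begin

section \<open>The Rauzy tiling\<close>

text \<open>The index set \<open>{1,2,3}\<close> is the three-element type \<open>3\<close>; its numeral \<open>3\<close> equals \<open>0\<close>
  and is the third index, in accordance with \<open>v $ 3\<close> for \<open>v :: 'a^3\<close>.\<close>

definition proj :: "real^3 \<Rightarrow> real^2" where
  "proj v = v $ 1 *\<^sub>R vector [- (sqrt 3 / 2), - (1 / 2)]
          + v $ 2 *\<^sub>R vector [sqrt 3 / 2, - (1 / 2)]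
          + v $ 3 *\<^sub>R vector [0, 1]"

definition dir :: "3 \<Rightarrow> real^2" where
  "dir a = proj (axis a 1)"

definition subst_matrix :: "int^3^3" where
  "subst_matrix = vector [vector [0, 1, 0], vector [0, 0, 1], vector [1, -1, -1]]"

type_synonym tile = "(int^3) \<times> 3"

fun subst_tile :: "tile \<Rightarrow> tile set" where
  "subst_tile (z, k) =
    (let m = subst_matrix *v z in
     if k = 1 then {(m, 3), (m + column 2 subst_matrix, 1), (m + column 3 subst_matrix, 2)}
     else if k = 2 then {(m, 1)}
     else {(m, 2)})"

primrec patch :: "nat \<Rightarrow> tile set" where
  "patch 0 = {(0, 1), (0, 2), (0, 3)}"
| "patch (Suc i) = (\<Union>t\<in>patch i. subst_tile t)"

definition tiling :: "tile set" where
  "tiling = (\<Union>i. patch i)"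

fun rhombus :: "tile \<Rightarrow> (real^2) set" where
  "rhombus (z, k) =
    {proj (\<chi> a. of_int (z $ a)) + l *\<^sub>R dir i + m *\<^sub>R dir j | l m i j.
      {i, j, k} = UNIV \<and> 0 \<le> l \<and> l \<le> 1 \<and> 0 \<le> m \<and> m \<le> 1}"

fun corners :: "tile \<Rightarrow> (real^2) set" where
  "corners (z, k) =
    {proj (\<chi> a. of_int (z $ a)) + l *\<^sub>R dir i + m *\<^sub>R dir j | l m i j.
      {i, j, k} = UNIV \<and> l \<in> {0, 1} \<and> m \<in> {0, 1}}"

lemma rhombus_eq_convex_hull: "rhombus t = convex hull (corners t)"
proof (cases t)
  case (Pair z k)
  define p where "p = proj (\<chi> a. of_int (z $ a))"
  define i j where "i = k + 1" and "j = k + 2"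
  have "\<forall>i' j' k :: 3. (\<forall>a. a \<in> {i', j', k}) \<longleftrightarrow>
      (i' = k + 1 \<and> j' = k + 2) \<or> (i' = k + 2 \<and> j' = k + 1)"
    unfolding forall_3 by simp
  then have ex: "{i', j', k} = UNIV \<longleftrightarrow> (i' = i \<and> j' = j) \<or> (i' = j \<and> j' = i)" for i' j'
    unfolding i_def j_def by blast
  define Q where "Q l m = p + l *\<^sub>R dir i + m *\<^sub>R dir j" for l m
  have swap: "p + l *\<^sub>R dir j + m *\<^sub>R dir i = Q m l" for l m
    by (simp add: Q_def)
  have gen: "{p + l *\<^sub>R dir i' + m *\<^sub>R dir j' | l m i' j'.
      (i' = i \<and> j' = j \<or> i' = j \<and> j' = i) \<and> B l m} = {Q l m | l m. B l m}" (is "?L = ?R")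
    if B: "\<And>l m. B l m \<Longrightarrow> B m l" for B
  proof (intro equalityI subsetI)
    fix y assume "y \<in> ?L"
    then obtain l m i' j' where y: "y = p + l *\<^sub>R dir i' + m *\<^sub>R dir j'" "B l m"
      and "i' = i \<and> j' = j \<or> i' = j \<and> j' = i"
      by blast
    then have "y = Q l m \<or> y = Q m l"
      using swap Q_def by metis
    then show "y \<in> ?R"
      using B y(2) by blast
  next
    fix y assume "y \<in> ?R"
    then show "y \<in> ?L"
      unfolding Q_def by blast
  qed
  have rh: "rhombus t = {Q l m | l m. 0 \<le> l \<and> l \<le> 1 \<and> 0 \<le> m \<and> m \<le> 1}"
    unfolding Pair rhombus.simps ex p_def[symmetric] by (rule gen) blast
  have co: "corners t = {Q l m | l m. l \<in> {0, 1} \<and> m \<in> {0, 1}}"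
    unfolding Pair corners.simps ex p_def[symmetric] by (rule gen) blast
  show ?thesis
  proof
    show "rhombus t \<subseteq> convex hull (corners t)"
    proof
      fix y assume "y \<in> rhombus t"
      then obtain l m where y: "y = Q l m" and lm: "0 \<le> l" "l \<le> 1" "0 \<le> m" "m \<le> 1"
        unfolding rh by blast
      have c: "Q l' m' \<in> convex hull (corners t)" if "l' \<in> {0, 1}" "m' \<in> {0, 1}" for l' m'
        using that by (intro hull_inc) (auto simp: co)
      have e: "Q l m' \<in> convex hull (corners t)" if "m' \<in> {0, 1}" for m'
      proof -
        have "Q l m' = (1 - l) *\<^sub>R Q 0 m' + l *\<^sub>R Q 1 m'"
          by (simp add: Q_def algebra_simps)
        then show ?thesis
          using convexD[OF convex_convex_hull, OF c[of 0 m'] c[of 1 m'], of "1 - l" l] lm that by simp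
      qed
      have "Q l m = (1 - m) *\<^sub>R Q l 0 + m *\<^sub>R Q l 1"
        by (simp add: Q_def algebra_simps)
      then show "y \<in> convex hull (corners t)"
        using convexD[OF convex_convex_hull, OF e[of 0] e[of 1], of "1 - m" m] lm y by simp
    qed
  next
    have "convex (rhombus t)"
    proof (rule convexI)
      fix x y and u v :: real
      assume "x \<in> rhombus t" "y \<in> rhombus t" and uv: "0 \<le> u" "0 \<le> v" "u + v = 1"
      then obtain l m l' m' where x: "x = Q l m" and y: "y = Q l' m'"
        and b: "0 \<le> l" "l \<le> 1" "0 \<le> m" "m \<le> 1" "0 \<le> l'" "l' \<le> 1" "0 \<le> m'" "m' \<le> 1"
        unfolding rh by blast
      have v: "v = 1 - u"
        using uv by simp
      have "u *\<^sub>R x + v *\<^sub>R y = Q (u * l + v * l') (u * m + v * m')"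
        unfolding x y Q_def v by (simp add: algebra_simps)
      moreover have "0 \<le> u * l + v * l'" "0 \<le> u * m + v * m'"
        using b uv by auto
      moreover have "u * l + v * l' \<le> 1" "u * m + v * m' \<le> 1"
        using b uv by (auto intro: convex_bound_le)
      ultimately show "u *\<^sub>R x + v *\<^sub>R y \<in> rhombus t"
        unfolding rh by blast
    qed
    moreover have "corners t \<subseteq> rhombus t"
      unfolding rh co by fastforce
    ultimately show "convex hull (corners t) \<subseteq> rhombus t"
      by (rule hull_minimal[rotated])
  qed
qed

text \<open>The sides of the rhombus \<open>(z, k)\<close> join corners differing by \<open>\<plusminus> dir i\<close> with \<open>i \<noteq> k\<close>
  (the short diagonal is \<open>\<plusminus> dir k\<close>).\<close>

fun side :: "tile \<Rightarrow> real^2 \<Rightarrow> real^2 \<Rightarrow> bool" where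
  "side (z, k) v w \<longleftrightarrow> v \<in> corners (z, k) \<and> w \<in> corners (z, k) \<and>
    (\<exists>i. i \<noteq> k \<and> (w - v = dir i \<or> w - v = - dir i))"

definition vertices :: "(real^2) set" where
  "vertices = (\<Union>t\<in>tiling. corners t)"

text \<open>An arrow is its pair (source, target): the quiver has no multiple arrows and no loops.\<close>

definition arrows :: "((real^2) \<times> (real^2)) set" where
  "arrows = {(v, w). \<exists>t\<in>tiling. side t v w}"

text \<open>\<open>z, u, y, v\<close> are the four vertices of a rhombus of the tiling in cyclic order;
  \<open>z, y\<close> are opposite and \<open>u, v\<close> are the remaining vertices.\<close>

definition tiling_rhombus :: "real^2 \<Rightarrow> real^2 \<Rightarrow> real^2 \<Rightarrow> real^2 \<Rightarrow> bool" where
  "tiling_rhombus z u y v \<longleftrightarrow> z \<noteq> y \<and> u \<noteq> v \<and>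
    (\<exists>t\<in>tiling. side t z u \<and> side t u y \<and> side t y v \<and> side t v z)"

definition n_vertex :: "nat \<Rightarrow> real^2 \<Rightarrow> bool" where
  "n_vertex n z \<longleftrightarrow> z \<in> vertices \<and> finite {x. (z, x) \<in> arrows} \<and> card {x. (z, x) \<in> arrows} = n"

definition ccw_labelling :: "nat \<Rightarrow> real^2 \<Rightarrow> (nat \<Rightarrow> real^2) \<Rightarrow> bool" where
  "ccw_labelling n z x \<longleftrightarrow>
    x ` {1..n} = {w. (z, w) \<in> arrows} \<and>
    (\<exists>r \<theta> :: nat \<Rightarrow> real.
      (\<forall>j\<in>{1..n}. 0 < r j \<and> x j = z + r j *\<^sub>R vector [cos (\<theta> j), sin (\<theta> j)]) \<and>
      strict_mono_on {1..n} \<theta> \<and>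
      (\<forall>i\<in>{1..n}. \<forall>j\<in>{1..n}. \<theta> j - \<theta> i < 2 * pi))"

definition sign_choice :: "(3 \<Rightarrow> real^2 \<Rightarrow> int) \<Rightarrow> bool" where
  "sign_choice s \<longleftrightarrow>
    (\<forall>a. \<forall>z\<in>vertices. s a z = 1 \<or> s a z = -1) \<and>
    (\<forall>a z x. (z, x) \<in> arrows \<and> (x - z = dir a \<or> x - z = - dir a) \<longrightarrow>
      s a x = - s a z \<and> (\<forall>c. c \<noteq> a \<longrightarrow> s c x = s c z))"


section \<open>The path algebra and the Rauzy algebra\<close>

text \<open>Since there is at most one arrow between two vertices, a path is the nonempty list of the
  vertices it visits; \<open>[z]\<close> is the trivial path at \<open>z\<close>.\<close>

definition walks :: "(real^2) list set" where
  "walks = {p. p \<noteq> [] \<and> set p \<subseteq> vertices \<and> successively (\<lambda>v w. (v, w) \<in> arrows) p}"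

type_synonym 'k path_comb = "(real^2) list \<Rightarrow>\<^sub>0 'k"

definition path_mult :: "'k::field path_comb \<Rightarrow> 'k path_comb \<Rightarrow> 'k path_comb" where
  "path_mult f g =
    (\<Sum>p\<in>Poly_Mapping.keys f. \<Sum>q\<in>Poly_Mapping.keys g.
      if last p = hd q
      then Poly_Mapping.single (p @ tl q) (Poly_Mapping.lookup f p * Poly_Mapping.lookup g q)
      else 0)"

text \<open>The quiver is infinite, so \<open>kQ\<close> and its quotients have no unit: the field \<open>one\<close> of the
  record is a dummy and is never used.\<close>

definition path_algebra :: "'k::field path_comb ring" where
  "path_algebra =
    \<lparr>carrier = {f. Poly_Mapping.keys f \<subseteq> walks}, mult = path_mult, one = undefined,
     zero = 0, add = (+)\<rparr>"

definition two_sided_ideal :: "'a set \<Rightarrow> 'a ring \<Rightarrow> bool" where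
  "two_sided_ideal I R \<longleftrightarrow> additive_subgroup I R \<and>
    (\<forall>a\<in>I. \<forall>x\<in>carrier R. x \<otimes>\<^bsub>R\<^esub> a \<in> I \<and> a \<otimes>\<^bsub>R\<^esub> x \<in> I)"

definition generated_ideal :: "'a ring \<Rightarrow> 'a set \<Rightarrow> 'a set" where
  "generated_ideal R S = \<Inter>{I. two_sided_ideal I R \<and> S \<subseteq> I}"

abbreviation walk_elem :: "(real^2) list \<Rightarrow> 'k::field path_comb" where
  "walk_elem p \<equiv> Poly_Mapping.single p 1"

definition rel_zero :: "'k::field path_comb set" where
  "rel_zero = {walk_elem [x, y, w] | x y w.
    (x, y) \<in> arrows \<and> (y, w) \<in> arrows \<and> x \<noteq> w \<and> \<not> (\<exists>t\<in>tiling. side t x y \<and> side t y w)}"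

definition rel_commute :: "'k::field path_comb set" where
  "rel_commute = {walk_elem [z, u, y] - walk_elem [z, v, y] | z u y v. tiling_rhombus z u y v}"

definition loop_elem :: "real^2 \<Rightarrow> real^2 \<Rightarrow> 'k::field path_comb" where
  "loop_elem z d = (if (z, z + d) \<in> arrows then walk_elem [z, z + d, z] else 0)"

definition D_elem :: "3 \<Rightarrow> real^2 \<Rightarrow> 'k::field path_comb" where
  "D_elem a z = loop_elem z (dir a) - loop_elem z (- dir a)"

definition signed_D :: "(3 \<Rightarrow> real^2 \<Rightarrow> int) \<Rightarrow> 3 \<Rightarrow> real^2 \<Rightarrow> 'k::field path_comb" where
  "signed_D s a z = Poly_Mapping.map (\<lambda>c. of_int (s a z) * c) (D_elem a z)"

definition rel_loop :: "(3 \<Rightarrow> real^2 \<Rightarrow> int) \<Rightarrow> 'k::field path_comb set" where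
  "rel_loop s = {signed_D s a z - signed_D s c z | a c z. z \<in> vertices}"

definition rauzy_ideal :: "(3 \<Rightarrow> real^2 \<Rightarrow> int) \<Rightarrow> 'k::field path_comb set" where
  "rauzy_ideal s = generated_ideal path_algebra (rel_zero \<union> rel_commute \<union> rel_loop s)"

definition rauzy_algebra :: "(3 \<Rightarrow> real^2 \<Rightarrow> int) \<Rightarrow> 'k::field path_comb set ring" where
  "rauzy_algebra s = path_algebra Quot (rauzy_ideal s)"

definition walk_class :: "(3 \<Rightarrow> real^2 \<Rightarrow> int) \<Rightarrow> (real^2) list \<Rightarrow> 'k::field path_comb set" where
  "walk_class s p = rauzy_ideal s +>\<^bsub>path_algebra\<^esub> walk_elem p"


section \<open>Right modules\<close>

text \<open>Right modules use the record of HOL-Algebra modules, \<open>a \<odot> x\<close> being read as \<open>x \<cdot> a\<close>.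
  As \<open>A\<close> has no unit but has local units, the usual unitality condition \<open>M A = M\<close> says that every
  \<open>x\<close> is fixed by some element of \<open>A\<close>. For the Rauzy algebra, such a module carries a unique
  compatible \<open>k\<close>-vector space structure (\<open>c\<close> acts on \<open>x = x \<cdot> a\<close> as \<open>c a\<close>), for which all
  \<open>A\<close>-linear maps and all submodules are \<open>k\<close>-linear.\<close>

definition right_module :: "'a ring \<Rightarrow> ('a, 'm) module \<Rightarrow> bool" where
  "right_module A M \<longleftrightarrow> abelian_group M \<and>
    (\<forall>a\<in>carrier A. \<forall>x\<in>carrier M. a \<odot>\<^bsub>M\<^esub> x \<in> carrier M) \<and>
    (\<forall>a\<in>carrier A. \<forall>b\<in>carrier A. \<forall>x\<in>carrier M.
      (a \<oplus>\<^bsub>A\<^esub> b) \<odot>\<^bsub>M\<^esub> x = a \<odot>\<^bsub>M\<^esub> x \<oplus>\<^bsub>M\<^esub> b \<odot>\<^bsub>M\<^esub> x) \<and>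
    (\<forall>a\<in>carrier A. \<forall>x\<in>carrier M. \<forall>y\<in>carrier M.
      a \<odot>\<^bsub>M\<^esub> (x \<oplus>\<^bsub>M\<^esub> y) = a \<odot>\<^bsub>M\<^esub> x \<oplus>\<^bsub>M\<^esub> a \<odot>\<^bsub>M\<^esub> y) \<and>
    (\<forall>a\<in>carrier A. \<forall>b\<in>carrier A. \<forall>x\<in>carrier M.
      (a \<otimes>\<^bsub>A\<^esub> b) \<odot>\<^bsub>M\<^esub> x = b \<odot>\<^bsub>M\<^esub> (a \<odot>\<^bsub>M\<^esub> x)) \<and>
    (\<forall>x\<in>carrier M. \<exists>a\<in>carrier A. a \<odot>\<^bsub>M\<^esub> x = x)"

definition right_hom :: "'a ring \<Rightarrow> ('a, 'm) module \<Rightarrow> ('a, 'n) module \<Rightarrow> ('m \<Rightarrow> 'n) set" where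
  "right_hom A M N = {f. f \<in> carrier M \<rightarrow> carrier N \<and>
    (\<forall>x\<in>carrier M. \<forall>y\<in>carrier M. f (x \<oplus>\<^bsub>M\<^esub> y) = f x \<oplus>\<^bsub>N\<^esub> f y) \<and>
    (\<forall>a\<in>carrier A. \<forall>x\<in>carrier M. f (a \<odot>\<^bsub>M\<^esub> x) = a \<odot>\<^bsub>N\<^esub> f x)}"

definition right_iso :: "'a ring \<Rightarrow> ('a, 'm) module \<Rightarrow> ('a, 'n) module \<Rightarrow> bool" where
  "right_iso A M N \<longleftrightarrow> (\<exists>f\<in>right_hom A M N. bij_betw f (carrier M) (carrier N))"

definition short_exact ::
  "'a ring \<Rightarrow> ('a, 'l) module \<Rightarrow> ('l \<Rightarrow> 'm) \<Rightarrow> ('a, 'm) module \<Rightarrow> ('m \<Rightarrow> 'n) \<Rightarrow> ('a, 'n) module \<Rightarrow> bool"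
  where
  "short_exact A L f M g N \<longleftrightarrow>
    right_module A L \<and> right_module A M \<and> right_module A N \<and>
    f \<in> right_hom A L M \<and> g \<in> right_hom A M N \<and>
    inj_on f (carrier L) \<and> f ` carrier L = a_kernel M N g \<and> g ` carrier M = carrier N"

definition regular_module :: "'a ring \<Rightarrow> ('a, 'a) module" where
  "regular_module A =
    \<lparr>carrier = carrier A, mult = mult A, one = one A, zero = zero A, add = add A,
     smult = (\<lambda>a x. x \<otimes>\<^bsub>A\<^esub> a)\<rparr>"

definition sub_module :: "('a, 'm) module \<Rightarrow> 'm set \<Rightarrow> ('a, 'm) module" where
  "sub_module M N = M\<lparr>carrier := N\<rparr>"

definition quotient_module :: "('a, 'm) module \<Rightarrow> 'm set \<Rightarrow> ('a, 'm set) module" where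
  "quotient_module M N =
    \<lparr>carrier = a_rcosets\<^bsub>M\<^esub> N, mult = undefined, one = undefined, zero = N, add = set_add M,
     smult = (\<lambda>a X. \<Union>x\<in>X. N +>\<^bsub>M\<^esub> (a \<odot>\<^bsub>M\<^esub> x))\<rparr>"

definition right_ideal :: "'a ring \<Rightarrow> 'a \<Rightarrow> 'a set" where
  "right_ideal A x = (\<lambda>a. x \<otimes>\<^bsub>A\<^esub> a) ` carrier A"

text \<open>Lifting property against all epimorphisms \<open>g : M \<rightarrow> N\<close>. HOL cannot quantify over the types
  of \<open>M\<close> and \<open>N\<close>; for a module \<open>P\<close> with elements in \<open>'p\<close> the types below are large enough when \<open>A\<close>
  has a complete family of orthogonal idempotents (as a quotient of \<open>kQ\<close> has): the direct sum \<open>F\<close>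
  of copies of \<open>A\<close> indexed by the elements of \<open>P\<close> consists of functions \<open>'p \<Rightarrow> 'a\<close>, and lifting
  the identity of \<open>P\<close> along the canonical epimorphism \<open>F \<rightarrow> P\<close> makes \<open>P\<close> a direct summand of the
  projective module \<open>F\<close>, hence gives the lifting property for modules over arbitrary types.\<close>

definition projective :: "'a ring \<Rightarrow> ('a, 'p) module \<Rightarrow> bool" where
  "projective A P \<longleftrightarrow> right_module A P \<and>
    (\<forall>(M :: ('a, 'p \<Rightarrow> 'a) module) (N :: ('a, 'p) module) g h.
      right_module A M \<and> right_module A N \<and>
      g \<in> right_hom A M N \<and> g ` carrier M = carrier N \<and> h \<in> right_hom A P N \<longrightarrow>
      (\<exists>l\<in>right_hom A P M. \<forall>x\<in>carrier P. g (l x) = h x))"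

definition projective_cover ::
  "'a ring \<Rightarrow> ('a, 'p) module \<Rightarrow> ('p \<Rightarrow> 'm) \<Rightarrow> ('a, 'm) module \<Rightarrow> bool" where
  "projective_cover A P \<pi> M \<longleftrightarrow>
    projective A P \<and> right_module A M \<and> \<pi> \<in> right_hom A P M \<and> \<pi> ` carrier P = carrier M \<and>
    (\<forall>N. submodule N A P \<and> N <+>\<^bsub>P\<^esub> a_kernel P M \<pi> = carrier P \<longrightarrow> N = carrier P)"


section \<open>Rhombus modules\<close>

definition rhombus_module ::
  "(3 \<Rightarrow> real^2 \<Rightarrow> int) \<Rightarrow> ('k::field path_comb set, 'm) module \<Rightarrow> bool" where
  "rhombus_module s M \<longleftrightarrow> right_module (rauzy_algebra s) M \<and>
    (\<exists>z u y v. tiling_rhombus z u y v \<and>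
      right_iso (rauzy_algebra s) M
        (sub_module (regular_module (rauzy_algebra s))
          (right_ideal (rauzy_algebra s) (walk_class s [z, u, y]))))"

definition has_rhombus_filtration ::
  "(3 \<Rightarrow> real^2 \<Rightarrow> int) \<Rightarrow> ('k::field path_comb set, 'm) module \<Rightarrow> bool" where
  "has_rhombus_filtration s M \<longleftrightarrow> right_module (rauzy_algebra s) M \<and>
    (\<exists>r (F :: nat \<Rightarrow> 'm set).
      F 0 = {\<zero>\<^bsub>M\<^esub>} \<and> F r = carrier M \<and>
      (\<forall>j\<le>r. submodule (F j) (rauzy_algebra s) M) \<and>
      (\<forall>j<r. F j \<subseteq> F (Suc j) \<and>
        rhombus_module s (quotient_module (sub_module M (F (Suc j))) (F j))))"

end

theory Submission
  imports Defs
begin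

text \<open>The tiling is the discrete plane of all faces \<open>(q, k)\<close> with \<open>0 \<le> \<langle>q, wt\<rangle> < wt k\<close>. Hence the rhombi at
  a vertex can be read off from the arrows at that vertex.

  At a \<open>5\<close>-vertex consider the chain of right ideals
  \<open>0 \<subseteq> p A \<subseteq> b\<^sub>1 A \<subseteq> b\<^sub>1 A + b\<^sub>2 A \<subseteq> b\<^sub>1 A + b\<^sub>2 A + b\<^sub>3 A \<subseteq> e\<^sub>z A\<close>, where \<open>p\<close> is the path of length two around the
  rhombus with sides \<open>b\<^sub>1, b\<^sub>2\<close>. The relations bound each quotient from above: modulo the preceding ideal,
  all but four of the paths that extend its generator vanish. Left multiplication by a path that annihilates the
  preceding ideal maps the quotient to a rhombus module. It is injective there because the closed paths of
  length four around a rhombus are nonzero in \<open>A\<close>, which is detected by a trace form on \<open>kQ\<close> that is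
  compatible with the relations.

  In particular \<open>b\<^sub>1 A + b\<^sub>2 A\<close> is the kernel of the left multiplication by the reversed arrow \<open>b\<^sub>4'\<close> on \<open>e\<^sub>z A\<close>.
  An element of this kernel that ends at \<open>z\<close> has vanishing cube, so the kernel is superfluous and \<open>e\<^sub>z A\<close> is a projective cover of
  \<open>b\<^sub>4' A\<close>.\<close>

section \<open>The tiling as a discrete plane\<close>

text \<open>The tiling is given only as a limit of substitutions, so its local structure is hidden.
  The real eigenvalue of \<open>subst_matrix\<close> yields a linear height \<open>ht\<close> for
  which the images of the three tile types fill exactly the intervals
  \<open>0 \<le> ht q < wt k\<close>. Hence every tile of the discrete plane has a parent there, and
  the complex eigenvalues shrink repeated parents into a finite region that is settled by
  computation. The algebra is given by generators and relations, which show that elements vanish but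
  never that they do not. The lower bounds therefore need a functional on paths that is compatible
  with the relations. The order of the arrows in the chain matters: the rhombus shared with the
  previous arrow puts one of the two far corners over the new arrow into the preceding ideal, and
  the loop relations then kill the remaining loops, so that a single rhombus is left.\<close>

definition trib :: real where
  "trib = (SOME l. 0 < l \<and> l ^ 3 + l ^ 2 + l = 1)"

text \<open>The cubic is the characteristic polynomial of \<open>subst_matrix\<close>, and its real
  root is the reciprocal of the tribonacci constant. The intermediate value theorem on the unit
  interval provides it.\<close>

lemma trib: "0 < trib" "trib ^ 3 + trib ^ 2 + trib = 1"
proof -
  have "\<exists>l. 0 \<le> l \<and> l \<le> 1 \<and> l ^ 3 + l ^ 2 + l = (1::real)"
    by (rule IVT) (auto intro!: continuous_intros)
  then obtain l :: real where l: "0 \<le> l" "l ^ 3 + l ^ 2 + l = 1"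
    by blast
  then have "0 < l \<and> l ^ 3 + l ^ 2 + l = 1"
    by (cases "l = 0") auto
  then have "0 < trib \<and> trib ^ 3 + trib ^ 2 + trib = 1"
    unfolding trib_def by (rule someI)
  then show "0 < trib" "trib ^ 3 + trib ^ 2 + trib = 1"
    by auto
qed

lemma cubic_mono:
  fixes a b :: real
  assumes "0 \<le> a" "a \<le> b"
  shows "a ^ 3 + a ^ 2 + a \<le> b ^ 3 + b ^ 2 + b"
  using assms power_mono[of a b 3] power_mono[of a b 2] by linarith

text \<open>The cubic is increasing, so it suffices to evaluate it at the two rationals. The
  precision is what bounds the rounding error in \<open>small_stepped_tiling\<close>.\<close>

lemma trib_bounds: "543689 / 1000000 < trib" "trib < 54369 / 100000"
proof -
  show "543689 / 1000000 < trib"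
  proof (rule ccontr)
    assume "\<not> ?thesis"
    then have "trib ^ 3 + trib ^ 2 + trib \<le> (543689 / 1000000) ^ 3 + (543689 / 1000000) ^ 2 + 543689 / 1000000"
      using trib by (intro cubic_mono) auto
    then show False
      using trib by (simp add: power_divide)
  qed
  show "trib < 54369 / 100000"
  proof (rule ccontr)
    assume "\<not> ?thesis"
    then have "trib ^ 3 + trib ^ 2 + trib \<ge> (54369 / 100000) ^ 3 + (54369 / 100000) ^ 2 + 54369 / 100000"
      using trib by (intro cubic_mono) auto
    then show False
      using trib by (simp add: power_divide)
  qed
qed

lemma trib_sq_bounds: "295597 / 1000000 < trib ^ 2" "trib ^ 2 < 2956 / 10000"
proof -
  have "(543689 / 1000000) ^ 2 < trib ^ 2"
    using trib_bounds by (intro power_strict_mono) auto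
  then show "295597 / 1000000 < trib ^ 2"
    by (simp add: power_divide)
  have "trib ^ 2 < (54369 / 100000) ^ 2"
    using trib_bounds by (intro power_strict_mono) auto
  then show "trib ^ 2 < 2956 / 10000"
    by (simp add: power_divide)
qed

text \<open>A left eigenvector of the substitution matrix, for the eigenvalue \<open>trib\<close>.\<close>

definition wt :: "3 \<Rightarrow> real" where
  "wt a = (if a = 1 then 1 else if a = 2 then trib + trib ^ 2 else trib)"

definition ht :: "int^3 \<Rightarrow> real" where
  "ht q = of_int (q $ 1) * wt 1 + of_int (q $ 2) * wt 2 + of_int (q $ 3) * wt 3"

definition stepped :: "tile set" where
  "stepped = {(q, k). 0 \<le> ht q \<and> ht q < wt k}"

section \<open>Heights under the substitution\<close>

lemma wt_simps: "wt 1 = 1" "wt 2 = trib + trib ^ 2" "wt 3 = trib"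
  by (simp_all add: wt_def)

lemma wt_pos: "0 < wt a"
  using trib(1) by (simp add: wt_def add_pos_pos)

lemma ht_add [simp]: "ht (p + q) = ht p + ht q"
  and ht_diff [simp]: "ht (p - q) = ht p - ht q"
  and ht_uminus [simp]: "ht (- p) = - ht p"
  and ht_zero [simp]: "ht 0 = 0"
  by (simp_all add: ht_def algebra_simps)

lemma ht_axis [simp]: "ht (axis a 1) = wt a"
  using exhaust_3[of a] by (auto simp: ht_def axis_def)

lemma subst_matrix_mult: "subst_matrix *v vector [a, b, c] = vector [b, c, a - b - c]"
  by (simp add: vec_eq_iff forall_3 matrix_vector_mult_def sum_3 subst_matrix_def)

lemma vec3_cases: obtains a b c where "(q :: int^3) = vector [a, b, c]"
proof -
  have "q = vector [q $ 1, q $ 2, q $ 3]"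
    by (simp add: vec_eq_iff forall_3)
  then show ?thesis
    using that by blast
qed

lemma ht_vector: "ht (vector [a, b, c]) = of_int a + of_int b * (trib + trib ^ 2) + of_int c * trib"
  by (simp add: ht_def wt_simps)

lemma ht_subst_matrix: "ht (subst_matrix *v q) = trib * ht q"
proof -
  obtain a b c where q: "q = vector [a, b, c]"
    by (rule vec3_cases)
  have "trib * ht q - ht (subst_matrix *v q) = of_int (b) * (trib ^ 3 + trib ^ 2 + trib - 1)"
    unfolding q subst_matrix_mult ht_vector by (simp add: algebra_simps power2_eq_square power3_eq_cube)
  then show ?thesis
    using trib by simp
qed

lemma column_vectors: "column 2 subst_matrix = vector [1, 0, -1]" "column 3 subst_matrix = vector [0, 1, -1]"
  by (simp_all add: vec_eq_iff forall_3 column_def subst_matrix_def)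

lemma ht_columns: "ht (column 2 subst_matrix) = 1 - trib" "ht (column 3 subst_matrix) = trib ^ 2"
  by (simp_all add: column_vectors ht_vector)

lemma trib_prod: "trib * (trib + trib ^ 2) = 1 - trib"
  using trib by (simp add: power2_eq_square power3_eq_cube algebra_simps)

text \<open>On heights a substitution step is multiplication by \<open>trib\<close> followed by a
  shift. Type 1 goes to the bands [0, trib) of type 3, [1 - trib, 1) of type 1 and [trib ^ 2, trib +
  trib ^ 2) of type 2; types 2 and 3 go to the complementary bands [0, 1 - trib) of type 1 and [0,
  trib ^ 2) of type 2.\<close>

lemma tiling_subset: "tiling \<subseteq> stepped"
proof -
  have step: "t' \<in> stepped" if "t \<in> stepped" "t' \<in> subst_tile t" for t t'
  proof -
    obtain q k where t: "t = (q, k)" by (cases t)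
    have h: "0 \<le> ht q" "ht q < wt k"
      using that t by (auto simp: stepped_def)
    have h2: "0 \<le> trib * ht q" "trib * ht q < trib * wt k"
      using h trib(1) by auto
    consider "k = 1" | "k = 2" | "k = 3"
      using exhaust_3 by blast
    then show ?thesis
    proof cases
      case 1
      then show ?thesis
        using that h2 trib_bounds trib_sq_bounds
        by (auto simp: t Let_def stepped_def ht_subst_matrix ht_columns wt_simps)
    next
      case 2
      then show ?thesis
        using that h2 trib_prod trib(1)
        by (auto simp: t Let_def stepped_def ht_subst_matrix ht_columns wt_simps)
    next
      case 3
      have "trib * trib = trib ^ 2" by (simp add: power2_eq_square)
      then show ?thesis
        using that h2 trib(1) 3
        by (auto simp: t Let_def stepped_def ht_subst_matrix ht_columns wt_simps)
    qed
  qed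
  have "patch i \<subseteq> stepped" for i
  proof (induction i)
    case 0
    show ?case
      using wt_pos by (auto simp: stepped_def)
  next
    case (Suc i)
    then show ?case
      unfolding patch.simps using step by blast
  qed
  then show ?thesis
    unfolding tiling_def by blast
qed

lemma tiling_subst: "t \<in> tiling \<Longrightarrow> t' \<in> subst_tile t \<Longrightarrow> t' \<in> tiling"
proof -
  assume "t \<in> tiling" "t' \<in> subst_tile t"
  then obtain i where "t \<in> patch i"
    unfolding tiling_def by blast
  then have "t' \<in> patch (Suc i)"
    using \<open>t' \<in> subst_tile t\<close> unfolding patch.simps by blast
  then show ?thesis
    unfolding tiling_def by blast
qed

section \<open>Tiles near the origin, by computation\<close>

lemma tiling_origin: "(0, k) \<in> tiling"
proof -
  have "(0, k) \<in> patch 0"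
    using exhaust_3[of k] unfolding patch.simps by blast
  then show ?thesis
    unfolding tiling_def by blast
qed

text \<open>The inverse of \<open>subst_matrix\<close> sends (a, b, c) to (a + b + c, a, b). In the
  last two cases a column of the matrix is subtracted before the inverse is applied.\<close>

lemma subst_parents:
  "(vector [a, b, c], 3) \<in> subst_tile (vector [a + b + c, a, b], 1)"
  "(vector [a, b, c], 1) \<in> subst_tile (vector [a + b + c, a, b], 2)"
  "(vector [a, b, c], 2) \<in> subst_tile (vector [a + b + c, a, b], 3)"
  "(vector [a, b, c], 1) \<in> subst_tile (vector [a + b + c, a - 1, b], 1)"
  "(vector [a, b, c], 2) \<in> subst_tile (vector [a + b + c, a, b - 1], 1)"
  by (simp_all add: Let_def subst_matrix_mult column_vectors vec_eq_iff forall_3)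

lemmas tiling_parents = subst_parents[THEN tiling_subst[rotated]]

text \<open>The tile of type \<open>k\<close> at \<open>(a, b, c)\<close> is followed back through the substitution. Comparing the
  integer approximation \<open>1000000 * a + 839287 * b + 543689 * c\<close> of \<open>10 ^ 6 * ht\<close> selects the one of the two
  possible parents that lies in the discrete plane; soundness does not depend on this choice.\<close>

primrec descends :: "nat \<Rightarrow> int \<Rightarrow> int \<Rightarrow> int \<Rightarrow> int \<Rightarrow> bool" where
  "descends 0 a b c k \<longleftrightarrow> a = 0 \<and> b = 0 \<and> c = 0"
| "descends (Suc n) a b c k \<longleftrightarrow>
    (if a = 0 \<and> b = 0 \<and> c = 0 then True
     else if k = 3 then descends n (a + b + c) a b 1
     else if k = 1 then
       (if 1000000 * a + 839287 * b + 543689 * c < 456311 then descends n (a + b + c) a b 2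
        else descends n (a + b + c) (a - 1) b 1)
     else
       (if 1000000 * a + 839287 * b + 543689 * c < 295598 then descends n (a + b + c) a b 3
        else descends n (a + b + c) a (b - 1) 1))"

text \<open>The three types are treated together because a parent usually has another type.\<close>

lemma descends_tiling:
  "(descends n a b c 1 \<longrightarrow> (vector [a, b, c], 1) \<in> tiling) \<and>
   (descends n a b c 2 \<longrightarrow> (vector [a, b, c], 2) \<in> tiling) \<and>
   (descends n a b c 3 \<longrightarrow> (vector [a, b, c], 3) \<in> tiling)"
proof (induction n arbitrary: a b c)
  have z: "(vector [0, 0, 0], k) \<in> tiling" for k
  proof -
    have "(vector [0, 0, 0] :: int^3) = 0"
      by (simp add: vec_eq_iff forall_3)
    then show ?thesis
      using tiling_origin by simp
  qed
  case 0
  show ?case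
    by (auto intro: z)
  case (Suc n)
  show ?case
  proof (cases "a = 0 \<and> b = 0 \<and> c = 0")
    case True
    then show ?thesis
      by (simp only: z simp_thms)
  next
    case False
    then show ?thesis
      using Suc.IH[of "a + b + c" a b] Suc.IH[of "a + b + c" "a - 1" b] Suc.IH[of "a + b + c" a "b - 1"]
        tiling_parents[of a b c]
      by (simp only: descends.simps if_False) auto
  qed
qed

text \<open>The three exceptions are the excluded points with \<open>ht q = wt k\<close>, which the rounding does not
  separate from the discrete plane.\<close>

definition small_tiles :: bool where
  "small_tiles \<longleftrightarrow> (\<forall>b \<in> set [-3..3]. \<forall>c \<in> set [-4..4].
     let y = 839287 * b + 543689 * c in
     \<forall>a \<in> set [- ((y + 50) div 1000000)..1 + (50 - y) div 1000000].
     let h = 1000000 * a + y in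
     (a = 1 \<and> b = 0 \<and> c = 0 \<or> descends 12 a b c 1) \<and>
     (h \<le> 839350 \<longrightarrow> a = 0 \<and> b = 1 \<and> c = 0 \<or> descends 12 a b c 2) \<and>
     (h \<le> 543750 \<longrightarrow> a = 0 \<and> b = 0 \<and> c = 1 \<or> descends 12 a b c 3))"

text \<open>Pure evaluation: twelve steps back lead to the origin from every candidate other than
  the three exceptions.\<close>

lemma small_tiles: small_tiles
  unfolding small_tiles_def eval_nat_numeral by code_simp

text \<open>The integer \<open>1000000 * a + y\<close> differs from the scaled height by at most 13
  = 3 * 3 + 4 * 1, the error of the rounded weights. The wider margins in \<open>small_tiles\<close>
  absorb this error.\<close>

lemma small_stepped_tiling:
  assumes "(vector [a, b, c], k) \<in> stepped" "\<bar>b\<bar> \<le> 3" "\<bar>c\<bar> \<le> 4"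
  shows "(vector [a, b, c], k) \<in> tiling"
proof -
  define y where "y = 839287 * b + 543689 * c"
  have bc: "b \<in> set [-3..3]" "c \<in> set [-4..4]"
    using assms by auto
  have r: "\<bar>of_int b * (1000000 * (trib + trib ^ 2) - 839287)\<bar> \<le> 3 * (3::real)"
       "\<bar>of_int c * (1000000 * trib - 543689)\<bar> \<le> 4 * (1::real)"
  proof -
    have "real_of_int \<bar>b\<bar> \<le> 3" "real_of_int \<bar>c\<bar> \<le> 4"
      using assms(2,3) by linarith+
    moreover have "\<bar>1000000 * (trib + trib ^ 2) - 839287\<bar> \<le> 3" "\<bar>1000000 * trib - 543689\<bar> \<le> 1"
      using trib_bounds trib_sq_bounds unfolding abs_le_iff by (simp_all add: algebra_simps)
    ultimately show "\<bar>of_int b * (1000000 * (trib + trib ^ 2) - 839287)\<bar> \<le> 3 * (3::real)"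
       "\<bar>of_int c * (1000000 * trib - 543689)\<bar> \<le> 4 * (1::real)"
      unfolding abs_mult by (intro mult_mono; simp)+
  qed
  have h: "0 \<le> ht (vector [a, b, c])" "ht (vector [a, b, c]) < wt k"
    using assms by (auto simp: stepped_def)
  have y: "\<bar>of_int (1000000 * a + y) - 1000000 * ht (vector [a, b, c])\<bar> \<le> 13"
    using r unfolding ht_vector y_def abs_le_iff by (auto simp: algebra_simps)
  have w1: "wt k \<le> 1"
    using trib_bounds trib_sq_bounds by (simp add: wt_def)
  have "real_of_int (1000000 * a + y) \<le> 1000050" "real_of_int (1000000 * a + y) \<ge> - 50"
    using y h w1 by linarith+
  then have "a \<in> set [- ((y + 50) div 1000000)..1 + (50 - y) div 1000000]"
    by auto
  then have S: "a = 1 \<and> b = 0 \<and> c = 0 \<or> descends 12 a b c 1"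
     "1000000 * a + y \<le> 839350 \<Longrightarrow> a = 0 \<and> b = 1 \<and> c = 0 \<or> descends 12 a b c 2"
     "1000000 * a + y \<le> 543750 \<Longrightarrow> a = 0 \<and> b = 0 \<and> c = 1 \<or> descends 12 a b c 3"
    using small_tiles bc unfolding small_tiles_def Let_def y_def by blast+
  consider "k = 1" | "k = 2" | "k = 3"
    using exhaust_3 by blast
  then show ?thesis
  proof cases
    case 1
    then have "\<not> (a = 1 \<and> b = 0 \<and> c = 0)"
      using h by (auto simp: ht_vector wt_simps)
    then show ?thesis
      using S(1) descends_tiling 1 by blast
  next
    case 2
    then have "\<not> (a = 0 \<and> b = 1 \<and> c = 0)"
      using h by (auto simp: ht_vector wt_simps)
    moreover have "real_of_int (1000000 * a + y) \<le> 839350"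
      using y h 2 trib_bounds trib_sq_bounds unfolding wt_simps 2 by linarith
    ultimately show ?thesis
      using S(2) descends_tiling 2 by (metis of_int_le_numeral_iff)
  next
    case 3
    then have "\<not> (a = 0 \<and> b = 0 \<and> c = 1)"
      using h by (auto simp: ht_vector wt_simps)
    moreover have "real_of_int (1000000 * a + y) \<le> 543750"
      using y h 3 trib_bounds trib_sq_bounds unfolding wt_simps 3 by linarith
    ultimately show ?thesis
      using S(3) descends_tiling 3 by (metis of_int_le_numeral_iff)
  qed
qed

text \<open>The conjugate eigenvalue of modulus \<open>sqrt trib\<close>: the passage to the parent tile multiplies
  \<open>of_int b + conj_root * of_int c\<close> by \<open>- cnj conj_root\<close>, up to a bounded error.\<close>

definition conj_root :: complex where
  "conj_root = Complex ((trib + trib ^ 2) / 2) (sqrt (trib - ((trib + trib ^ 2) / 2) ^ 2))"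

section \<open>The complex eigenvalues and the contraction of parents\<close>

lemma conj_root_disc: "((trib + trib ^ 2) / 2) ^ 2 \<le> 1762 / 10000"
proof -
  have "((trib + trib ^ 2) / 2) ^ 2 \<le> (8393 / 20000) ^ 2"
    using trib_bounds trib_sq_bounds by (intro power_mono) auto
  then show ?thesis
    by (simp add: power_divide)
qed

text \<open>\<open>- conj_root\<close> is a complex eigenvalue of the inverse of
  \<open>subst_matrix\<close>: its sum and product with the conjugate are the ones dictated by the
  cubic for \<open>trib\<close>. The bound \<open>conj_root_disc\<close> makes the radicand in the
  definition nonnegative.\<close>

lemma conj_root:
  "Re conj_root = (trib + trib ^ 2) / 2" "Im conj_root ^ 2 = trib - (Re conj_root) ^ 2"
  "cmod conj_root = sqrt trib"
  "conj_root + cnj conj_root = of_real (trib + trib ^ 2)" "conj_root * cnj conj_root = of_real trib"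
proof -
  show r: "Re conj_root = (trib + trib ^ 2) / 2" "Im conj_root ^ 2 = trib - (Re conj_root) ^ 2"
    using conj_root_disc trib_bounds by (simp_all add: conj_root_def)
  then show m: "cmod conj_root = sqrt trib"
    by (simp add: cmod_def)
  show "conj_root + cnj conj_root = of_real (trib + trib ^ 2)"
    unfolding complex_add_cnj r by simp
  show "conj_root * cnj conj_root = of_real trib"
    using m trib(1) by (simp flip: complex_norm_square of_real_power)
qed

text \<open>The size in the plane that the inverse substitution contracts. The first coordinate is
  omitted, since it is recovered from the other two and the height.\<close>

definition conj_size :: "int^3 \<Rightarrow> real" where
  "conj_size q = cmod (of_int (q $ 2) + conj_root * of_int (q $ 3))"

lemma cmod_real_plus: "(cmod (of_real x + conj_root * of_real y)) ^ 2 = x ^ 2 + (trib + trib ^ 2) * x * y + trib * y ^ 2"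
proof -
  have "(cmod (of_real x + conj_root * of_real y)) ^ 2 = (x + Re conj_root * y) ^ 2 + (Im conj_root * y) ^ 2"
    by (simp add: cmod_power2)
  also have "\<dots> = x ^ 2 + (2 * Re conj_root) * x * y + ((Re conj_root) ^ 2 + (Im conj_root) ^ 2) * y ^ 2"
    by (simp add: power2_eq_square algebra_simps)
  finally show ?thesis
    unfolding conj_root by simp
qed

text \<open>The squared size is a positive definite quadratic form in the last two coordinates.
  Completing the square in one of them bounds the other; the remaining coefficient
  \<open>trib - r ^ 2\<close> exceeds 36 / 100.\<close>

lemma conj_size_small:
  assumes "conj_size q \<le> 29 / 10"
  shows "\<bar>q $ 2\<bar> \<le> 3" "\<bar>q $ 3\<bar> \<le> 4"
proof -
  define x y where "x = real_of_int (q $ 2)" and "y = real_of_int (q $ 3)"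
  define r where "r = (trib + trib ^ 2) / 2"
  have r2_eq: "2 * r = trib + trib ^ 2"
    by (simp add: r_def)
  have "(conj_size q) ^ 2 \<le> (29 / 10) ^ 2"
    using assms by (intro power_mono) (auto simp: conj_size_def)
  then have le: "x ^ 2 + (2 * r) * x * y + trib * y ^ 2 \<le> 841 / 100"
    using cmod_real_plus[of x y] unfolding r2_eq by (simp add: conj_size_def x_def y_def power_divide)
  have r2: "r ^ 2 \<le> 1762 / 10000"
    unfolding r_def by (rule conj_root_disc)
  have "(x + r * y) ^ 2 + (trib - r ^ 2) * y ^ 2 \<le> 841 / 100"
    using le by (simp add: power2_eq_square algebra_simps)
  then have "(trib - r ^ 2) * y ^ 2 \<le> 841 / 100"
    using zero_le_power2[of "x + r * y"] by linarith
  moreover have "(36 / 100) * y ^ 2 \<le> (trib - r ^ 2) * y ^ 2"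
    using r2 trib_bounds by (intro mult_right_mono) auto
  ultimately have y: "y ^ 2 < 5 ^ 2"
    by simp
  have "trib * x ^ 2 + 2 * r * trib * x * y + trib ^ 2 * y ^ 2 = trib * (x ^ 2 + 2 * r * x * y + trib * y ^ 2)"
    by (simp add: power2_eq_square algebra_simps)
  also have "\<dots> \<le> trib * (841 / 100)"
    using le trib by (intro mult_left_mono) auto
  finally have "(trib * y + r * x) ^ 2 + (trib - r ^ 2) * x ^ 2 \<le> trib * (841 / 100)"
    by (simp add: power2_eq_square algebra_simps)
  then have "(trib - r ^ 2) * x ^ 2 \<le> 54369 / 100000 * 841 / 100"
    using zero_le_power2[of "trib * y + r * x"] trib_bounds by linarith
  moreover have "(36 / 100) * x ^ 2 \<le> (trib - r ^ 2) * x ^ 2"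
    using r2 trib_bounds by (intro mult_right_mono) auto
  ultimately have x: "x ^ 2 < 4 ^ 2"
    by simp
  have "\<bar>x\<bar> < 4" "\<bar>y\<bar> < 5"
    using x y by (metis abs_numeral power2_abs power2_less_imp_less abs_ge_zero zero_le_numeral)+
  then show "\<bar>q $ 2\<bar> \<le> 3" "\<bar>q $ 3\<bar> \<le> 4"
    unfolding x_def y_def by linarith+
qed

text \<open>The height bands described at \<open>tiling_subset\<close> exhaust each type, so the
  height of \<open>q\<close> selects the parent. When the first coordinate is expressed through the
  height, the conjugate coordinate of the parent becomes \<open>- cnj conj_root\<close> times that
  of \<open>q\<close> plus an error of modulus at most \<open>sqrt trib\<close>.\<close>

lemma stepped_parent:
  assumes "(q, k) \<in> stepped"
  obtains q' k' where "(q', k') \<in> stepped" "(q, k) \<in> subst_tile (q', k')"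
    "conj_size q' \<le> sqrt trib * (conj_size q + 1)"
proof -
  obtain a b c where q: "q = vector [a, b, c]"
    by (rule vec3_cases)
  define p where "p = (vector [a + b + c, a, b] :: int^3)"
  have hp: "trib * ht p = ht q"
    using ht_subst_matrix[of p] by (simp add: p_def q subst_matrix_mult)
  have h: "0 \<le> ht q" "ht q < wt k"
    using assms by (auto simp: stepped_def)
  have sq: "trib * trib = trib ^ 2" "trib * trib ^ 2 = trib ^ 3"
    by (simp_all add: power2_eq_square power3_eq_cube)
  have hle: "x \<le> ht p \<longleftrightarrow> trib * x \<le> ht q" "ht p < x \<longleftrightarrow> ht q < trib * x" for x
    using trib(1) hp by (metis mult_le_cancel_left_pos, metis mult_less_cancel_left_pos)
  have size: "conj_size q' \<le> sqrt trib * (conj_size q + 1)"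
    if "q' $ 2 = a - e" "q' $ 3 = b - e'"
      "cmod (of_real (ht q - e) - conj_root * of_int e') \<le> sqrt trib" for q' e e'
  proof -
    have "a = ht q - b * (trib + trib ^ 2) - c * trib"
      by (simp add: q ht_vector)
    then have "complex_of_real a = complex_of_real (ht q - b * (trib + trib ^ 2) - c * trib)"
      by simp
    then have "complex_of_int a = of_real (ht q) - of_int b * of_real (trib + trib ^ 2) - of_int c * of_real trib"
      unfolding of_real_diff of_real_mult of_real_of_int_eq .
    then have "complex_of_int a =
        of_real (ht q) - of_int b * (conj_root + cnj conj_root) - of_int c * (conj_root * cnj conj_root)"
      unfolding conj_root(4,5) .
    then have "of_int (q' $ 2) + conj_root * of_int (q' $ 3) =
       - cnj conj_root * (of_int b + conj_root * of_int c) + (of_real (ht q - e) - conj_root * of_int e')"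
      unfolding that by (simp add: algebra_simps)
    then have "conj_size q' \<le> cmod (- cnj conj_root * (of_int b + conj_root * of_int c))
       + cmod (of_real (ht q - e) - conj_root * of_int e')"
      unfolding conj_size_def by (simp only: norm_triangle_ineq)
    also have "cmod (- cnj conj_root * (of_int b + conj_root * of_int c)) = sqrt trib * conj_size q"
      by (simp add: norm_mult conj_root(3) conj_size_def q)
    finally show ?thesis
      using that(3) by (simp add: algebra_simps)
  qed
  have e0: "cmod (of_real x - conj_root * of_int 0) \<le> sqrt trib" if "\<bar>x\<bar> \<le> trib" for x
  proof -
    have "trib \<le> sqrt trib"
      using trib_bounds by (intro real_le_rsqrt) (simp add: power2_eq_square mult_left_le)
    then show ?thesis
      using that by simp
  qed
  \<comment> \<open>The error is the distance from \<open>conj_root\<close> to a point of the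
    interval [0, trib + trib ^ 2]. The real part of \<open>conj_root\<close> is the midpoint, so the
    distance is largest at the end points, where it is \<open>sqrt trib\<close>.\<close>
  have e1: "cmod (of_real x - conj_root * of_int 1) \<le> sqrt trib" if "0 \<le> x" "x \<le> trib + trib ^ 2" for x
  proof -
    have "(cmod (of_real x + conj_root * of_real (- 1))) ^ 2 = trib - x * (trib + trib ^ 2 - x)"
      unfolding cmod_real_plus by (simp add: power2_eq_square algebra_simps)
    also have "\<dots> \<le> trib"
      using that by simp
    finally show ?thesis
      by (simp add: real_le_rsqrt)
  qed
  consider (a1) "k = 1" "ht q < 1 - trib" | (a2) "k = 1" "1 - trib \<le> ht q"
    | (b1) "k = 2" "ht q < trib ^ 2" | (b2) "k = 2" "trib ^ 2 \<le> ht q" | (c1) "k = 3"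
    using exhaust_3[of k] by fastforce
  then show ?thesis
  proof cases
    case a1
    have "(p, 2) \<in> stepped"
      using h a1 hle[of 0] hle[of "wt 2"] trib_prod by (simp add: stepped_def wt_simps)
    moreover have "\<bar>ht q\<bar> \<le> trib"
      using h a1 trib_bounds by simp
    ultimately show ?thesis
      using that[of p 2] subst_parents(2)[of a b c] size[of p 0 0] e0 a1 by (simp add: p_def q)
  next
    case a2
    define p' where "p' = (vector [a + b + c, a - 1, b] :: int^3)"
    have "ht p' = ht p - wt 2"
      by (simp add: p'_def p_def ht_vector wt_simps algebra_simps)
    then have "(p', 1) \<in> stepped"
      using h a2 hle[of "wt 1 + wt 2"] hle[of "wt 2"] trib_prod by (simp add: stepped_def wt_simps algebra_simps)
    moreover have "\<bar>ht q - 1\<bar> \<le> trib"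
      using h a2 by (simp add: wt_simps)
    ultimately show ?thesis
      using that[of p' 1] subst_parents(4)[of a b c] size[of p' 1 0] e0[of "ht q - 1"] a2 by (simp add: p'_def q)
  next
    case b1
    have "(p, 3) \<in> stepped"
      using h b1 hle[of 0] hle[of "wt 3"] sq by (simp add: stepped_def wt_simps)
    moreover have "\<bar>ht q\<bar> \<le> trib"
      using h b1 trib_bounds trib_sq_bounds by simp
    ultimately show ?thesis
      using that[of p 3] subst_parents(3)[of a b c] size[of p 0 0] e0 b1 by (simp add: p_def q)
  next
    case b2
    define p' where "p' = (vector [a + b + c, a, b - 1] :: int^3)"
    have "ht p' = ht p - wt 3"
      by (simp add: p'_def p_def ht_vector wt_simps algebra_simps)
    then have "(p', 1) \<in> stepped"
      using h b2 hle[of "wt 1 + wt 3"] hle[of "wt 3"] sq by (simp add: stepped_def wt_simps algebra_simps)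
    moreover have "ht q \<le> trib + trib ^ 2"
      using h b2 by (simp add: wt_simps)
    ultimately show ?thesis
      using that[of p' 1] subst_parents(5)[of a b c] size[of p' 0 1] e1 h b2 by (simp add: p'_def q)
  next
    case c1
    have "(p, 1) \<in> stepped"
      using h c1 hle[of 0] hle[of "wt 1"] by (simp add: stepped_def wt_simps)
    moreover have "\<bar>ht q\<bar> \<le> trib"
      using h c1 by (simp add: wt_simps)
    ultimately show ?thesis
      using that[of p 1] subst_parents(1)[of a b c] size[of p 0 0] e0 c1 by (simp add: p_def q)
  qed
qed

text \<open>The estimate for parents has the fixed point sqrt trib / (1 - sqrt trib), about 2.81,
  which lies below 29 / 10. Above 29 / 10 every passage to a parent lowers the size bound by at
  least 1 / 50, so finitely many steps reach the computed region.\<close>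

theorem tiling_eq_stepped: "tiling = stepped"
proof
  show "stepped \<subseteq> tiling"
  proof -
    have "(q, k) \<in> tiling" if "(q, k) \<in> stepped" "conj_size q \<le> 29 / 10 + real m / 50" for q k m
      using that
    proof (induction m arbitrary: q k)
      case 0
      obtain a b c where q: "q = vector [a, b, c]"
        by (rule vec3_cases)
      show ?case
        using small_stepped_tiling[of a b c k] conj_size_small[of q] 0 by (simp add: q)
    next
      case (Suc m)
      obtain q' k' where q': "(q', k') \<in> stepped" "(q, k) \<in> subst_tile (q', k')"
        "conj_size q' \<le> sqrt trib * (conj_size q + 1)"
        using stepped_parent Suc.prems(1) by blast
      have "sqrt trib \<le> 738 / 1000"
        using trib_bounds by (intro real_le_lsqrt) (auto simp: power_divide)
      then have "sqrt trib * (conj_size q + 1) \<le> 738 / 1000 * (29 / 10 + real (Suc m) / 50 + 1)"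
        using Suc.prems(2) trib(1) by (intro mult_mono) (auto simp: conj_size_def)
      also have "\<dots> \<le> 29 / 10 + real m / 50"
        by (simp add: field_simps)
      finally have "(q', k') \<in> tiling"
        using Suc.IH q' by force
      then show ?case
        using q'(2) by (rule tiling_subst)
    qed
    moreover have "\<exists>m. conj_size q \<le> 29 / 10 + real m / 50" for q
    proof -
      obtain m where "50 * conj_size q \<le> real m"
        using real_arch_simple by blast
      then show ?thesis
        by (intro exI[of _ m]) simp
    qed
    ultimately show ?thesis
      by force
  qed
qed (rule tiling_subset)

section \<open>Vertices, arrows and rhombi\<close>

definition pt :: "int^3 \<Rightarrow> real^2" where
  "pt q = proj (\<chi> a. of_int (q $ a))"

definition st :: "3 \<Rightarrow> bool \<Rightarrow> real^2" where
  "st i b = (if b then dir i else - dir i)"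

definition lstep :: "3 \<Rightarrow> bool \<Rightarrow> int^3" where
  "lstep i b = (if b then axis i 1 else - axis i 1)"

text \<open>The degenerate case \<open>x = w\<close> is included and holds along every edge;
  distinctness is assumed separately where it matters.\<close>

definition adj3 :: "real^2 \<Rightarrow> real^2 \<Rightarrow> real^2 \<Rightarrow> bool" where
  "adj3 x y w \<longleftrightarrow> (\<exists>t\<in>tiling. side t x y \<and> side t y w)"

text \<open>A slab whose width is the height of the vector (1, 1, 1), which spans the kernel of the
  projection. It contains exactly one lattice point over each projected lattice point.\<close>

definition level :: "(int^3) set" where
  "level = {q. 0 \<le> ht q \<and> ht q < wt 1 + wt 2 + wt 3}"

lemma proj_coords:
  "proj v $ 1 = sqrt 3 / 2 * (v $ 2 - v $ 1)" "proj v $ 2 = v $ 3 - (v $ 1 + v $ 2) / 2"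
  by (simp_all add: proj_def algebra_simps)

lemma pt_add [simp]: "pt (p + q) = pt p + pt q"
  and pt_uminus [simp]: "pt (- q) = - pt q"
  by (simp_all add: pt_def vec_eq_iff forall_2 proj_coords field_simps)

lemma pt_axis: "pt (axis i 1) = dir i"
proof -
  have "(\<chi> a. of_int ((axis i 1 :: int^3) $ a)) = (axis i 1 :: real^3)"
    by (simp add: vec_eq_iff axis_def)
  then show ?thesis
    by (simp add: pt_def dir_def)
qed

lemma pt_lstep [simp]: "pt (lstep i b) = st i b"
  by (simp add: lstep_def st_def pt_axis)

lemma pt_eq_iff: "pt p = pt q \<longleftrightarrow> p $ 1 - q $ 1 = p $ 2 - q $ 2 \<and> p $ 1 - q $ 1 = p $ 3 - q $ 3"
proof -
  have "pt p = pt q \<longleftrightarrow> real_of_int (p $ 2) - p $ 1 = real_of_int (q $ 2) - q $ 1 \<and>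
      real_of_int (p $ 3) - (real_of_int (p $ 1) + p $ 2) / 2 = real_of_int (q $ 3) - (real_of_int (q $ 1) + q $ 2) / 2"
    by (simp add: pt_def vec_eq_iff forall_2 proj_coords)
  also have "\<dots> \<longleftrightarrow> p $ 1 - q $ 1 = p $ 2 - q $ 2 \<and> p $ 1 - q $ 1 = p $ 3 - q $ 3"
    by (auto simp: field_simps)
  finally show ?thesis .
qed

lemma lstep_nth: "lstep i b $ a = (if a = i then (if b then 1 else - 1) else 0)"
  by (simp add: lstep_def axis_def)

lemma st_not [simp]: "st i (\<not> b) = - st i b"
  by (simp add: st_def)

lemma inner_st: "st i b \<bullet> st j c = (if b = c then 1 else - 1) * (if i = j then 1 else - (1 / 2))"
proof -
  have "\<forall>i j. dir i \<bullet> dir j = (if i = j then 1 else - (1 / 2))"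
    unfolding forall_3 dir_def by (simp add: inner_vec_def sum_2 proj_coords axis_def)
  then show ?thesis
    by (simp add: st_def)
qed

lemma st_inj [simp]: "st i b = st j c \<longleftrightarrow> i = j \<and> b = c"
proof
  assume "st i b = st j c"
  then have "st i b \<bullet> st i b = st i b \<bullet> st j c"
    by simp
  then show "i = j \<and> b = c"
    unfolding inner_st by (auto split: if_splits)
qed simp

lemma st_nonzero [simp]: "st i b \<noteq> 0"
proof
  assume "st i b = 0"
  then have "st i b = st i (\<not> b)"
    by simp
  then show False
    unfolding st_inj by simp
qed

lemma st_eq_minus [simp]: "st i b = - st j c \<longleftrightarrow> i = j \<and> b = (\<not> c)" "- st j c = st i b \<longleftrightarrow> i = j \<and> b = (\<not> c)"
  using st_inj[of i b j "\<not> c"] by auto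

text \<open>The inner product with \<open>st i b\<close> is 1 / 2 or 3 / 2 on the left. If this step
  does not occur on the right, each summand there contributes - 1, - 1 / 2 or 1 / 2, and no two of
  these add up to either value.\<close>

lemma st_sum_cases:
  assumes "st i b + st j c = st i' b' + st j' c'" "i \<noteq> j"
  shows "st i b = st i' b' \<or> st i b = st j' c'"
proof (rule ccontr)
  assume *: "\<not> ?thesis"
  have "st i b \<bullet> st i b + st i b \<bullet> st j c = st i b \<bullet> st i' b' + st i b \<bullet> st j' c'"
    using assms(1) by (simp flip: inner_add_right)
  then show False
    using * assms(2) unfolding inner_st by (auto split: if_splits)
qed

lemma other3: "\<exists>j. j \<noteq> (i :: 3)"
  by (rule exI[of _ "i + 1"]) simp

lemma distinct3_cases:
  assumes "i \<noteq> j" obtains k :: 3 where "k \<noteq> i" "k \<noteq> j"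
proof -
  have "\<forall>i j :: 3. i \<noteq> j \<longrightarrow> - (i + j) \<noteq> i \<and> - (i + j) \<noteq> j"
    unfolding forall_3 by simp
  then show ?thesis
    using assms that by blast
qed

lemma distinct3_third:
  fixes i j k l :: 3
  assumes "i \<noteq> j" "k \<noteq> i" "k \<noteq> j"
  shows "l = i \<or> l = j \<or> l = k"
proof -
  have "\<forall>i j k l :: 3. i \<noteq> j \<longrightarrow> k \<noteq> i \<longrightarrow> k \<noteq> j \<longrightarrow> l = i \<or> l = j \<or> l = k"
    unfolding forall_3 by simp
  then show ?thesis
    using assms by blast
qed

lemma wt_sum:
  assumes "i \<noteq> j" "k \<noteq> i" "k \<noteq> j"
  shows "wt 1 + wt 2 + wt 3 = wt i + wt j + wt k"
proof -
  have "\<forall>i j k :: 3. i \<noteq> j \<longrightarrow> k \<noteq> i \<longrightarrow> k \<noteq> j \<longrightarrow> wt 1 + wt 2 + wt 3 = wt i + wt j + wt k"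
    unfolding forall_3 by simp
  then show ?thesis
    using assms by blast
qed

lemma ht_lstep [simp]: "ht (lstep i b) = (if b then wt i else - wt i)"
  by (simp add: lstep_def)

lemma pt_inj_level:
  assumes "pt p = pt q" "p \<in> level" "q \<in> level"
  shows "p = q"
proof -
  define m where "m = p $ 1 - q $ 1"
  have "ht p = ht q + of_int m * (wt 1 + wt 2 + wt 3)"
  proof -
    have "p $ 1 = q $ 1 + m" "p $ 2 = q $ 2 + m" "p $ 3 = q $ 3 + m"
      using assms(1) unfolding pt_eq_iff m_def by auto
    then show ?thesis
      by (simp add: ht_def algebra_simps)
  qed
  then have "\<bar>of_int m * (wt 1 + wt 2 + wt 3)\<bar> < wt 1 + wt 2 + wt 3"
    using assms by (auto simp: level_def)
  moreover have "wt 1 + wt 2 + wt 3 > 0"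
    using wt_pos by (simp add: add_pos_pos)
  ultimately have "m = 0"
    by (auto simp: abs_mult)
  then show ?thesis
    using assms(1) unfolding pt_eq_iff m_def by (simp add: vec_eq_iff forall_3)
qed

section \<open>Corners, vertices and arrows in the lattice\<close>

definition lcorners :: "tile \<Rightarrow> (int^3) set" where
  "lcorners t = {q. q $ snd t = fst t $ snd t \<and> (\<forall>a. q $ a = fst t $ a \<or> q $ a = fst t $ a + 1)}"

lemma corners_eq: "corners t = pt ` lcorners t"
proof -
  obtain z k where t: "t = (z, k)" by (cases t)
  \<comment> \<open>The real parameters in \<open>corners\<close> take only the values 0 and 1;
    \<open>e\<close> reads them as integers.\<close>
  define e :: "real \<Rightarrow> int" where "e l = (if l = 1 then 1 else 0)" for l
  have *: "proj (\<chi> a. of_int (z $ a)) + l *\<^sub>R dir i + m *\<^sub>R dir j = pt (\<chi> a. z $ a + (if a = i then e l else if a = j then e m else 0))"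
    if "i \<noteq> j" "l \<in> {0, 1}" "m \<in> {0, 1}" for i j l m
  proof -
    have "(\<chi> a. z $ a + (if a = i then e l else if a = j then e m else 0)) = z + (if l = 1 then axis i 1 else 0) + (if m = 1 then axis j 1 else 0)"
      using that by (auto simp: vec_eq_iff axis_def e_def)
    then show ?thesis
      using that by (auto simp: pt_axis) (auto simp: pt_def vec_eq_iff forall_2 proj_coords)
  qed
  have d: "{i, j, k} = UNIV \<longleftrightarrow> i \<noteq> j \<and> k \<noteq> i \<and> k \<noteq> j" for i j
  proof
    assume u: "{i, j, k} = UNIV"
    have "card {i, j, k} = 3"
      unfolding u by simp
    then show "i \<noteq> j \<and> k \<noteq> i \<and> k \<noteq> j"
      by (auto simp: card_insert_if split: if_splits)
  next
    assume "i \<noteq> j \<and> k \<noteq> i \<and> k \<noteq> j"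
    then show "{i, j, k} = UNIV"
      using distinct3_third by auto
  qed
  show ?thesis
  proof (intro equalityI subsetI)
    fix y assume "y \<in> corners t"
    then obtain l m i j where y: "y = proj (\<chi> a. of_int (z $ a)) + l *\<^sub>R dir i + m *\<^sub>R dir j"
      "i \<noteq> j" "k \<noteq> i" "k \<noteq> j" "l \<in> {0, 1}" "m \<in> {0, 1}"
      unfolding t corners.simps d by blast
    then have "y = pt (\<chi> a. z $ a + (if a = i then e l else if a = j then e m else 0))"
      using * by blast
    moreover have "(\<chi> a. z $ a + (if a = i then e l else if a = j then e m else 0)) \<in> lcorners t"
      using y by (auto simp: lcorners_def t e_def)
    ultimately show "y \<in> pt ` lcorners t"
      by blast
  next
    fix y assume "y \<in> pt ` lcorners t"
    then obtain q where q: "q \<in> lcorners t" "y = pt q"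
      by blast
    obtain i where i: "i \<noteq> k"
      using other3 by blast
    obtain j where j: "j \<noteq> i" "j \<noteq> k"
      using distinct3_cases[OF i] by blast
    define l m :: real where "l = of_int (q $ i - z $ i)" and "m = of_int (q $ j - z $ j)"
    have lm: "l \<in> {0, 1}" "m \<in> {0, 1}"
      using q by (auto simp: lcorners_def t l_def m_def)
    have "q = (\<chi> a. z $ a + (if a = i then e l else if a = j then e m else 0))"
      unfolding vec_eq_iff
    proof
      fix a
      have "a = i \<or> a = j \<or> a = k"
        using distinct3_third[of i j k] i j by auto
      then show "q $ a = (\<chi> a. z $ a + (if a = i then e l else if a = j then e m else 0)) $ a"
        using i j q(1) by (auto simp: lcorners_def t l_def m_def e_def)
    qed
    then have "y = proj (\<chi> a. of_int (z $ a)) + l *\<^sub>R dir i + m *\<^sub>R dir j"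
      using *[of i j l m] j lm q by simp
    then show "y \<in> corners t"
      unfolding t corners.simps d using i j lm by blast
  qed
qed

lemma ht_lcorners:
  assumes "q \<in> lcorners (z, k)"
  shows "ht z \<le> ht q" "ht q + wt k \<le> ht z + (wt 1 + wt 2 + wt 3)"
proof -
  have nn: "q $ a = z $ a \<or> q $ a = z $ a + 1" for a
    using assms by (simp add: lcorners_def)
  have *: "of_int (z $ a) * wt a \<le> of_int (q $ a) * wt a" "of_int (q $ a) * wt a \<le> of_int (z $ a) * wt a + wt a" for a
    using nn[of a] wt_pos[of a] by (auto simp: algebra_simps)
  show "ht z \<le> ht q"
    using *(1)[of 1] *(1)[of 2] *(1)[of 3] by (simp add: ht_def)
  have "of_int (q $ k) * wt k = of_int (z $ k) * wt k"
    using assms by (simp add: lcorners_def)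
  then show "ht q + wt k \<le> ht z + (wt 1 + wt 2 + wt 3)"
    using *(2)[of 1] *(2)[of 2] *(2)[of 3] exhaust_3[of k] by (auto simp: ht_def)
qed

lemma lcorners_level: "t \<in> tiling \<Longrightarrow> lcorners t \<subseteq> level"
proof
  fix q assume "t \<in> tiling" "q \<in> lcorners t"
  moreover obtain z k where "t = (z, k)" by (cases t)
  ultimately show "q \<in> level"
    using ht_lcorners[of q z k] by (auto simp: tiling_eq_stepped stepped_def level_def)
qed

text \<open>Every lattice point of the slab is a corner of some tile. The slab splits into bands of
  widths \<open>wt 1\<close>, \<open>wt 2\<close> and \<open>wt 3\<close>, and for the band of type
  k the tile of type k is based at \<open>q\<close>, \<open>q - axis 1 1\<close> or
  \<open>q - axis 1 1 - axis 2 1\<close>.\<close>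

lemma vertices_eq: "vertices = pt ` level"
proof
  show "vertices \<subseteq> pt ` level"
    using lcorners_level by (auto simp: vertices_def corners_eq)
  have "pt q \<in> vertices" if "q \<in> level" for q
  proof -
    have "\<exists>t\<in>tiling. q \<in> lcorners t"
    proof (cases "ht q < wt 1")
      case True
      then have "(q, 1) \<in> tiling"
        using that by (simp add: tiling_eq_stepped stepped_def level_def)
      then show ?thesis
        by (rule bexI[rotated]) (auto simp: lcorners_def)
    next
      case False
      show ?thesis
      proof (cases "ht q < wt 1 + wt 2")
        case True
        then have "(q - axis 1 1, 2) \<in> tiling"
          using that False by (simp add: tiling_eq_stepped stepped_def level_def)
        then show ?thesis
          by (rule bexI[rotated]) (auto simp: lcorners_def axis_def)
      next
        case False
        then have "(q - axis 1 1 - axis 2 1, 3) \<in> tiling"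
          using that by (simp add: tiling_eq_stepped stepped_def level_def)
        then show ?thesis
          by (rule bexI[rotated]) (auto simp: lcorners_def axis_def)
      qed
    qed
    then show ?thesis
      by (auto simp: vertices_def corners_eq)
  qed
  then show "pt ` level \<subseteq> vertices"
    by blast
qed

lemma side_iff:
  "side (z, k) x y \<longleftrightarrow> (\<exists>q i b. q \<in> lcorners (z, k) \<and> q + lstep i b \<in> lcorners (z, k) \<and> i \<noteq> k \<and>
      x = pt q \<and> y = pt q + st i b)" (is "?L \<longleftrightarrow> ?R")
proof
  assume ?L
  then obtain i where i: "i \<noteq> k" "y - x = dir i \<or> y - x = - dir i" and "x \<in> corners (z, k)" "y \<in> corners (z, k)"
    by auto
  then obtain p q where pq: "q \<in> lcorners (z, k)" "p \<in> lcorners (z, k)" "x = pt q" "y = pt p"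
    by (auto simp: corners_eq)
  obtain b where b: "y - x = st i b"
    using i(2) by (metis st_def)
  then have "pt p = pt (q + lstep i b)"
    using pq by (simp add: algebra_simps)
  \<comment> \<open>Both points have the same coordinate \<open>k\<close>, which removes the
    ambiguity along (1, 1, 1).\<close>
  then have "p = q + lstep i b"
  proof -
    have eq: "p $ a - (q + lstep i b) $ a = p $ k - (q + lstep i b) $ k" for a
      using \<open>pt p = _\<close> exhaust_3[of a] exhaust_3[of k] unfolding pt_eq_iff by fastforce
    have "p $ k = (q + lstep i b) $ k"
      using pq i(1) by (simp add: lcorners_def lstep_nth)
    then show ?thesis
      using eq by (simp add: vec_eq_iff)
  qed
  then show ?R
    using pq i b by (metis pt_add pt_lstep)
next
  assume ?R
  then obtain q i b where *: "q \<in> lcorners (z, k)" "q + lstep i b \<in> lcorners (z, k)" "i \<noteq> k"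
      "x = pt q" "y = pt (q + lstep i b)"
    by auto
  then have "x \<in> corners (z, k)" "y \<in> corners (z, k)"
    unfolding corners_eq by blast+
  then show ?L
    using * by (auto simp: st_def)
qed

lemma side_sym: "side t x y \<Longrightarrow> side t y x"
proof -
  assume "side t x y"
  moreover obtain z k where t: "t = (z, k)" by (cases t)
  ultimately obtain q i b where q: "q \<in> lcorners t" "q + lstep i b \<in> lcorners t" "i \<noteq> k" "x = pt q" "y = pt q + st i b"
    unfolding t side_iff by blast
  have "q + lstep i b + lstep i (\<not> b) = q"
    by (simp add: vec_eq_iff lstep_nth)
  then have "q + lstep i b + lstep i (\<not> b) \<in> lcorners t"
    using q(1) by (simp only:)
  then show ?thesis
    unfolding t side_iff using q t by (intro exI[of _ "q + lstep i b"] exI[of _ i] exI[of _ "\<not> b"]) simp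
qed

lemma arrows_sym: "(x, y) \<in> arrows \<Longrightarrow> (y, x) \<in> arrows"
  unfolding arrows_def using side_sym by blast

lemma arrowsE:
  assumes "(x, y) \<in> arrows"
  obtains q i b where "q \<in> level" "q + lstep i b \<in> level" "x = pt q" "y = x + st i b"
proof -
  obtain z k where "(z, k) \<in> tiling" "side (z, k) x y"
    using assms by (auto simp: arrows_def simp del: side.simps)
  then show ?thesis
    unfolding side_iff using lcorners_level that by blast
qed

lemma arrows_vertices: "(x, y) \<in> arrows \<Longrightarrow> x \<in> vertices \<and> y \<in> vertices"
  by (metis arrowsE vertices_eq imageI pt_add pt_lstep)

text \<open>A negative step means that \<open>q\<close> is the upper end in its direction, so the
  base of the tile lies one step below \<open>q\<close> there.\<close>

lemma corner_tile:
  assumes "i \<noteq> j" "k \<noteq> i" "k \<noteq> j"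
  shows "{q, q + lstep i b, q + lstep j c} \<subseteq> lcorners (z, k) \<longleftrightarrow>
    z = q + (if b then 0 else - axis i 1) + (if c then 0 else - axis j 1)" (is "?L \<longleftrightarrow> ?R")
proof -
  have all: "(\<forall>a. P a) \<longleftrightarrow> P i \<and> P j \<and> P k" for P
    using distinct3_third[OF assms] by metis
  have mem: "v \<in> lcorners (z, k) \<longleftrightarrow> v $ k = z $ k \<and> (v $ i = z $ i \<or> v $ i = z $ i + 1) \<and> (v $ j = z $ j \<or> v $ j = z $ j + 1)" for v
    by (auto simp: lcorners_def all)
  have nth: "lstep i b $ i = (if b then 1 else - 1)" "lstep i b $ j = 0" "lstep i b $ k = 0"
    "lstep j c $ j = (if c then 1 else - 1)" "lstep j c $ i = 0" "lstep j c $ k = 0"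
    "(axis i 1 :: int^3) $ i = 1" "(axis i 1 :: int^3) $ j = 0" "(axis i 1 :: int^3) $ k = 0"
    "(axis j 1 :: int^3) $ i = 0" "(axis j 1 :: int^3) $ j = 1" "(axis j 1 :: int^3) $ k = 0"
    using assms by (auto simp: lstep_nth axis_def)
  have "?L \<longleftrightarrow> q $ k = z $ k \<and> q $ i = z $ i + (if b then 0 else 1) \<and> q $ j = z $ j + (if c then 0 else 1)"
    unfolding insert_subset mem vector_add_component nth by (cases b; cases c) auto
  also have "\<dots> \<longleftrightarrow> ?R"
    unfolding vec_eq_iff all vector_add_component if_distrib[of "\<lambda>v. v $ _"] vector_uminus_component zero_index nth
    by (cases b; cases c) auto
  finally show "?L \<longleftrightarrow> ?R" .
qed

text \<open>For the converse, the lower end \<open>z\<close> of the edge has height below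
  \<open>wt j + wt k\<close>. If the height is below \<open>wt k\<close>, the edge is a side of the
  tile of type \<open>k\<close> at \<open>z\<close>; otherwise it is a side of the tile of type
  \<open>j\<close> based one step below \<open>z\<close> in direction \<open>k\<close>.\<close>

lemma arrow_iff:
  assumes "q \<in> level"
  shows "(pt q, pt q + st i b) \<in> arrows \<longleftrightarrow> q + lstep i b \<in> level"
proof
  assume "(pt q, pt q + st i b) \<in> arrows"
  then obtain q' i' b' where "q' \<in> level" "q' + lstep i' b' \<in> level" "pt q = pt q'" "pt q + st i b = pt q + st i' b'"
    by (rule arrowsE)
  then show "q + lstep i b \<in> level"
    using pt_inj_level assms by auto
next
  assume l: "q + lstep i b \<in> level"
  obtain j where j: "j \<noteq> i"
    using other3 by blast
  obtain k where k: "k \<noteq> i" "k \<noteq> j"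
    using distinct3_cases[OF j] by blast
  define z where "z = q + (if b then 0 else - axis i 1)"
  have h: "0 \<le> ht z" "ht z < wt j + wt k"
    using l assms wt_sum[of i j k] j k wt_pos[of i] by (auto simp: level_def z_def)
  have "\<exists>j' k' c. j' \<noteq> i \<and> k' \<noteq> i \<and> k' \<noteq> j' \<and> (z + (if c then 0 else - axis j' 1), k') \<in> tiling"
  proof (cases "ht z < wt k")
    case True
    then show ?thesis
      using h j k by (intro exI[of _ j] exI[of _ k] exI[of _ True]) (simp add: tiling_eq_stepped stepped_def)
  next
    case False
    then have "(z + (- axis k 1), j) \<in> tiling"
      using h by (simp add: tiling_eq_stepped stepped_def)
    then show ?thesis
      using j k by (intro exI[of _ k] exI[of _ j] exI[of _ False]) simp
  qed
  then obtain j' k' c where j: "j' \<noteq> i" and k: "k' \<noteq> i" "k' \<noteq> j'"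
    and "(z + (if c then 0 else - axis j' 1), k') \<in> tiling"
    by blast
  moreover have "{q, q + lstep i b, q + lstep j' c} \<subseteq> lcorners (z + (if c then 0 else - axis j' 1), k')"
    using corner_tile[of i j' k' q b c] j k by (simp add: z_def)
  ultimately have "\<exists>t\<in>tiling. side t (pt q) (pt q + st i b)"
    using k by (metis side_iff insert_subset)
  then show "(pt q, pt q + st i b) \<in> arrows"
    by (simp add: arrows_def del: side.simps)
qed

lemma adj3_iff:
  assumes q: "q \<in> level" and "i \<noteq> j" "k \<noteq> i" "k \<noteq> j"
  shows "adj3 (pt q + st i b) (pt q) (pt q + st j c) \<longleftrightarrow>
    (q + (if b then 0 else - axis i 1) + (if c then 0 else - axis j 1), k) \<in> tiling"
proof
  assume "adj3 (pt q + st i b) (pt q) (pt q + st j c)"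
  then obtain z k' where t: "(z, k') \<in> tiling"
    and "side (z, k') (pt q + st i b) (pt q)" "side (z, k') (pt q) (pt q + st j c)"
    unfolding adj3_def by (metis surj_pair)
  then have "side (z, k') (pt q) (pt q + st i b)" "side (z, k') (pt q) (pt q + st j c)"
    using side_sym by blast+
  then obtain p i' b' r j' c' where
    p: "p \<in> lcorners (z, k')" "p + lstep i' b' \<in> lcorners (z, k')" "i' \<noteq> k'" "pt q = pt p" "pt q + st i b = pt p + st i' b'"
    and r: "r \<in> lcorners (z, k')" "r + lstep j' c' \<in> lcorners (z, k')" "j' \<noteq> k'" "pt q = pt r" "pt q + st j c = pt r + st j' c'"
    unfolding side_iff by blast
  have eq: "p = q" "r = q"
    using pt_inj_level[of q] p(1,4) r(1,4) q lcorners_level[OF t] by blast+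
  have "st i b = st i' b'" "st j c = st j' c'"
    using p(5) r(5) unfolding eq by simp_all
  then have eq2: "i' = i" "b' = b" "j' = j" "c' = c"
    by simp_all
  then have k: "k' = k"
    using distinct3_third[of i j k k'] assms p(3) r(3) by auto
  have "{q, q + lstep i b, q + lstep j c} \<subseteq> lcorners (z, k)"
    using p(1,2) r(2) unfolding eq eq2 k by simp
  then show "(q + (if b then 0 else - axis i 1) + (if c then 0 else - axis j 1), k) \<in> tiling"
    using t unfolding corner_tile[OF assms(2-)] k by simp
next
  let ?t = "(q + (if b then 0 else - axis i 1) + (if c then 0 else - axis j 1), k)"
  assume t: "?t \<in> tiling"
  have "q \<in> lcorners ?t" "q + lstep i b \<in> lcorners ?t" "q + lstep j c \<in> lcorners ?t"
    using corner_tile[OF assms(2-), of q b c "fst ?t"] by simp_all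
  then have "side ?t (pt q) (pt q + st i b)" "side ?t (pt q) (pt q + st j c)"
    unfolding side_iff using assms(3,4) by blast+
  then show "adj3 (pt q + st i b) (pt q) (pt q + st j c)"
    using t side_sym unfolding adj3_def by blast
qed

lemma adj3_arrows:
  assumes "adj3 x z y"
  shows "(x, z) \<in> arrows" "(z, x) \<in> arrows" "(z, y) \<in> arrows" "(y, z) \<in> arrows"
proof -
  show "(x, z) \<in> arrows" "(z, y) \<in> arrows"
    using assms by (auto simp: adj3_def arrows_def simp del: side.simps)
  then show "(z, x) \<in> arrows" "(y, z) \<in> arrows"
    by (simp_all add: arrows_sym)
qed

lemma adj3_sym: "adj3 x z y \<Longrightarrow> adj3 y z x"
  unfolding adj3_def using side_sym by blast

lemma adj3_axis:
  assumes "adj3 (z + st i b) z (z + st i c)"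
  shows "b = c"
proof -
  obtain v k' where t: "(v, k') \<in> tiling"
    and "side (v, k') (z + st i b) z" "side (v, k') z (z + st i c)"
    using assms unfolding adj3_def by (metis surj_pair)
  then have "side (v, k') z (z + st i b)" "side (v, k') z (z + st i c)"
    using side_sym by blast+
  then obtain p i' b' r j' c' where
    p: "p \<in> lcorners (v, k')" "p + lstep i' b' \<in> lcorners (v, k')" "z = pt p" "z + st i b = pt p + st i' b'"
    and r: "r \<in> lcorners (v, k')" "r + lstep j' c' \<in> lcorners (v, k')" "z = pt r" "z + st i c = pt r + st j' c'"
    unfolding side_iff by blast
  have "p = r"
    using pt_inj_level[of p r] p r lcorners_level[OF t] by auto
  then have "p + lstep i b \<in> lcorners (v, k')" "p + lstep i c \<in> lcorners (v, k')"
    using p r by auto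
  then have "(p + lstep i b) $ i = v $ i \<or> (p + lstep i b) $ i = v $ i + 1"
    "(p + lstep i c) $ i = v $ i \<or> (p + lstep i c) $ i = v $ i + 1"
    unfolding lcorners_def by simp_all
  then have "\<bar>(p + lstep i b) $ i - (p + lstep i c) $ i\<bar> \<le> 1"
    by auto
  then show ?thesis
    by (auto simp: lstep_nth split: if_splits)
qed

text \<open>The three directions sum to zero, so \<open>- st k b\<close> bisects the angle of 120
  degrees between the two steps, and the rhombus is present exactly when no edge runs there. In
  heights, both sides compare \<open>ht q\<close> with the same threshold.\<close>

lemma adj3_same:
  assumes "z \<in> vertices" and ijk: "i \<noteq> j" "k \<noteq> i" "k \<noteq> j"
  shows "adj3 (z + st i b) z (z + st j b) \<longleftrightarrow> (z, z - st k b) \<notin> arrows"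
proof -
  obtain q where q: "q \<in> level" "z = pt q"
    using assms(1) by (auto simp: vertices_eq)
  have "(pt q, pt q + st k (\<not> b)) \<in> arrows \<longleftrightarrow> q + lstep k (\<not> b) \<in> level"
    using arrow_iff[OF q(1)] by blast
  then show ?thesis
    using q adj3_iff[OF q(1) ijk, of b b] wt_sum[OF ijk] wt_pos[of k]
    by (auto simp: level_def tiling_eq_stepped stepped_def)
qed

text \<open>The steps enclose 60 degrees and no edge can separate them. The two arrows bound the
  height from above and from below exactly as the tile does.\<close>

lemma adj3_opp:
  assumes "z \<in> vertices" and "i \<noteq> j"
  shows "adj3 (z + st i b) z (z - st j b) \<longleftrightarrow> (z, z + st i b) \<in> arrows \<and> (z, z - st j b) \<in> arrows"
proof -
  obtain q where q: "q \<in> level" "z = pt q"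
    using assms(1) by (auto simp: vertices_eq)
  obtain k where k: "k \<noteq> i" "k \<noteq> j"
    using distinct3_cases[OF assms(2)] .
  have "(pt q, pt q + st i b) \<in> arrows \<longleftrightarrow> q + lstep i b \<in> level"
    "(pt q, pt q + st j (\<not> b)) \<in> arrows \<longleftrightarrow> q + lstep j (\<not> b) \<in> level"
    using arrow_iff[OF q(1)] by blast+
  moreover have "(q + (if b then 0 else - axis i 1) + (if \<not> b then 0 else - axis j 1), k) \<in> tiling
      \<longleftrightarrow> q + lstep i b \<in> level \<and> q + lstep j (\<not> b) \<in> level"
    using q(1) wt_sum[OF assms(2) k] wt_pos[of i] wt_pos[of j]
    unfolding level_def mem_Collect_eq tiling_eq_stepped stepped_def prod.case ht_add ht_lstep
    by (cases b) (auto simp: algebra_simps)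
  ultimately show ?thesis
    using q adj3_iff[OF q(1) assms(2) k, of b "\<not> b"] by simp
qed

text \<open>Both arrows compare the height of \<open>q\<close> with one threshold,
  \<open>wt j\<close> or \<open>wt i + wt k\<close> according to \<open>b\<close>, and ask for
  opposite sides of it. This carries information about arrows from one end of an edge to the
  other.\<close>

lemma arrow_flip:
  assumes "(z, z + st i b) \<in> arrows" and ijk: "i \<noteq> j" "k \<noteq> i" "k \<noteq> j"
  shows "(z, z - st j b) \<in> arrows \<longleftrightarrow> (z + st i b, z + st i b + st k b) \<notin> arrows"
proof -
  obtain q where q: "q \<in> level" "z = pt q"
    using assms(1) arrows_vertices by (auto simp: vertices_eq)
  have l: "q + lstep i b \<in> level"
    using assms(1) arrow_iff q by auto
  have "(pt q, pt q + st j (\<not> b)) \<in> arrows \<longleftrightarrow> q + lstep j (\<not> b) \<in> level"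
    using arrow_iff[OF q(1)] by blast
  moreover have "(pt (q + lstep i b), pt (q + lstep i b) + st k b) \<in> arrows \<longleftrightarrow> q + lstep i b + lstep k b \<in> level"
    using arrow_iff[OF l] by blast
  ultimately show ?thesis
    using q l wt_sum[OF ijk] wt_pos[of i] wt_pos[of j] wt_pos[of k]
    by (auto simp: level_def split: if_splits)
qed

section \<open>Rhombi spanned by two edges\<close>

lemma adj3E:
  assumes "adj3 x z y" "x \<noteq> y"
  obtains i b j c where "i \<noteq> j" "x = z + st i b" "y = z + st j c"
proof -
  obtain i b j c where *: "x = z + st i b" "y = z + st j c"
    using adj3_arrows[OF assms(1)] arrowsE by metis
  then have "i \<noteq> j"
    using adj3_axis assms by blast
  then show ?thesis
    using * that by blast
qed

lemma square_sides:
  assumes "t \<in> tiling" "side t u z" "side t z v" "u \<noteq> v"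
  shows "side t u (u + v - z)" "side t (u + v - z) v" "corners t = {z, u, v, u + v - z}"
proof -
  obtain w k where t: "t = (w, k)" by (cases t)
  have "adj3 u z v"
    using assms by (auto simp: adj3_def simp del: side.simps)
  then obtain i b j c where ij: "i \<noteq> j" "u = z + st i b" "v = z + st j c"
    using assms(4) by (rule adj3E)
  obtain p i' b' where p: "p \<in> lcorners t" "p + lstep i' b' \<in> lcorners t" "z = pt p" "u = pt p + st i' b'" "i' \<noteq> k"
    using side_sym[OF assms(2)] unfolding t side_iff by blast
  obtain r j' c' where r: "r \<in> lcorners t" "r + lstep j' c' \<in> lcorners t" "z = pt r" "v = pt r + st j' c'" "j' \<noteq> k"
    using assms(3) unfolding t side_iff by blast
  have "p = r"
    using pt_inj_level[of p r] p r lcorners_level[OF assms(1)] by auto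
  then have pp: "p + lstep i b \<in> lcorners t" "p + lstep j c \<in> lcorners t" and k: "k \<noteq> i" "k \<noteq> j"
    using p r ij by auto
  have w: "w = p + (if b then 0 else - axis i 1) + (if c then 0 else - axis j 1)"
    using corner_tile[OF ij(1) k, of p b c w] p(1) pp unfolding t by simp
  have e: "p + lstep i b + lstep j c \<in> lcorners t"
    using p(1) pp ij(1) unfolding t lcorners_def mem_Collect_eq fst_conv snd_conv vector_add_component
    by (metis add.right_neutral lstep_nth)
  then have e': "p + lstep j c + lstep i b \<in> lcorners t"
    by (simp add: add_ac)
  have y: "u + v - z = pt (p + lstep i b) + st j c" "u + v - z = pt (p + lstep j c) + st i b"
    "u = pt (p + lstep i b)" "v = pt (p + lstep j c)"
    using p ij by simp_all
  show "side t u (u + v - z)"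
    unfolding t side_iff using y pp e k t by blast
  have "side t v (u + v - z)"
    unfolding t side_iff using y pp e' k t by blast
  then show "side t (u + v - z) v"
    by (rule side_sym)
  have "lcorners t = {p, p + lstep i b, p + lstep j c, p + lstep i b + lstep j c}"
  proof (intro equalityI subsetI)
    fix q assume q: "q \<in> lcorners t"
    have all: "(\<forall>a. P a) \<longleftrightarrow> P i \<and> P j \<and> P k" for P
      using distinct3_third[OF ij(1) k] by metis
    have nth: "lstep i b $ i = (if b then 1 else - 1)" "lstep i b $ j = 0" "lstep i b $ k = 0"
      "lstep j c $ j = (if c then 1 else - 1)" "lstep j c $ i = 0" "lstep j c $ k = 0"
      using ij k by (auto simp: lstep_nth)
    have mem: "v \<in> lcorners t \<longleftrightarrow> v $ k = w $ k \<and> (v $ i = w $ i \<or> v $ i = w $ i + 1) \<and> (v $ j = w $ j \<or> v $ j = w $ j + 1)" for v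
      by (auto simp: lcorners_def t all)
    have "q $ k = p $ k"
      using q p(1) unfolding mem by simp
    moreover have "q $ i = p $ i \<or> q $ i = p $ i + lstep i b $ i"
      using q p(1) pp(1) unfolding mem vector_add_component nth by auto
    moreover have "q $ j = p $ j \<or> q $ j = p $ j + lstep j c $ j"
      using q p(1) pp(2) unfolding mem vector_add_component nth by auto
    ultimately show "q \<in> {p, p + lstep i b, p + lstep j c, p + lstep i b + lstep j c}"
      unfolding insert_iff vec_eq_iff all vector_add_component by (elim disjE) (simp_all add: nth)
  qed (use e p pp in auto)
  then show "corners t = {z, u, v, u + v - z}"
    unfolding corners_eq using y p(3) ij by (auto simp: algebra_simps)
qed

lemma tiling_rhombusI:
  assumes "adj3 u z v" "u \<noteq> v"
  shows "tiling_rhombus z u (u + v - z) v"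
proof -
  obtain t where t: "t \<in> tiling" "side t u z" "side t z v"
    using assms by (auto simp: adj3_def simp del: side.simps)
  obtain i b j c where ij: "i \<noteq> j" "u = z + st i b" "v = z + st j c"
    using assms by (rule adj3E)
  have "st i b \<noteq> - st j c"
    using ij by simp
  then have "z \<noteq> u + v - z"
    using ij by (metis (no_types, lifting) add.commute add_diff_cancel_left' add_left_cancel diff_add_eq group_cancel.rule0 eq_neg_iff_add_eq_0)
  then show ?thesis
    unfolding tiling_rhombus_def using assms(2) square_sides[OF t assms(2)] t side_sym by blast
qed

lemma tiling_rhombusD:
  assumes "tiling_rhombus z u y v"
  shows "adj3 u z v" "adj3 z u y" "adj3 u y v" "adj3 z v y" "y = u + v - z" "z \<noteq> y" "u \<noteq> v"
proof -
  obtain t where t: "t \<in> tiling" "side t z u" "side t u y" "side t y v" "side t v z" and ne: "z \<noteq> y" "u \<noteq> v"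
    using assms by (auto simp: tiling_rhombus_def simp del: side.simps)
  show "adj3 u z v" "adj3 z u y" "adj3 u y v" "adj3 z v y"
    unfolding adj3_def using t side_sym by blast+
  have "y \<in> corners t"
    using t(3) by (cases t) auto
  moreover have "corners t = {z, u, v, u + v - z}"
    using square_sides(3)[OF t(1) side_sym[OF t(2)] side_sym[OF t(5)] ne(2)] .
  moreover have "(u, y) \<in> arrows" "(y, v) \<in> arrows"
    using t by (auto simp: arrows_def simp del: side.simps)
  then have "y \<noteq> u" "y \<noteq> v"
    using arrowsE by (metis add_cancel_right_right st_nonzero)+
  ultimately show "y = u + v - z" "z \<noteq> y" "u \<noteq> v"
    using ne by auto
qed

section \<open>Directions at a 5-vertex\<close>

text \<open>The six edge directions in counterclockwise order.\<close>

definition hexdir :: "int \<Rightarrow> real^2" where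
  "hexdir n = st (if n mod 3 = 0 then 1 else if n mod 3 = 1 then 3 else 2) (odd n)"

lemma hexdir_eq_iff: "hexdir m = hexdir n \<longleftrightarrow> 6 dvd m - n"
proof -
  have "hexdir m = hexdir n \<longleftrightarrow> m mod 3 = n mod 3 \<and> odd m = odd n"
    by (auto simp: hexdir_def)
  also have "\<dots> \<longleftrightarrow> 6 dvd m - n"
    by presburger
  finally show ?thesis .
qed

lemma hexdir_add3: "hexdir (n + 3) = - hexdir n"
  by (simp add: hexdir_def)

lemma hexdir_surj: "\<exists>n. st i b = hexdir n"
proof -
  have "st 1 b = hexdir (if b then 3 else 0)" "st 2 b = hexdir (if b then 5 else 2)" "st 3 b = hexdir (if b then 1 else 4)"
    by (simp_all add: hexdir_def)
  then show ?thesis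
    using exhaust_3[of i] by blast
qed

lemma dir_coords: "dir 1 = vector [- (sqrt 3 / 2), - (1 / 2)]" "dir 2 = vector [sqrt 3 / 2, - (1 / 2)]"
  "dir 3 = vector [0, 1]"
  by (simp_all add: dir_def proj_def axis_def)

lemma hexdir_angle: "hexdir n = vector [cos (pi / 6 + of_int n * pi / 3), sin (pi / 6 + of_int n * pi / 3)]"
proof -
  define P where "P n \<longleftrightarrow> hexdir n = vector [cos (pi / 6 + of_int n * pi / 3), sin (pi / 6 + of_int n * pi / 3)]" for n
  have shift: "P (n + 3) \<longleftrightarrow> P n" for n
  proof -
    have eq: "pi / 6 + of_int (n + 3) * pi / 3 = (pi / 6 + of_int n * pi / 3) + pi"
      by (simp add: field_simps)
    show ?thesis
      unfolding P_def hexdir_add3 eq cos_periodic_pi sin_periodic_pi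
      by (simp add: vec_eq_iff forall_2)
  qed
  have base: "P 0" "P 1" "P 2"
  proof -
    show "P 0"
      by (simp add: P_def hexdir_def st_def dir_coords cos_30 sin_30 vec_eq_iff forall_2)
    have "pi / 6 + pi / 3 = pi / 2"
      by (simp add: field_simps)
    then show "P 1"
      by (simp add: P_def hexdir_def st_def dir_coords)
    have eq: "pi / 6 + 2 * pi / 3 = pi - pi / 6"
      by (simp add: field_simps)
    show "P 2"
      unfolding P_def of_int_numeral eq cos_pi_minus sin_pi_minus cos_30 sin_30
      by (simp add: hexdir_def st_def dir_coords vec_eq_iff forall_2)
  qed
  have up: "P (r + 3 * int m) \<longleftrightarrow> P r" for r m
  proof (induction m)
    case (Suc m)
    have "r + 3 * int (Suc m) = (r + 3 * int m) + 3"
      by simp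
    then show ?case
      using Suc shift by metis
  qed simp
  \<comment> \<open>The induction \<open>up\<close> covers only natural multiples of 3. For negative
    quotients it is applied with \<open>n\<close> as the starting point and \<open>n mod 3\<close>
    as the end.\<close>
  have "n = n mod 3 + 3 * int (nat (n div 3)) \<or> n mod 3 = n + 3 * int (nat (- (n div 3)))"
    using mult_div_mod_eq[of 3 n] by linarith
  moreover have "n mod 3 = 0 \<or> n mod 3 = 1 \<or> n mod 3 = 2"
    by presburger
  ultimately have "P n"
    using base up by metis
  then show ?thesis
    by (simp add: P_def)
qed

text \<open>Indices differing by 1 or 5 are 60 degrees apart, which is the case of
  \<open>adj3_opp\<close>. A difference of 2 or 4 means 120 degrees with one possible separating
  edge, as in \<open>adj3_same\<close>, and a difference of 3 means collinear edges.\<close>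

lemma adj3_hexdir:
  assumes z: "(z, z + hexdir n) \<in> arrows" "(z, z + hexdir m) \<in> arrows" and nm: "n < m" "m < n + 6"
  shows "adj3 (z + hexdir n) z (z + hexdir m) \<longleftrightarrow> m = n + 1 \<or> m = n + 5 \<or>
    (m = n + 2 \<and> (z, z + hexdir (n + 1)) \<notin> arrows) \<or> (m = n + 4 \<and> (z, z + hexdir (m + 1)) \<notin> arrows)"
proof -
  define a :: "int \<Rightarrow> 3" where "a n = (if n mod 3 = 0 then 1 else if n mod 3 = 1 then 3 else 2)" for n
  have hd: "hexdir n = st (a n) (odd n)" for n
    by (simp add: hexdir_def a_def)
  have a_eq: "a n = a m \<longleftrightarrow> n mod 3 = m mod 3" for n m
    by (auto simp: a_def)
  have vz: "z \<in> vertices"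
    using z arrows_vertices by blast
  consider "m = n + 1 \<or> m = n + 5" | "m = n + 2" | "m = n + 3" | "m = n + 4"
    using nm by linarith
  then show ?thesis
  proof cases
    case 1
    then have "odd m = (\<not> odd n)" "a n \<noteq> a m"
      unfolding a_eq by presburger+
    then have "hexdir m = - st (a m) (odd n)"
      by (simp add: hd)
    then show ?thesis
      using adj3_opp[OF vz \<open>a n \<noteq> a m\<close>, of "odd n"] z 1 by (auto simp: hd)
  next
    case 2
    then have "odd m = odd n" "odd (n + 1) = (\<not> odd n)" "a n \<noteq> a m" "a (n + 1) \<noteq> a n" "a (n + 1) \<noteq> a m"
      unfolding a_eq by presburger+
    moreover from this have "hexdir (n + 1) = - st (a (n + 1)) (odd n)"
      by (simp add: hd)
    ultimately show ?thesis
      using adj3_same[OF vz, of "a n" "a m" "a (n + 1)" "odd n"] 2 by (simp add: hd)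
  next
    case 3
    then have "hexdir m = st (a n) (\<not> odd n)"
      using hexdir_add3[of n] by (simp add: hd)
    then show ?thesis
      using adj3_axis[of z "a n" "odd n" "\<not> odd n"] 3 by (auto simp: hd)
  next
    case 4
    then have "odd m = odd n" "odd (m + 1) = (\<not> odd n)" "a n \<noteq> a m" "a (m + 1) \<noteq> a n" "a (m + 1) \<noteq> a m"
      unfolding a_eq by presburger+
    moreover from this have "hexdir (m + 1) = - st (a (m + 1)) (odd n)"
      by (simp add: hd)
    ultimately show ?thesis
      using adj3_same[OF vz, of "a n" "a m" "a (m + 1)" "odd n"] 4 by (simp add: hd)
  qed
qed

lemma hexdir_polar:
  assumes "hexdir n = r *\<^sub>R vector [cos t, sin t]" "0 < r"
  shows "\<exists>m. hexdir m = hexdir n \<and> t = pi / 6 + of_int m * pi / 3"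
proof -
  define p where "p = pi / 6 + of_int n * pi / 3"
  have c: "cos p = r * cos t" "sin p = r * sin t"
    using assms(1) unfolding hexdir_angle p_def by (simp_all add: vec_eq_iff forall_2)
  have "r ^ 2 * ((cos t) ^ 2 + (sin t) ^ 2) = (cos p) ^ 2 + (sin p) ^ 2"
    unfolding c by (simp only: power_mult_distrib distrib_left)
  then have "r ^ 2 = 1"
    by (simp only: sin_cos_squared_add2 mult_1_right)
  then have "r = 1"
    using assms(2) by (simp add: power2_eq_1_iff)
  then obtain k where "t = p + 2 * pi * of_int k"
    using c sin_cos_eq_iff[of t p] by auto
  then have "t = pi / 6 + of_int (n + 6 * k) * pi / 3"
    by (simp add: p_def field_simps)
  moreover have "hexdir (n + 6 * k) = hexdir n"
    by (simp add: hexdir_eq_iff)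
  ultimately show ?thesis
    by blast
qed

lemma ccw_labelling_5:
  assumes "ccw_labelling 5 z x"
  shows "{w. (z, w) \<in> arrows} = {x 1, x 2, x 3, x 4, x 5}" "distinct [x 1, x 2, x 3, x 4, x 5]"
    "adj3 (x 1) z (x 2)" "adj3 (x 2) z (x 3)" "adj3 (x 3) z (x 4)" "adj3 (x 4) z (x 5)" "adj3 (x 5) z (x 1)"
    "\<not> adj3 (x 1) z (x 3)" "\<not> adj3 (x 1) z (x 4)" "\<not> adj3 (x 2) z (x 4)" "\<not> adj3 (x 2) z (x 5)" "\<not> adj3 (x 3) z (x 5)"
proof -
  obtain r t where x: "x ` {1..5} = {w. (z, w) \<in> arrows}"
    and rt: "\<And>j. j \<in> {1..5} \<Longrightarrow> 0 < r j \<and> x j = z + r j *\<^sub>R vector [cos (t j), sin (t j)]"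
    and mono: "strict_mono_on {1..5} t"
    and bound: "\<And>i j. i \<in> {1..5} \<Longrightarrow> j \<in> {1..5} \<Longrightarrow> t j - t i < 2 * pi"
    using assms unfolding ccw_labelling_def by blast
  have "\<exists>m. x j = z + hexdir m \<and> t j = pi / 6 + of_int m * pi / 3" if j: "j \<in> {1..5}" for j
  proof -
    have "(z, x j) \<in> arrows"
      using x j by blast
    then obtain i b where "x j = z + st i b"
      using arrowsE by metis
    then obtain n where n: "x j = z + hexdir n"
      using hexdir_surj by metis
    then have "hexdir n = r j *\<^sub>R vector [cos (t j), sin (t j)]"
      using rt[OF j] by simp
    then show ?thesis
      using hexdir_polar rt[OF j] n by metis
  qed
  then obtain N where N: "\<And>j. j \<in> {1..5} \<Longrightarrow> x j = z + hexdir (N j) \<and> t j = pi / 6 + of_int (N j) * pi / 3"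
    by metis
  have less: "N i < N j" if "i \<in> {1..5}" "j \<in> {1..5}" "i < j" for i j
  proof -
    have "t i < t j"
      using mono that by (simp add: strict_mono_on_def)
    then have "of_int (N i) * pi < of_int (N j) * pi"
      using N that by simp
    then show ?thesis
      by simp
  qed
  have "t 5 - t 1 < 2 * pi"
    by (rule bound) auto
  then have "of_int (N 5) * pi < (of_int (N 1) + 6) * pi"
    using N[of 1] N[of 5] by (simp add: field_simps)
  then have "of_int (N 5) < (of_int (N 1) + 6 :: real)"
    by (simp only: mult_less_cancel_right_pos[OF pi_gt_zero])
  then have N6: "N 5 < N 1 + 6"
    by linarith
  have N5: "N 1 < N 2" "N 2 < N 3" "N 3 < N 4" "N 4 < N 5"
    by (auto intro: less)
  have xs: "x 1 = z + hexdir (N 1)" "x 2 = z + hexdir (N 2)" "x 3 = z + hexdir (N 3)" "x 4 = z + hexdir (N 4)" "x 5 = z + hexdir (N 5)"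
    using N by auto
  have "{1..5} = {1, 2, 3, 4, 5 :: nat}"
    by auto
  then show set: "{w. (z, w) \<in> arrows} = {x 1, x 2, x 3, x 4, x 5}"
    using x by auto
  have arr: "(z, z + hexdir n) \<in> arrows \<longleftrightarrow> 6 dvd n - N 1 \<or> 6 dvd n - N 2 \<or> 6 dvd n - N 3 \<or> 6 dvd n - N 4 \<or> 6 dvd n - N 5" for n
  proof -
    have "(z, z + hexdir n) \<in> arrows \<longleftrightarrow> z + hexdir n \<in> {x 1, x 2, x 3, x 4, x 5}"
      using set by blast
    then show ?thesis
      unfolding xs by (simp add: hexdir_eq_iff)
  qed
  have ah: "adj3 (z + hexdir n) z (z + hexdir m) \<longleftrightarrow> m = n + 1 \<or> m = n + 5 \<or>
    (m = n + 2 \<and> (z, z + hexdir (n + 1)) \<notin> arrows) \<or> (m = n + 4 \<and> (z, z + hexdir (m + 1)) \<notin> arrows)"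
    if "n \<in> {N 1, N 2, N 3, N 4, N 5}" "m \<in> {N 1, N 2, N 3, N 4, N 5}" "n < m" for n m
    using that N5 N6 by (intro adj3_hexdir) (auto simp: arr)
  obtain d2 d3 d4 d5 where d: "N 2 = N 1 + d2" "N 3 = N 1 + d3" "N 4 = N 1 + d4" "N 5 = N 1 + d5"
    by (metis add.commute diff_add_cancel)
  then have b: "0 < d2" "d2 < d3" "d3 < d4" "d4 < d5" "d5 < 6"
    using N5 N6 by simp_all
  then have "d5 = 4 \<or> d5 = 5" "d4 = 3 \<or> d4 = 4" "d3 = 2 \<or> d3 = 3" "d2 = 1 \<or> d2 = 2"
    by linarith+
  \<comment> \<open>The offsets from \<open>N 1\<close> are the numbers 1 to 5 with one of them left
    out.\<close>
  with b have cases: "d2 = 1 \<and> d3 = 2 \<and> d4 = 3 \<and> d5 = 4 \<or> d2 = 1 \<and> d3 = 2 \<and> d4 = 3 \<and> d5 = 5 \<or> d2 = 1 \<and> d3 = 2 \<and> d4 = 4 \<and> d5 = 5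
    \<or> d2 = 1 \<and> d3 = 3 \<and> d4 = 4 \<and> d5 = 5 \<or> d2 = 2 \<and> d3 = 3 \<and> d4 = 4 \<and> d5 = 5"
    by auto
  show "distinct [x 1, x 2, x 3, x 4, x 5]"
    using cases unfolding xs by (elim disjE) (simp_all add: hexdir_eq_iff d)
  have main: "adj3 (x 1) z (x 2) \<and> adj3 (x 2) z (x 3) \<and> adj3 (x 3) z (x 4) \<and> adj3 (x 4) z (x 5) \<and> adj3 (x 1) z (x 5) \<and>
    \<not> adj3 (x 1) z (x 3) \<and> \<not> adj3 (x 1) z (x 4) \<and> \<not> adj3 (x 2) z (x 4) \<and> \<not> adj3 (x 2) z (x 5) \<and> \<not> adj3 (x 3) z (x 5)"
    using cases unfolding xs by (elim disjE) (simp_all add: ah d arr)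
  then show "adj3 (x 5) z (x 1)"
    by (elim conjE) (rule adj3_sym)
  show "adj3 (x 1) z (x 2)" "adj3 (x 2) z (x 3)" "adj3 (x 3) z (x 4)" "adj3 (x 4) z (x 5)"
    "\<not> adj3 (x 1) z (x 3)" "\<not> adj3 (x 1) z (x 4)" "\<not> adj3 (x 2) z (x 4)" "\<not> adj3 (x 2) z (x 5)" "\<not> adj3 (x 3) z (x 5)"
    using main by simp_all
qed

section \<open>The path algebra and its quotient\<close>

abbreviation lookup where "lookup \<equiv> Poly_Mapping.lookup"
abbreviation keys where "keys \<equiv> Poly_Mapping.keys"
abbreviation single where "single \<equiv> Poly_Mapping.single"

text \<open>Summing over common finite supersets of the supports turns bilinearity into a termwise
  identity.\<close>

lemma path_mult_superset:
  assumes "finite P" "finite Q" "keys f \<subseteq> P" "keys g \<subseteq> Q"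
  shows "path_mult f g = (\<Sum>p\<in>P. \<Sum>q\<in>Q. if last p = hd q then single (p @ tl q) (lookup f p * lookup g q) else 0)"
proof -
  have "path_mult f g = (\<Sum>p\<in>P. \<Sum>q\<in>keys g. if last p = hd q then single (p @ tl q) (lookup f p * lookup g q) else 0)"
    unfolding path_mult_def using assms by (intro sum.mono_neutral_left) (auto simp: in_keys_iff intro!: sum.neutral)
  also have "\<dots> = (\<Sum>p\<in>P. \<Sum>q\<in>Q. if last p = hd q then single (p @ tl q) (lookup f p * lookup g q) else 0)"
    using assms by (intro sum.cong sum.mono_neutral_left) (auto simp: in_keys_iff)
  finally show ?thesis .
qed

lemma path_mult_add_left: "path_mult (f + f') g = path_mult f g + path_mult f' g"
proof -
  have k: "keys (f + f') \<subseteq> keys f \<union> keys f'"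
    by (rule Poly_Mapping.keys_add)
  show ?thesis
    using path_mult_superset[of "keys f \<union> keys f'" "keys g" "f + f'" g] path_mult_superset[of "keys f \<union> keys f'" "keys g" f g]
      path_mult_superset[of "keys f \<union> keys f'" "keys g" f' g] k
    by (simp flip: sum.distrib) (intro sum.cong refl; simp add: lookup_add distrib_right single_add)
qed

lemma path_mult_add_right: "path_mult f (g + g') = path_mult f g + path_mult f g'"
proof -
  have k: "keys (g + g') \<subseteq> keys g \<union> keys g'"
    by (rule Poly_Mapping.keys_add)
  show ?thesis
    using path_mult_superset[of "keys f" "keys g \<union> keys g'" f "g + g'"] path_mult_superset[of "keys f" "keys g \<union> keys g'" f g]
      path_mult_superset[of "keys f" "keys g \<union> keys g'" f g'] k
    by (simp flip: sum.distrib) (intro sum.cong refl; simp add: lookup_add distrib_left single_add)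
qed

lemma path_mult_zero [simp]: "path_mult 0 g = 0" "path_mult f 0 = 0"
  by (simp_all add: path_mult_def)

lemma path_mult_uminus_left: "path_mult (- f) g = - path_mult f g"
  using path_mult_add_left[of "- f" f g] by (simp add: eq_neg_iff_add_eq_0)

lemma path_mult_uminus_right: "path_mult f (- g) = - path_mult f g"
  using path_mult_add_right[of f "- g" g] by (simp add: eq_neg_iff_add_eq_0)

lemma path_mult_diff_left: "path_mult (f - f') g = path_mult f g - path_mult f' g"
  using path_mult_add_left[of f "- f'" g] by (simp add: path_mult_uminus_left)

lemma path_mult_diff_right: "path_mult f (g - g') = path_mult f g - path_mult f g'"
  using path_mult_add_right[of f g "- g'"] by (simp add: path_mult_uminus_right)

lemma path_mult_sum_left: "path_mult (\<Sum>i\<in>S. F i) g = (\<Sum>i\<in>S. path_mult (F i) g)"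
  by (induction S rule: infinite_finite_induct) (simp_all add: path_mult_add_left)

lemma path_mult_sum_right: "path_mult f (\<Sum>i\<in>S. F i) = (\<Sum>i\<in>S. path_mult f (F i))"
  by (induction S rule: infinite_finite_induct) (simp_all add: path_mult_add_right)

lemma path_mult_single [simp]:
  "path_mult (single p c) (single q d) = (if last p = hd q then single (p @ tl q) (c * d) else 0)"
  using path_mult_superset[of "{p}" "{q}" "single p c" "single q d"] by simp

lemma poly_mapping_sum_single: "f = (\<Sum>p\<in>keys f. single p (lookup f p))"
  by (rule poly_mapping_eqI) (auto simp: lookup_sum lookup_single when_def in_keys_iff)

section \<open>Combinations of walks and their product\<close>

abbreviation pcar :: "'k::field path_comb set" where
  "pcar \<equiv> {f. keys f \<subseteq> walks}"

lemma pcar_induct [consumes 1, case_names zero add single]: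
  assumes "f \<in> pcar" "P 0" "\<And>f g. f \<in> pcar \<Longrightarrow> g \<in> pcar \<Longrightarrow> P f \<Longrightarrow> P g \<Longrightarrow> P (f + g)"
    "\<And>p c. p \<in> walks \<Longrightarrow> P (single p c)"
  shows "P f"
proof -
  have "P (\<Sum>p\<in>S. single p (lookup f p)) \<and> (\<Sum>p\<in>S. single p (lookup f p)) \<in> pcar" if "finite S" "S \<subseteq> keys f" for S
    using that
  proof (induction S)
    case empty
    then show ?case
      using assms by simp
  next
    case (insert p S)
    then have "P (single p (lookup f p))" "single p (lookup f p) \<in> pcar"
      using assms by auto
    then show ?case
      using insert assms(3)[of "single p (lookup f p)"] Poly_Mapping.keys_add[of "single p (lookup f p)" "\<Sum>p\<in>S. single p (lookup f p)"]
      by auto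
  qed
  from this[of "keys f"] show ?thesis
    by (simp flip: poly_mapping_sum_single)
qed

lemma pcar_zero: "0 \<in> pcar"
  and pcar_add: "f \<in> pcar \<Longrightarrow> g \<in> pcar \<Longrightarrow> f + g \<in> pcar"
  and pcar_uminus: "f \<in> pcar \<Longrightarrow> - f \<in> pcar"
  and pcar_diff: "f \<in> pcar \<Longrightarrow> g \<in> pcar \<Longrightarrow> f - g \<in> pcar"
  and pcar_single: "p \<in> walks \<Longrightarrow> single p c \<in> pcar"
  using Poly_Mapping.keys_add[of f g] keys_diff[of f g] by (auto simp: in_keys_iff)

lemma walks_append:
  assumes "p \<in> walks" "q \<in> walks" "last p = hd q"
  shows "p @ tl q \<in> walks" "hd (p @ tl q) = hd p" "last (p @ tl q) = last q"
  using assms by (cases q; cases "tl q"; auto simp: walks_def successively_append_iff)+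

lemma walks_not_Nil: "p \<in> walks \<Longrightarrow> p \<noteq> []"
  by (simp add: walks_def)

lemma pcar_mult:
  assumes "f \<in> pcar" "g \<in> pcar"
  shows "path_mult f g \<in> pcar"
  using assms(1)
proof (induction f rule: pcar_induct)
  case (single p c)
  show ?case
    using assms(2)
  proof (induction g rule: pcar_induct)
    case (single q d)
    then show ?case
      using walks_append[OF \<open>p \<in> walks\<close> single] by (simp add: pcar_single)
  qed (simp_all only: path_mult_zero path_mult_add_right pcar_zero pcar_add)
qed (simp_all only: path_mult_zero path_mult_add_left pcar_zero pcar_add)

lemma path_mult_assoc:
  assumes "f \<in> pcar" "g \<in> pcar" "h \<in> pcar"
  shows "path_mult (path_mult f g) h = path_mult f (path_mult g h)"
  using assms(1)
proof (induction f rule: pcar_induct)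
  case f: (single p c)
  show ?case
    using assms(2)
  proof (induction g rule: pcar_induct)
    case g: (single q d)
    show ?case
      using assms(3)
    proof (induction h rule: pcar_induct)
      case h: (single r e)
      have "tl (q @ tl r) = tl q @ tl r" "hd (q @ tl r) = hd q"
        using walks_not_Nil[OF g] by simp_all
      moreover have "last p = hd q \<Longrightarrow> last (p @ tl q) = last q"
        using walks_append f g by blast
      ultimately show ?case
        by (simp add: mult.assoc)
    qed (simp_all only: path_mult_zero path_mult_add_right)
  qed (simp_all only: path_mult_zero path_mult_add_left path_mult_add_right)
qed (simp_all only: path_mult_zero path_mult_add_left)

lemma path_algebra_simps:
  "carrier path_algebra = pcar" "x \<otimes>\<^bsub>path_algebra\<^esub> y = path_mult x y" "x \<oplus>\<^bsub>path_algebra\<^esub> y = x + y"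
  "\<zero>\<^bsub>path_algebra\<^esub> = 0"
  by (simp_all add: path_algebra_def)

lemma abelian_group_path_algebra: "abelian_group (path_algebra :: 'k::field path_comb ring)"
proof (rule abelian_groupI, unfold path_algebra_simps)
  fix f :: "'k path_comb"
  assume "f \<in> pcar"
  then show "\<exists>g\<in>pcar. g + f = 0"
    using pcar_uminus by (intro bexI[of _ "- f"]) auto
qed (simp_all only: pcar_add pcar_zero add_0_left add_0_right ac_simps)

lemma a_inv_path_algebra: "f \<in> pcar \<Longrightarrow> \<ominus>\<^bsub>path_algebra\<^esub> f = - f"
  using abelian_group.minus_equality[OF abelian_group_path_algebra, of "- f" f] pcar_uminus
  by (simp add: path_algebra_simps)

lemma two_sided_ideal_iff:
  fixes I :: "'k::field path_comb set"
  shows "two_sided_ideal I path_algebra \<longleftrightarrow> I \<subseteq> pcar \<and> 0 \<in> I \<and> (\<forall>f\<in>I. \<forall>g\<in>I. f + g \<in> I) \<and> (\<forall>f\<in>I. - f \<in> I) \<and>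
    (\<forall>f\<in>I. \<forall>h\<in>pcar. path_mult h f \<in> I \<and> path_mult f h \<in> I)"
proof -
  have inv: "inv\<^bsub>add_monoid path_algebra\<^esub> f = - f" if "f \<in> pcar" for f :: "'k path_comb"
    using a_inv_path_algebra[OF that] by (simp add: a_inv_def)
  have "additive_subgroup I path_algebra \<longleftrightarrow> I \<subseteq> pcar \<and> (\<forall>f\<in>I. \<forall>g\<in>I. f + g \<in> I) \<and> 0 \<in> I \<and>
      (\<forall>f\<in>I. inv\<^bsub>add_monoid path_algebra\<^esub> f \<in> I)"
    unfolding additive_subgroup_def subgroup_def by (simp add: path_algebra_simps(1,4) Ball_def) (simp add: path_algebra_simps)
  also have "\<dots> \<longleftrightarrow> I \<subseteq> pcar \<and> 0 \<in> I \<and> (\<forall>f\<in>I. \<forall>g\<in>I. f + g \<in> I) \<and> (\<forall>f\<in>I. - f \<in> I)"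
    using inv subsetD[of I pcar] by (metis (no_types, lifting))
  finally show ?thesis
    unfolding two_sided_ideal_def path_algebra_simps by blast
qed

lemma two_sided_ideal_pcar: "two_sided_ideal pcar path_algebra"
  unfolding two_sided_ideal_iff by (intro conjI ballI subset_refl pcar_zero pcar_add pcar_uminus pcar_mult)

section \<open>The relations and the ideal generated by them\<close>

definition rels :: "(3 \<Rightarrow> real^2 \<Rightarrow> int) \<Rightarrow> 'k::field path_comb set" where
  "rels s = rel_zero \<union> rel_commute \<union> rel_loop s"

lemma walks_triple: "[x, y, w] \<in> walks \<longleftrightarrow> (x, y) \<in> arrows \<and> (y, w) \<in> arrows"
  by (auto simp: walks_def dest: arrows_vertices)

lemma walks_Cons: "x # y # p \<in> walks \<longleftrightarrow> (x, y) \<in> arrows \<and> y # p \<in> walks"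
  by (auto simp: walks_def dest: arrows_vertices)

lemma walks_single: "[x] \<in> walks \<longleftrightarrow> x \<in> vertices"
  by (auto simp: walks_def)

lemma tiling_rhombus_arrows:
  assumes "tiling_rhombus z u y v"
  shows "(z, u) \<in> arrows" "(u, y) \<in> arrows" "(y, v) \<in> arrows" "(v, z) \<in> arrows"
    "(u, z) \<in> arrows" "(y, u) \<in> arrows" "(v, y) \<in> arrows" "(z, v) \<in> arrows"
  using tiling_rhombusD[OF assms] adj3_arrows by blast+

lemma signed_D_eq: "signed_D s a z = (if (z, z + dir a) \<in> arrows then single [z, z + dir a, z] (of_int (s a z)) else 0)
    - (if (z, z - dir a) \<in> arrows then single [z, z - dir a, z] (of_int (s a z)) else 0)"
  unfolding signed_D_def D_elem_def loop_elem_def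
  by (rule poly_mapping_eqI) (simp add: map.rep_eq lookup_minus lookup_single when_def)

lemma rels_pcar: "rels s \<subseteq> pcar"
proof -
  have "signed_D s a z \<in> pcar" for a z
    unfolding signed_D_eq by (intro pcar_diff) (auto simp: walks_triple arrows_sym pcar_single pcar_zero)
  then have "rel_loop s \<subseteq> pcar"
    unfolding rel_loop_def using pcar_diff by blast
  moreover have "rel_commute \<subseteq> pcar"
  proof -
    have "walk_elem [z, u, y] - walk_elem [z, v, y] \<in> pcar" if "tiling_rhombus z u y v" for z u y v
      using tiling_rhombus_arrows[OF that] by (intro pcar_diff pcar_single) (simp_all add: walks_triple)
    then show ?thesis
      unfolding rel_commute_def by blast
  qed
  moreover have "rel_zero \<subseteq> pcar"
    unfolding rel_zero_def using pcar_single walks_triple by blast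
  ultimately show ?thesis
    by (simp add: rels_def)
qed

lemma rauzy_ideal_eq: "rauzy_ideal s = \<Inter>{I. two_sided_ideal I path_algebra \<and> rels s \<subseteq> I}"
  by (simp add: rauzy_ideal_def generated_ideal_def rels_def)

lemma rels_ideal: "rels s \<subseteq> rauzy_ideal s"
  unfolding rauzy_ideal_eq by blast

lemma rauzy_ideal_minimal: "two_sided_ideal I path_algebra \<Longrightarrow> rels s \<subseteq> I \<Longrightarrow> rauzy_ideal s \<subseteq> I"
  unfolding rauzy_ideal_eq by blast

lemma two_sided_ideal_rauzy: "two_sided_ideal (rauzy_ideal s) path_algebra"
  unfolding two_sided_ideal_iff
proof (intro conjI ballI)
  show "rauzy_ideal s \<subseteq> pcar"
    using rauzy_ideal_minimal two_sided_ideal_pcar rels_pcar by blast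
qed (unfold rauzy_ideal_eq, auto simp del: mem_Collect_eq simp: two_sided_ideal_iff mem_Collect_eq[of _ "\<lambda>I. two_sided_ideal I path_algebra \<and> rels s \<subseteq> I"])

lemmas rauzy_ideal_facts = two_sided_ideal_rauzy[unfolded two_sided_ideal_iff]

lemma J_pcar: "f \<in> rauzy_ideal s \<Longrightarrow> f \<in> pcar"
  and J_zero: "0 \<in> rauzy_ideal s"
  and J_add: "f \<in> rauzy_ideal s \<Longrightarrow> g \<in> rauzy_ideal s \<Longrightarrow> f + g \<in> rauzy_ideal s"
  and J_uminus: "f \<in> rauzy_ideal s \<Longrightarrow> - f \<in> rauzy_ideal s"
  and J_mult_left: "f \<in> rauzy_ideal s \<Longrightarrow> h \<in> pcar \<Longrightarrow> path_mult h f \<in> rauzy_ideal s"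
  and J_mult_right: "f \<in> rauzy_ideal s \<Longrightarrow> h \<in> pcar \<Longrightarrow> path_mult f h \<in> rauzy_ideal s"
  using rauzy_ideal_facts by blast+

lemma J_diff: "f \<in> rauzy_ideal s \<Longrightarrow> g \<in> rauzy_ideal s \<Longrightarrow> f - g \<in> rauzy_ideal s"
  using J_add[of f s "- g"] J_uminus[of g s] by simp

section \<open>Residue classes and the operations of the quotient\<close>

definition cls :: "(3 \<Rightarrow> real^2 \<Rightarrow> int) \<Rightarrow> 'k::field path_comb \<Rightarrow> 'k path_comb set" where
  "cls s f = rauzy_ideal s +>\<^bsub>path_algebra\<^esub> f"

lemma cls_eq: "cls s f = {j + f | j. j \<in> rauzy_ideal s}"
  unfolding cls_def a_r_coset_def' path_algebra_simps by blast

lemma mem_cls: "g \<in> cls s f \<longleftrightarrow> g - f \<in> rauzy_ideal s"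
  unfolding cls_eq by (auto intro!: exI[of _ "g - f"])

lemma cls_eq_iff: "cls s f = cls s g \<longleftrightarrow> f - g \<in> rauzy_ideal s"
proof
  assume "cls s f = cls s g"
  moreover have "f \<in> cls s f"
    by (simp add: mem_cls J_zero)
  ultimately show "f - g \<in> rauzy_ideal s"
    using mem_cls by blast
next
  assume fg: "f - g \<in> rauzy_ideal s"
  show "cls s f = cls s g"
  proof (rule Set.set_eqI)
    fix h
    show "h \<in> cls s f \<longleftrightarrow> h \<in> cls s g"
      unfolding mem_cls using J_add[OF _ fg, of "h - f"] J_diff[OF _ fg, of "h - g"] by auto
  qed
qed

lemma walk_class_eq: "walk_class s p = cls s (single p 1)"
  by (simp add: walk_class_def cls_def)

lemma carrier_rauzy: "carrier (rauzy_algebra s) = cls s ` pcar"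
  unfolding rauzy_algebra_def FactRing_def A_RCOSETS_def' path_algebra_simps by (auto simp: cls_def)

lemma zero_rauzy: "\<zero>\<^bsub>rauzy_algebra s\<^esub> = cls s 0"
  unfolding rauzy_algebra_def FactRing_def cls_eq by simp

lemma cls_zero_iff: "cls s f = \<zero>\<^bsub>rauzy_algebra s\<^esub> \<longleftrightarrow> f \<in> rauzy_ideal s"
  unfolding zero_rauzy cls_eq_iff by simp

lemma add_rauzy: "cls s f \<oplus>\<^bsub>rauzy_algebra s\<^esub> cls s g = cls s (f + g)"
proof -
  have "(\<Union>h\<in>cls s f. \<Union>k\<in>cls s g. {h + k}) = cls s (f + g)"
  proof (intro equalityI subsetI)
    fix h assume "h \<in> cls s (f + g)"
    then have "h - g \<in> cls s f" "g \<in> cls s g"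
      by (simp_all add: mem_cls J_zero diff_diff_eq add.commute)
    then show "h \<in> (\<Union>h\<in>cls s f. \<Union>k\<in>cls s g. {h + k})"
      by (intro UN_I[of "h - g"] UN_I[of g]) auto
  next
    fix h assume "h \<in> (\<Union>h\<in>cls s f. \<Union>k\<in>cls s g. {h + k})"
    then obtain a b where "h = a + b" "a - f \<in> rauzy_ideal s" "b - g \<in> rauzy_ideal s"
      by (auto simp: mem_cls)
    then show "h \<in> cls s (f + g)"
      unfolding mem_cls using J_add[of "a - f" s "b - g"] by (simp add: algebra_simps)
  qed
  then show ?thesis
    unfolding rauzy_algebra_def FactRing_def by (simp add: set_add_def' path_algebra_simps)
qed

lemma mult_rauzy:
  assumes "f \<in> pcar" "g \<in> pcar"
  shows "cls s f \<otimes>\<^bsub>rauzy_algebra s\<^esub> cls s g = cls s (path_mult f g)"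
proof -
  have "cls s (path_mult a b) = cls s (path_mult f g)" if "a \<in> cls s f" "b \<in> cls s g" for a b
  proof -
    have ab: "a - f \<in> rauzy_ideal s" "b - g \<in> rauzy_ideal s"
      using that by (simp_all add: mem_cls)
    have "a \<in> pcar"
      using pcar_add[OF J_pcar[OF ab(1)] assms(1)] by simp
    then have "path_mult a (b - g) + path_mult (a - f) g \<in> rauzy_ideal s"
      using ab assms by (intro J_add J_mult_left J_mult_right)
    then show ?thesis
      unfolding cls_eq_iff path_mult_diff_left path_mult_diff_right by simp
  qed
  moreover have "f \<in> cls s f" "g \<in> cls s g"
    by (simp_all add: mem_cls J_zero)
  ultimately have "(\<Union>a\<in>cls s f. \<Union>b\<in>cls s g. cls s (path_mult a b)) = cls s (path_mult f g)"
    by blast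
  then show ?thesis
    unfolding rauzy_algebra_def FactRing_def by (simp add: rcoset_mult_def path_algebra_simps flip: cls_def)
qed

section \<open>A trace form on closed paths\<close>

definition edge :: "real^2 \<Rightarrow> real^2 \<Rightarrow> 3 \<times> bool" where
  "edge x a = (SOME e. a = x + st (fst e) (snd e))"

lemma edge_st [simp]: "edge x (x + st i b) = (i, b)"
  unfolding edge_def by (rule some_equality) (auto simp: prod_eq_iff)

lemma edge_minus_st [simp]: "edge x (x - st i b) = (i, \<not> b)"
  using edge_st[of x i "\<not> b"] by simp

definition weight2 :: "real^2 \<Rightarrow> 3 \<times> bool \<Rightarrow> int" where
  "weight2 x e = 1 - int (card {j. j \<noteq> fst e \<and> (x, x - st j (snd e)) \<in> arrows})"

text \<open>A trace form on closed paths of length four: a path around a rhombus with sides parallel to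
  \<open>dir i\<close> and \<open>dir j\<close>, or a path equal to one by the commutation relations, gets \<open>s i * s j\<close>; the
  value \<open>weight2\<close> at the square of a loop is then forced by the loop relations.\<close>

fun tau :: "(3 \<Rightarrow> real^2 \<Rightarrow> int) \<Rightarrow> (real^2) list \<Rightarrow> int" where
  "tau s [x, a, b, c, x'] =
    (if x' \<noteq> x then 0
     else if b \<noteq> x then (if adj3 x a b \<and> adj3 b c x then s (fst (edge x a)) x * s (fst (edge a b)) x else 0)
     else if a \<noteq> c then (if adj3 a x c then s (fst (edge x a)) x * s (fst (edge x c)) x else 0)
     else weight2 x (edge x a))"
| "tau s _ = 0"

lemma tau_length: "length p \<noteq> 5 \<Longrightarrow> tau s p = 0"
  by (cases "(s, p)" rule: tau.cases) auto

lemma split_length5: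
  assumes "length (p @ [a, b, c] @ q) = 5"
  obtains (0) d e where "p = []" "q = [d, e]" | (1) d e where "p = [d]" "q = [e]" | (2) d e where "p = [d, e]" "q = []"
  using assms
  by (cases p; cases "tl p"; cases q; cases "tl q"; cases "tl (tl p)"; cases "tl (tl q)"; auto)

lemma tau_rev: "tau s [x, a, x, c, x'] = tau s [x', c, x, a, x]"
  using adj3_sym[of a x c] adj3_sym[of c x a] by auto

lemma tiling_rhombus_rotate: "tiling_rhombus z u y v \<Longrightarrow> tiling_rhombus u y v z"
  unfolding tiling_rhombus_def by blast

lemma tiling_rhombus_reflect: "tiling_rhombus z u y v \<Longrightarrow> tiling_rhombus z v y u"
  unfolding tiling_rhombus_def using side_sym by blast

lemma tiling_rhombus_opposite: "tiling_rhombus z u y v \<Longrightarrow> tiling_rhombus y u z v"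
  using tiling_rhombus_rotate tiling_rhombus_reflect by blast

text \<open>Both halves of the walk write \<open>b - x\<close> as a sum of two nonparallel steps. By
  \<open>st_sum_cases\<close> they use the same two steps, and \<open>a \<noteq> c\<close> means
  that the order is exchanged.\<close>

lemma four_cycle:
  assumes "adj3 x a b" "adj3 b c x" "a \<noteq> c" "x \<noteq> b"
  shows "tiling_rhombus x a b c"
proof -
  obtain i1 b1 j1 c1 where 1: "i1 \<noteq> j1" "x = a + st i1 b1" "b = a + st j1 c1"
    using assms(1,4) by (rule adj3E)
  obtain i2 b2 j2 c2 where 2: "i2 \<noteq> j2" "b = c + st i2 b2" "x = c + st j2 c2"
    using assms(2,4) by (metis adj3E)
  have "a + st i1 b1 = c + st j2 c2" "a + st j1 c1 = c + st i2 b2"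
    using 1 2 by metis+
  then have "(c + st i2 b2) - (c + st j2 c2) = (a + st j1 c1) - (a + st i1 b1)"
    by metis
  then have "st j1 c1 + st i1 (\<not> b1) = st i2 b2 + st j2 (\<not> c2)"
    unfolding st_not by simp
  then have "st j1 c1 = st i2 b2 \<or> st j1 c1 = st j2 (\<not> c2)"
    using 1(1)[symmetric] by (rule st_sum_cases)
  moreover have "st j1 c1 \<noteq> st i2 b2"
    using assms(3) 1(3) 2(2) by (auto simp del: st_inj)
  ultimately have "st j1 c1 = - st j2 c2"
    by (simp del: st_inj st_eq_minus)
  then have "c = x + b - a"
    using 1(3) 2(3) by (simp del: st_inj st_eq_minus)
  moreover have "tiling_rhombus a x (x + b - a) b"
    using assms by (intro tiling_rhombusI)
  ultimately show ?thesis
    using tiling_rhombus_rotate tiling_rhombus_reflect by blast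
qed

text \<open>At the start or end of a closed path the definition of \<open>tau\<close> asks for
  adjacency at \<open>b\<close>. In the middle it asks for it at \<open>a\<close> and
  \<open>c\<close> instead, but then the path surrounds a rhombus by \<open>four_cycle\<close>, and
  adjacency at \<open>b\<close> follows.\<close>

lemma tau_zero:
  assumes "\<not> adj3 a b c" "a \<noteq> c"
  shows "tau s (p @ [a, b, c] @ q) = 0"
proof (cases "length (p @ [a, b, c] @ q) = 5")
  case True
  then show ?thesis
  proof (cases rule: split_length5)
    case (0 d e)
    then show ?thesis
      using assms by auto
  next
    case (1 d e)
    show ?thesis
    proof (cases "b = d")
      case False
      have "adj3 a b c" if "adj3 d a b" "adj3 b c d"
        using tiling_rhombusD(3)[OF four_cycle[OF that]] assms(2) False by simp
      then show ?thesis
        using assms 1 False by auto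
    qed (use assms 1 in auto)
  next
    case (2 d e)
    then show ?thesis
      using assms by auto
  qed
qed (rule tau_length)

lemma edge_opposite:
  assumes "tiling_rhombus z u y v"
  obtains i b j c where "i \<noteq> j" "u = z + st i b" "v = z + st j c" "y = z + st i b + st j c"
proof -
  obtain i b j c where "i \<noteq> j" "u = z + st i b" "v = z + st j c"
    using adj3E[OF tiling_rhombusD(1,7)[OF assms]] .
  moreover from this have "y = z + st i b + st j c"
    using tiling_rhombusD(5)[OF assms] by simp
  ultimately show ?thesis
    using that by blast
qed

lemma rhombus_edges:
  assumes "tiling_rhombus z u y v"
  shows "edge u y = edge z v" "edge v y = edge z u"
proof -
  obtain i b j c where *: "i \<noteq> j" "u = z + st i b" "v = z + st j c" "y = z + st i b + st j c"
    using assms by (rule edge_opposite)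
  then have "y = u + st j c" "y = v + st i b"
    by (simp_all add: add_ac)
  then show "edge u y = edge z v" "edge v y = edge z u"
    using *(2,3) by (metis edge_st)+
qed

lemma tau_rhombus:
  assumes "tiling_rhombus z u y v"
  shows "tau s [z, u, y, u, z] = s (fst (edge z u)) z * s (fst (edge z v)) z"
    "tau s [z, u, y, v, z] = s (fst (edge z u)) z * s (fst (edge z v)) z"
    "tau s [z, u, z, v, z] = s (fst (edge z u)) z * s (fst (edge z v)) z"
  using tiling_rhombusD(1-4,6,7)[OF assms] rhombus_edges[OF assms]
    tiling_rhombusD(1-4)[OF assms, THEN adj3_sym]
  by auto

text \<open>Both ways around the rhombus use the same pair of directions, and the value is symmetric
  in them. In the middle position with \<open>d\<close> different from \<open>u\<close> and
  \<open>v\<close> both values vanish: a nonzero one would make \<open>d\<close>, \<open>z\<close>,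
  \<open>w\<close>, \<open>y\<close> a rhombus, with \<open>d\<close> the corner opposite to
  \<open>w\<close>.\<close>

lemma tau_commute:
  assumes "tiling_rhombus z u y v"
  shows "tau s (p @ [z, u, y] @ q) = tau s (p @ [z, v, y] @ q)"
proof (cases "length (p @ [z, u, y] @ q) = 5")
  case False
  then show ?thesis
    by (simp add: tau_length)
next
  case True
  note D = tiling_rhombusD(1-4,6,7)[OF assms]
  note S = D(1-4)[THEN adj3_sym]
  note e = rhombus_edges[OF assms]
  show ?thesis
    using True
  proof (cases rule: split_length5)
    case (0 d f)
    then show ?thesis
      using D S by (simp add: e mult.commute)
  next
    case (1 d f)
    have uv: "tau s [u, z, u, y, f] = tau s [u, z, v, y, f]" if R: "tiling_rhombus z u y v" for u v
      using tiling_rhombusD(1-4,6,7)[OF R] tiling_rhombusD(3)[OF R, THEN adj3_sym] rhombus_edges[OF R]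
      by (cases "f = u") auto
    show ?thesis
    proof (cases "d = u \<or> d = v")
      case True
      then show ?thesis
        using uv[OF assms] uv[OF tiling_rhombus_reflect[OF assms]] unfolding 1 append.simps by metis
    next
      case False
      have "\<not> (adj3 d z w \<and> adj3 w y d)" if w: "w \<in> {u, v}" for w
      proof
        assume a: "adj3 d z w \<and> adj3 w y d"
        have "d \<noteq> w"
          using w False by auto
        then have "w = z + y - d"
          using tiling_rhombusD(5)[OF four_cycle[of d z w y]] a D(5) by blast
        then show False
          using tiling_rhombusD(5)[OF assms] w False by (auto simp: algebra_simps)
      qed
      moreover have "w \<noteq> d" if "w \<in> {u, v}" for w
        using that False by auto
      ultimately have "tau s [d, z, w, y, f] = 0" if "w \<in> {u, v}" for w
        using that unfolding tau.simps by meson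
      from this[of u] this[of v] show ?thesis
        by (simp add: 1 del: tau.simps)
    qed
  next
    case (2 d f)
    then show ?thesis
      using D S by (cases "d = y") simp_all
  qed
qed

section \<open>Compatibility with the loop relations\<close>

definition sgn_bool :: "bool \<Rightarrow> int" where
  "sgn_bool b = (if b then 1 else - 1)"

text \<open>The trace of the signed element D in direction \<open>a\<close>, inserted at
  \<open>z\<close> between \<open>p\<close> and \<open>q\<close>. Both loops are included whether or
  not the arrows exist; by \<open>tau_walk\<close> a missing arrow contributes 0.\<close>

definition loop_tau :: "(3 \<Rightarrow> real^2 \<Rightarrow> int) \<Rightarrow> 3 \<Rightarrow> (real^2) list \<Rightarrow> real^2 \<Rightarrow> (real^2) list \<Rightarrow> int" where
  "loop_tau s a p z q = s a z *
    (tau s (p @ [z, z + st a True, z] @ q) - tau s (p @ [z, z + st a False, z] @ q))"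

lemma loop_tau_bool:
  "loop_tau s a p z q = s a z * sgn_bool b *
    (tau s (p @ [z, z + st a b, z] @ q) - tau s (p @ [z, z - st a b, z] @ q))"
proof -
  have "st a False = - st a True"
    by (simp add: st_def)
  then show ?thesis
    by (cases b) (simp_all add: loop_tau_def sgn_bool_def algebra_simps del: st_eq_minus)
qed

lemma weight2_third:
  assumes "i \<noteq> j" "k \<noteq> i" "k \<noteq> j"
  shows "weight2 x (i, b) = 1 - of_bool ((x, x - st j b) \<in> arrows) - of_bool ((x, x - st k b) \<in> arrows)"
proof -
  have "{l. l \<noteq> i \<and> (x, x - st l b) \<in> arrows} =
      (if (x, x - st j b) \<in> arrows then {j} else {}) \<union> (if (x, x - st k b) \<in> arrows then {k} else {})"
    using distinct3_third[OF assms] assms by auto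
  then show ?thesis
    using assms by (simp add: weight2_def)
qed

context
  fixes s :: "3 \<Rightarrow> real^2 \<Rightarrow> int"
  assumes sc: "sign_choice s"
begin

lemma sign_square: "z \<in> vertices \<Longrightarrow> s a z * s a z = 1"
proof -
  assume "z \<in> vertices"
  then have "s a z = 1 \<or> s a z = - 1"
    using sc unfolding sign_choice_def by blast
  then show ?thesis
    by auto
qed

lemma sign_step:
  assumes "(x, x + st i b) \<in> arrows"
  shows "s i (x + st i b) = - s i x" "c \<noteq> i \<Longrightarrow> s c (x + st i b) = s c x"
proof -
  have "(x + st i b) - x = dir i \<or> (x + st i b) - x = - dir i"
    by (simp add: st_def)
  then show "s i (x + st i b) = - s i x" "c \<noteq> i \<Longrightarrow> s c (x + st i b) = s c x"
    using sc assms unfolding sign_choice_def by blast+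
qed

text \<open>This computation is the origin of \<open>weight2\<close>. In the direction of the edge
  only the doubled loop counts, the opposite one being collinear. In another direction
  \<open>a\<close>, with third direction \<open>k\<close>, adjacency contributes the indicator that
  the arrow \<open>- st k b\<close> is missing minus the indicator that \<open>- st a b\<close> is
  present, which is 1 minus the number of arrows counted by \<open>weight2\<close>.\<close>

lemma loop_tau_start:
  assumes "(x, x + st i b) \<in> arrows"
  shows "loop_tau s a [] x [x + st i b, x] = s i x * sgn_bool b * weight2 x (i, b)"
proof (cases "a = i")
  case True
  have "\<not> adj3 (x - st i b) x (x + st i b)"
    using adj3_axis[of x i "\<not> b" b] by auto
  then show ?thesis
    unfolding True loop_tau_bool[of s i _ _ _ b] by simp
next
  case False
  have x: "x \<in> vertices"
    using assms arrows_vertices by blast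
  obtain k where k: "k \<noteq> i" "k \<noteq> a"
    using distinct3_cases[of i a] False by blast
  have "adj3 (x + st a b) x (x + st i b) \<longleftrightarrow> (x, x - st k b) \<notin> arrows"
    using adj3_same[OF x] False k by blast
  moreover have "adj3 (x - st a b) x (x + st i b) \<longleftrightarrow> (x, x - st a b) \<in> arrows"
    using adj3_opp[OF x, of i a b] adj3_sym assms False by blast
  ultimately have "tau s [x, x + st a b, x, x + st i b, x] = of_bool ((x, x - st k b) \<notin> arrows) * (s a x * s i x)"
    "tau s [x, x - st a b, x, x + st i b, x] = of_bool ((x, x - st a b) \<in> arrows) * (s a x * s i x)"
    using False by auto
  then have "loop_tau s a [] x [x + st i b, x] = (s a x * s a x) * s i x * sgn_bool b *
      (of_bool ((x, x - st k b) \<notin> arrows) - of_bool ((x, x - st a b) \<in> arrows))"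
    unfolding loop_tau_bool[of s a _ _ _ b] by (simp del: tau.simps add: algebra_simps)
  then show ?thesis
    using weight2_third[of i a k x b] False k by (simp add: sign_square[OF x] of_bool_not_iff)
qed

text \<open>The loops are inserted at the far end of the edge, whereas \<open>weight2\<close> counts
  arrows at \<open>x\<close>; \<open>arrow_flip\<close> converts one into the other. For
  \<open>a = i\<close> the sign \<open>s i\<close> and the orientation of the edge change together
  and cancel.\<close>

lemma loop_tau_middle:
  assumes "(x, x + st i b) \<in> arrows"
  shows "loop_tau s a [x] (x + st i b) [x] = s i x * sgn_bool b * weight2 x (i, b)"
proof (cases "a = i")
  case True
  have "\<not> adj3 x (x + st i b) (x + st i b + st i b)"
    using adj3_axis[of "x + st i b" i "\<not> b" b] by auto
  moreover have "x + st i b + st i b \<noteq> x"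
    by (simp add: add.assoc flip: scaleR_2)
  ultimately show ?thesis
    unfolding True loop_tau_bool[of s i _ _ _ b] by (simp add: sign_step(1)[OF assms])
next
  case False
  define z where "z = x + st i b"
  have xz: "x = z + st i (\<not> b)"
    by (simp add: z_def)
  have x: "x \<in> vertices" and z: "z \<in> vertices" and arr: "(z, x) \<in> arrows"
    using assms arrows_vertices arrows_sym unfolding z_def by blast+
  obtain k where k: "k \<noteq> i" "k \<noteq> a"
    using distinct3_cases[of i a] False by blast
  have "adj3 x z (z - st a b) \<longleftrightarrow> (z, z + st k b) \<notin> arrows"
    using adj3_same[OF z, of i a k "\<not> b"] False k unfolding xz by simp
  moreover have "adj3 x z (z + st a b) \<longleftrightarrow> (z, z + st a b) \<in> arrows"
    using adj3_opp[OF z, of i a "\<not> b"] arr False unfolding xz by auto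
  moreover have "(x, x - st k b) \<in> arrows \<longleftrightarrow> (z, z + st a b) \<notin> arrows"
    "(x, x - st a b) \<in> arrows \<longleftrightarrow> (z, z + st k b) \<notin> arrows"
    using arrow_flip[OF assms, of k a] arrow_flip[OF assms, of a k] False k unfolding z_def by blast+
  moreover have "z + st a b \<noteq> x" "z - st a b \<noteq> x"
    using False unfolding xz by auto
  moreover have "adj3 (z + st a b) z x \<longleftrightarrow> adj3 x z (z + st a b)" "adj3 (z - st a b) z x \<longleftrightarrow> adj3 x z (z - st a b)"
    using adj3_sym by blast+
  moreover have "edge x z = (i, b)"
    by (simp add: z_def)
  ultimately have "tau s [x, z, z + st a b, z, x] = of_bool ((x, x - st k b) \<notin> arrows) * (s a x * s i x)"
    "tau s [x, z, z - st a b, z, x] = of_bool ((x, x - st a b) \<in> arrows) * (s a x * s i x)"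
    by auto
  then have "loop_tau s a [x] z [x] = (s a z * s a x) * s i x * sgn_bool b *
      (of_bool ((x, x - st k b) \<notin> arrows) - of_bool ((x, x - st a b) \<in> arrows))"
    unfolding loop_tau_bool[of s a _ _ _ b] by (simp del: tau.simps add: algebra_simps)
  moreover have "s a z = s a x"
    using sign_step(2)[OF assms False] by (simp add: z_def)
  ultimately show ?thesis
    using weight2_third[of i a k x b] False k by (simp add: sign_square[OF x] of_bool_not_iff z_def)
qed

text \<open>The values computed for an insertion at the start and in the middle do not involve the
  direction. An insertion at the end is reduced to the start by reversing the closed path.\<close>

lemma loop_tau_independent:
  assumes "p @ [z] @ q \<in> walks"
  shows "loop_tau s a p z q = loop_tau s c p z q"
proof (cases "length p + length q = 2")
  case False
  then show ?thesis
    by (simp add: loop_tau_def tau_length)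
next
  case True
  then consider (0) d e where "p = []" "q = [d, e]" | (1) d e where "p = [d]" "q = [e]" | (2) d e where "p = [d, e]" "q = []"
    by (cases p; cases "tl p"; cases q; cases "tl q"; cases "tl (tl p)"; cases "tl (tl q)"; auto)
  then show ?thesis
  proof cases
    case 0
    then have "(z, d) \<in> arrows"
      using assms by (auto simp: walks_def)
    then obtain i b where "d = z + st i b"
      by (metis arrowsE)
    then show ?thesis
      using loop_tau_start[of z i b] \<open>(z, d) \<in> arrows\<close> 0 by (cases "e = z") (auto simp: loop_tau_def)
  next
    case 1
    then have "(d, z) \<in> arrows"
      using assms by (auto simp: walks_def)
    then obtain i b where "z = d + st i b"
      by (metis arrowsE)
    then show ?thesis
      using loop_tau_middle[of d i b] \<open>(d, z) \<in> arrows\<close> 1 by (cases "e = d") (auto simp: loop_tau_def)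
  next
    case 2
    then have "(z, e) \<in> arrows"
      using assms arrows_sym by (auto simp: walks_def)
    then obtain i b where e: "e = z + st i b"
      by (metis arrowsE)
    have "tau s [d, e, z, w, z] = (if d = z then tau s [z, w, z, e, z] else 0)" for w
      using tau_rev[of s z w e z] by (cases "d = z") (simp_all only: tau.simps simp_thms if_True if_False, simp)
    then have "loop_tau s a p z q = (if d = z then loop_tau s a [] z [e, z] else 0)" for a
      unfolding loop_tau_def 2 by (simp del: tau.simps)
    then show ?thesis
      using loop_tau_start[of z i b] \<open>(z, e) \<in> arrows\<close> e by simp
  qed
qed

end

section \<open>The radical of the trace form\<close>

definition trace_form :: "(3 \<Rightarrow> real^2 \<Rightarrow> int) \<Rightarrow> 'k::field path_comb \<Rightarrow> 'k" where
  "trace_form s f = (\<Sum>p\<in>keys f. lookup f p * of_int (tau s p))"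

lemma trace_form_superset:
  "finite P \<Longrightarrow> keys f \<subseteq> P \<Longrightarrow> trace_form s f = (\<Sum>p\<in>P. lookup f p * of_int (tau s p))"
  unfolding trace_form_def by (rule sum.mono_neutral_left) (auto simp: in_keys_iff)

lemma trace_form_add: "trace_form s (f + g) = trace_form s f + trace_form s g"
  using trace_form_superset[of "keys f \<union> keys g" f s] trace_form_superset[of "keys f \<union> keys g" g s]
    trace_form_superset[of "keys f \<union> keys g" "f + g" s] Poly_Mapping.keys_add[of f g]
  by (simp add: lookup_add distrib_right sum.distrib)

lemma trace_form_single: "trace_form s (single p c) = c * of_int (tau s p)"
  using trace_form_superset[of "{p}" "single p c" s] by simp

lemma trace_form_zero [simp]: "trace_form s 0 = 0"
  by (simp add: trace_form_def)

lemma trace_form_uminus: "trace_form s (- f) = - trace_form s f"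
  using trace_form_add[of s f "- f"] by (simp add: eq_neg_iff_add_eq_0 add.commute)

lemma trace_form_diff: "trace_form s (f - g) = trace_form s f - trace_form s g"
  using trace_form_add[of s f "- g"] by (simp add: trace_form_uminus)

text \<open>The kernel of a linear functional need not be an ideal. Allowing walks on both sides
  yields a two-sided ideal on which the trace vanishes, so that only the generating relations have
  to be tested.\<close>

definition trace_radical :: "(3 \<Rightarrow> real^2 \<Rightarrow> int) \<Rightarrow> 'k::field path_comb set" where
  "trace_radical s = {f \<in> pcar. \<forall>p\<in>walks. \<forall>q\<in>walks. \<forall>c d.
    trace_form s (path_mult (path_mult (single p c) f) (single q d)) = 0}"

lemma trace_radical_ideal: "two_sided_ideal (trace_radical s :: 'k::field path_comb set) path_algebra"
  unfolding two_sided_ideal_iff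
proof (intro conjI ballI)
  show "trace_radical s \<subseteq> pcar"
    by (auto simp: trace_radical_def)
  show "0 \<in> trace_radical s"
    by (simp add: trace_radical_def)
  show "f + g \<in> trace_radical s" if "f \<in> trace_radical s" "g \<in> trace_radical s" for f g
    using that pcar_add[of f g] by (simp add: trace_radical_def path_mult_add_left path_mult_add_right trace_form_add)
  show "- f \<in> trace_radical s" if "f \<in> trace_radical s" for f
    using that by (simp add: trace_radical_def path_mult_uminus_left path_mult_uminus_right trace_form_uminus)
  fix f h :: "'k path_comb"
  assume f: "f \<in> trace_radical s" and h: "h \<in> pcar"
  then have fc: "f \<in> pcar"
    by (auto simp: trace_radical_def)
  have rad: "trace_form s (path_mult (path_mult (single p c) f) (single q d)) = 0" if "p \<in> walks" "q \<in> walks" for p q c d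
    using f that by (simp add: trace_radical_def)
  have "trace_form s (path_mult (path_mult (single p c) (path_mult h f)) (single q d)) = 0"
    if "p \<in> walks" "q \<in> walks" for p q c d
    using h
  proof (induction h rule: pcar_induct)
    case (single r e)
    have "path_mult (single p c) (path_mult (single r e) f) = path_mult (path_mult (single p c) (single r e)) f"
      using path_mult_assoc[OF pcar_single pcar_single fc, OF that(1) single] by metis
    then show ?case
      using rad[OF _ that(2)] walks_append[OF that(1) single] by (cases "last p = hd r") simp_all
  qed (simp_all add: path_mult_add_left path_mult_add_right trace_form_add)
  then show "path_mult h f \<in> trace_radical s"
    using h fc pcar_mult[of h f] by (simp add: trace_radical_def)
  have "trace_form s (path_mult (path_mult (single p c) (path_mult f h)) (single q d)) = 0"
    if "p \<in> walks" "q \<in> walks" for p q c d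
    using h
  proof (induction h rule: pcar_induct)
    case (single r e)
    have "path_mult (path_mult (single p c) (path_mult f (single r e))) (single q d) =
      path_mult (path_mult (single p c) f) (path_mult (single r e) (single q d))"
      using path_mult_assoc[OF pcar_single fc pcar_single, OF that(1) single]
        path_mult_assoc[OF pcar_mult[OF pcar_single fc] pcar_single pcar_single, OF that(1) single that(2)] by metis
    then show ?case
      using rad[OF that(1)] walks_append[OF single that(2)] by (simp split: if_splits)
  qed (simp_all add: path_mult_add_left path_mult_add_right trace_form_add)
  then show "path_mult f h \<in> trace_radical s"
    using h fc pcar_mult[of f h] by (simp add: trace_radical_def)
qed

lemma split_walk:
  assumes "p \<noteq> []" "last p = a"
  obtains p' where "p = p' @ [a]"
  using assms append_butlast_last_id by metis

lemma split_walk_tl: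
  assumes "p \<noteq> []" "hd p = a"
  obtains p' where "p = a # p'"
  using assms by (cases p) auto

lemma trace_zero:
  assumes "(x, y) \<in> arrows" "(y, w) \<in> arrows" "x \<noteq> w" "\<not> adj3 x y w"
  shows "walk_elem [x, y, w] \<in> trace_radical s"
proof -
  have "trace_form s (path_mult (path_mult (single p c) (walk_elem [x, y, w])) (single q d)) = 0"
    if pq: "p \<in> walks" "q \<in> walks" for p q and c d :: 'a
  proof (cases "last p = x \<and> hd q = w")
    case True
    then obtain p' q' where "p = p' @ [x]" "q = w # q'"
      using split_walk split_walk_tl walks_not_Nil pq by metis
    then show ?thesis
      using tau_zero[OF assms(4,3), of s p' q'] by (simp add: trace_form_single)
  qed auto
  then show ?thesis
    using assms by (simp add: trace_radical_def walks_triple)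
qed

lemma trace_commute:
  assumes "tiling_rhombus z u y v"
  shows "walk_elem [z, u, y] - walk_elem [z, v, y] \<in> trace_radical s"
proof -
  have "trace_form s (path_mult (path_mult (single p c) (walk_elem [z, u, y] - walk_elem [z, v, y])) (single q d)) = 0"
    if pq: "p \<in> walks" "q \<in> walks" for p q and c d :: 'a
  proof (cases "last p = z \<and> hd q = y")
    case True
    then obtain p' q' where "p = p' @ [z]" "q = y # q'"
      using split_walk split_walk_tl walks_not_Nil pq by metis
    then show ?thesis
      using tau_commute[OF assms, of s p' q']
      by (simp add: trace_form_single path_mult_diff_left path_mult_diff_right trace_form_diff)
  qed (auto simp: path_mult_diff_left path_mult_diff_right)
  moreover have "walk_elem [z, u, y] - walk_elem [z, v, y] \<in> pcar"
    using tiling_rhombus_arrows[OF assms] by (intro pcar_diff pcar_single) (simp_all add: walks_triple)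
  ultimately show ?thesis
    by (simp add: trace_radical_def)
qed

lemma st_True: "st a True = dir a" and st_False: "st a False = - dir a"
  by (simp_all add: st_def)

lemma tau_walk:
  assumes "tau s p \<noteq> 0" "p = p' @ [z, w, z] @ q'" "p' @ [z] @ q' \<in> walks"
  shows "(z, w) \<in> arrows"
proof -
  have "length (p' @ [z, w, z] @ q') = 5"
    using assms tau_length by metis
  then show ?thesis
  proof (cases rule: split_length5)
    case (0 d e)
    have "(z, d) \<in> arrows"
      using assms(3) 0 by (auto simp: walks_def)
    then show ?thesis
      using assms(1) adj3_arrows(2)[of w z d] unfolding assms(2) 0 by (auto split: if_splits)
  next
    case (1 d e)
    have "(z, d) \<in> arrows"
      using assms(3) 1 arrows_sym by (auto simp: walks_def)
    then show ?thesis
      using assms(1) adj3_arrows(3)[of d z w] unfolding assms(2) 1 by (auto split: if_splits)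
  next
    case (2 d e)
    have "(z, e) \<in> arrows"
      using assms(3) 2 arrows_sym by (auto simp: walks_def)
    then show ?thesis
      using assms(1) adj3_arrows(3)[of e z w] unfolding assms(2) 2 by (auto split: if_splits)
  qed
qed

lemma trace_loop:
  assumes "sign_choice s"
  shows "signed_D s a z - signed_D s c z \<in> trace_radical s"
proof -
  have *: "trace_form s (path_mult (path_mult (single p k) (signed_D s a z)) (single q d)) = k * d * of_int (loop_tau s a p' z q')"
    if "p = p' @ [z]" "q = z # q'" "p' @ [z] @ q' \<in> walks" for p q p' q' a and k d :: 'a
  proof -
    have w: "tau s (p' @ [z, z + st a b, z] @ q') = 0" if "(z, z + st a b) \<notin> arrows" for b
      using tau_walk[of s _ p' z "z + st a b" q'] \<open>p' @ [z] @ q' \<in> walks\<close> that by metis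
    show ?thesis
      unfolding signed_D_eq using w[of True] w[of False]
      by (simp add: that(1,2) path_mult_diff_left path_mult_diff_right trace_form_diff trace_form_single
          loop_tau_def st_True st_False algebra_simps)
  qed
  have "trace_form s (path_mult (path_mult (single p k) (signed_D s a z - signed_D s c z)) (single q d)) = 0"
    if pq: "p \<in> walks" "q \<in> walks" for p q and k d :: 'a
  proof (cases "last p = z \<and> hd q = z")
    case True
    then obtain p' q' where p': "p = p' @ [z]" "q = z # q'"
      using split_walk split_walk_tl walks_not_Nil pq by metis
    then have w: "p' @ [z] @ q' \<in> walks"
      using walks_append(1)[OF pq] by simp
    show ?thesis
      unfolding path_mult_diff_left path_mult_diff_right trace_form_diff *[OF p' w]
      using loop_tau_independent[OF assms w, of a c] by simp
  qed (auto simp: path_mult_diff_left path_mult_diff_right signed_D_eq)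
  moreover have "signed_D s a z - signed_D s c z \<in> (pcar :: 'a path_comb set)"
    unfolding signed_D_eq by (intro pcar_diff) (auto simp: walks_triple arrows_sym pcar_single pcar_zero)
  ultimately show ?thesis
    by (simp add: trace_radical_def)
qed

text \<open>The ideal of relations lies in the radical because its generators do, while the trace of
  the cycle is \<open>c\<close> times a product of two signs, which is nonzero in every
  characteristic.\<close>

lemma rhombus_cycle_nonzero:
  assumes "sign_choice s" "tiling_rhombus w u y v" "c \<noteq> 0"
  shows "single [w, u, y, u, w] c \<notin> (rauzy_ideal s :: 'k::field path_comb set)"
proof
  assume in_ideal: "single [w, u, y, u, w] c \<in> rauzy_ideal s"
  have "rels s \<subseteq> (trace_radical s :: 'k path_comb set)"
    unfolding rels_def rel_zero_def rel_commute_def rel_loop_def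
    using trace_zero trace_commute trace_loop[OF assms(1)] by (fastforce simp: adj3_def)
  then have "single [w, u, y, u, w] c \<in> trace_radical s"
    using in_ideal rauzy_ideal_minimal[OF trace_radical_ideal] by blast
  moreover have v: "w \<in> vertices"
    using tiling_rhombus_arrows[OF assms(2)] arrows_vertices by blast
  then have "[w] \<in> walks"
    by (simp add: walks_single)
  ultimately have "trace_form s (path_mult (path_mult (single [w] 1) (single [w, u, y, u, w] c)) (single [w] 1)) = 0"
    unfolding trace_radical_def by blast
  then have "c * of_int (tau s [w, u, y, u, w]) = 0"
    by (simp add: trace_form_single del: tau.simps)
  then have "c * of_int (s (fst (edge w u)) w * s (fst (edge w v)) w) = 0"
    unfolding tau_rhombus(1)[OF assms(2)] .
  moreover have "s i w = 1 \<or> s i w = - 1" for i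
    using assms(1) v unfolding sign_choice_def by blast
  then have "s i w * s j w = 1 \<or> s i w * s j w = - 1" for i j
    by (metis mult_1 mult_minus_left minus_minus)
  ultimately show False
    using assms(3) by (metis mult_1_right mult_minus_right neg_equal_0_iff_equal of_int_1 of_int_minus)
qed

section \<open>Right modules over rings with local units\<close>

lemma right_moduleD:
  assumes "right_module A M"
  shows "abelian_group M"
    "a \<in> carrier A \<Longrightarrow> x \<in> carrier M \<Longrightarrow> a \<odot>\<^bsub>M\<^esub> x \<in> carrier M"
    "a \<in> carrier A \<Longrightarrow> b \<in> carrier A \<Longrightarrow> x \<in> carrier M \<Longrightarrow> (a \<oplus>\<^bsub>A\<^esub> b) \<odot>\<^bsub>M\<^esub> x = a \<odot>\<^bsub>M\<^esub> x \<oplus>\<^bsub>M\<^esub> b \<odot>\<^bsub>M\<^esub> x"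
    "a \<in> carrier A \<Longrightarrow> x \<in> carrier M \<Longrightarrow> y \<in> carrier M \<Longrightarrow> a \<odot>\<^bsub>M\<^esub> (x \<oplus>\<^bsub>M\<^esub> y) = a \<odot>\<^bsub>M\<^esub> x \<oplus>\<^bsub>M\<^esub> a \<odot>\<^bsub>M\<^esub> y"
    "a \<in> carrier A \<Longrightarrow> b \<in> carrier A \<Longrightarrow> x \<in> carrier M \<Longrightarrow> (a \<otimes>\<^bsub>A\<^esub> b) \<odot>\<^bsub>M\<^esub> x = b \<odot>\<^bsub>M\<^esub> (a \<odot>\<^bsub>M\<^esub> x)"
    "x \<in> carrier M \<Longrightarrow> \<exists>a\<in>carrier A. a \<odot>\<^bsub>M\<^esub> x = x"
  using assms unfolding right_module_def by blast+

lemma right_homD: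
  assumes "f \<in> right_hom A M N"
  shows "x \<in> carrier M \<Longrightarrow> f x \<in> carrier N"
    "x \<in> carrier M \<Longrightarrow> y \<in> carrier M \<Longrightarrow> f (x \<oplus>\<^bsub>M\<^esub> y) = f x \<oplus>\<^bsub>N\<^esub> f y"
    "a \<in> carrier A \<Longrightarrow> x \<in> carrier M \<Longrightarrow> f (a \<odot>\<^bsub>M\<^esub> x) = a \<odot>\<^bsub>N\<^esub> f x"
  using assms unfolding right_hom_def by auto

lemma right_homI:
  assumes "\<And>x. x \<in> carrier M \<Longrightarrow> f x \<in> carrier N"
    "\<And>x y. x \<in> carrier M \<Longrightarrow> y \<in> carrier M \<Longrightarrow> f (x \<oplus>\<^bsub>M\<^esub> y) = f x \<oplus>\<^bsub>N\<^esub> f y"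
    "\<And>a x. a \<in> carrier A \<Longrightarrow> x \<in> carrier M \<Longrightarrow> f (a \<odot>\<^bsub>M\<^esub> x) = a \<odot>\<^bsub>N\<^esub> f x"
  shows "f \<in> right_hom A M N"
  using assms unfolding right_hom_def by auto

lemma right_hom_zero:
  assumes "f \<in> right_hom A M N" "abelian_group M" "abelian_group N"
  shows "f \<zero>\<^bsub>M\<^esub> = \<zero>\<^bsub>N\<^esub>"
proof -
  interpret M: abelian_group M by fact
  interpret N: abelian_group N by fact
  have "f \<zero>\<^bsub>M\<^esub> \<oplus>\<^bsub>N\<^esub> f \<zero>\<^bsub>M\<^esub> = f \<zero>\<^bsub>M\<^esub>"
    using right_homD(2)[OF assms(1), of "\<zero>\<^bsub>M\<^esub>" "\<zero>\<^bsub>M\<^esub>"] by simp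
  then show ?thesis
    using right_homD(1)[OF assms(1), of "\<zero>\<^bsub>M\<^esub>"] by (metis M.zero_closed N.add.l_cancel_one)
qed

lemma right_hom_minus:
  assumes "f \<in> right_hom A M N" "abelian_group M" "abelian_group N" "x \<in> carrier M"
  shows "f (\<ominus>\<^bsub>M\<^esub> x) = \<ominus>\<^bsub>N\<^esub> f x"
proof -
  interpret M: abelian_group M by fact
  interpret N: abelian_group N by fact
  have "f (\<ominus>\<^bsub>M\<^esub> x) \<oplus>\<^bsub>N\<^esub> f x = \<zero>\<^bsub>N\<^esub>"
    using right_homD(2)[OF assms(1), of "\<ominus>\<^bsub>M\<^esub> x" x] right_hom_zero[OF assms(1-3)] assms(4) by (simp add: M.l_neg)
  then show ?thesis
    using right_homD(1)[OF assms(1)] assms(4) by (simp add: N.minus_equality)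
qed

lemma right_hom_comp:
  assumes "f \<in> right_hom A M N" "g \<in> right_hom A N L"
  shows "(\<lambda>x. g (f x)) \<in> right_hom A M L"
  using right_homD[OF assms(1)] right_homD[OF assms(2)] by (intro right_homI) auto

lemma right_iso_sym:
  assumes "f \<in> right_hom A M N" "bij_betw f (carrier M) (carrier N)" "right_module A M"
  shows "right_iso A N M"
proof -
  interpret M: abelian_group M
    by (rule right_moduleD(1)[OF assms(3)])
  let ?g = "inv_into (carrier M) f"
  note inj = bij_betw_imp_inj_on[OF assms(2)] and img = bij_betw_imp_surj_on[OF assms(2)]
  have eqI: "?g (f x) = x" if "x \<in> carrier M" for x
    using inj that by simp
  have ex: "\<exists>u\<in>carrier M. x = f u" if "x \<in> carrier N" for x
    using that img by (metis imageE)
  have "?g \<in> right_hom A N M"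
  proof (rule right_homI)
    fix x y assume xy: "x \<in> carrier N" "y \<in> carrier N"
    obtain u v where "u \<in> carrier M" "v \<in> carrier M" "x = f u" "y = f v"
      using ex[OF xy(1)] ex[OF xy(2)] by blast
    then show "?g (x \<oplus>\<^bsub>N\<^esub> y) = ?g x \<oplus>\<^bsub>M\<^esub> ?g y"
      using eqI[of "u \<oplus>\<^bsub>M\<^esub> v"] right_homD(2)[OF assms(1)] by (simp add: eqI)
  next
    fix a x assume a: "a \<in> carrier A" "x \<in> carrier N"
    then obtain u where "u \<in> carrier M" "x = f u"
      using ex by blast
    then show "?g (a \<odot>\<^bsub>N\<^esub> x) = a \<odot>\<^bsub>M\<^esub> ?g x"
      using eqI[of "a \<odot>\<^bsub>M\<^esub> u"] right_homD(3)[OF assms(1)] right_moduleD(2)[OF assms(3)] a by (simp add: eqI)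
  qed (use img in \<open>auto intro: inv_into_into\<close>)
  then show ?thesis
    unfolding right_iso_def using bij_betw_inv_into[OF assms(2)] by blast
qed

text \<open>Nothing but its operations is known of \<open>Q\<close>; the axioms come over the
  bijection. This serves for quotients and for copies of a module over another type.\<close>

lemma right_module_transport:
  assumes M: "right_module A M" and bij: "bij_betw f (carrier M) (carrier Q)"
    and add: "\<And>x y. x \<in> carrier M \<Longrightarrow> y \<in> carrier M \<Longrightarrow> f (x \<oplus>\<^bsub>M\<^esub> y) = f x \<oplus>\<^bsub>Q\<^esub> f y"
    and smult: "\<And>a x. a \<in> carrier A \<Longrightarrow> x \<in> carrier M \<Longrightarrow> f (a \<odot>\<^bsub>M\<^esub> x) = a \<odot>\<^bsub>Q\<^esub> f x"
    and zero: "\<zero>\<^bsub>Q\<^esub> = f \<zero>\<^bsub>M\<^esub>"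
    and A: "\<And>a b. a \<in> carrier A \<Longrightarrow> b \<in> carrier A \<Longrightarrow> a \<oplus>\<^bsub>A\<^esub> b \<in> carrier A \<and> a \<otimes>\<^bsub>A\<^esub> b \<in> carrier A"
  shows "right_module A Q" "f \<in> right_hom A M Q"
proof -
  interpret M: abelian_group M
    by (rule right_moduleD(1)[OF M])
  note m = right_moduleD[OF M]
  have img: "carrier Q = f ` carrier M"
    using bij by (simp add: bij_betw_imp_surj_on)
  have "abelian_group Q"
  proof (rule abelian_groupI, unfold img zero)
    fix x assume "x \<in> f ` carrier M"
    then obtain u where "u \<in> carrier M" "x = f u"
      by blast
    then show "\<exists>y\<in>f ` carrier M. y \<oplus>\<^bsub>Q\<^esub> x = f \<zero>\<^bsub>M\<^esub>"
      using add[of "\<ominus>\<^bsub>M\<^esub> u" u] by (intro bexI[of _ "f (\<ominus>\<^bsub>M\<^esub> u)"]) (auto simp: M.l_neg)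
  qed (auto simp flip: add simp: M.a_ac)
  moreover have "\<exists>a\<in>carrier A. a \<odot>\<^bsub>Q\<^esub> x = x" if "x \<in> f ` carrier M" for x
    using that m(6) smult by force
  ultimately show "right_module A Q"
    unfolding right_module_def img
    by (auto simp flip: add smult simp: m A)
  show "f \<in> right_hom A M Q"
    using add smult img by (intro right_homI) auto
qed

text \<open>The cosets of the kernel are the fibres of \<open>f\<close>, so \<open>fib\<close>
  identifies \<open>N\<close> with the quotient and the module axioms are transported along
  it.\<close>

lemma quotient_module_iso:
  assumes M: "right_module A M" and N: "right_module A N" and f: "f \<in> right_hom A M N"
    and surj: "f ` carrier M = carrier N"
    and A: "\<And>a b. a \<in> carrier A \<Longrightarrow> b \<in> carrier A \<Longrightarrow> a \<oplus>\<^bsub>A\<^esub> b \<in> carrier A \<and> a \<otimes>\<^bsub>A\<^esub> b \<in> carrier A"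
  shows "right_module A (quotient_module M (a_kernel M N f))"
    "right_iso A (quotient_module M (a_kernel M N f)) N"
proof -
  interpret M: abelian_group M
    by (rule right_moduleD(1)[OF M])
  interpret N: abelian_group N
    by (rule right_moduleD(1)[OF N])
  note fh = right_homD[OF f] and f0 = right_hom_zero[OF f M.abelian_group_axioms N.abelian_group_axioms]
  let ?K = "a_kernel M N f" and ?Q = "quotient_module M (a_kernel M N f)"
  define fib where "fib n = {y \<in> carrier M. f y = n}" for n
  have coset: "?K +>\<^bsub>M\<^esub> x = fib (f x)" if x: "x \<in> carrier M" for x
  proof (intro equalityI subsetI)
    fix y assume "y \<in> ?K +>\<^bsub>M\<^esub> x"
    then show "y \<in> fib (f x)"
      using x fh by (auto simp: a_r_coset_def' a_kernel_def' fib_def)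
  next
    fix y assume "y \<in> fib (f x)"
    then have y: "y \<in> carrier M" "f y = f x"
      by (auto simp: fib_def)
    then have "y \<ominus>\<^bsub>M\<^esub> x \<in> ?K"
      using x fh right_hom_minus[OF f M.abelian_group_axioms N.abelian_group_axioms x]
      by (simp add: a_kernel_def' M.minus_eq N.r_neg)
    moreover have "y = (y \<ominus>\<^bsub>M\<^esub> x) \<oplus>\<^bsub>M\<^esub> x"
      using x y by (simp add: M.minus_eq M.a_assoc M.l_neg)
    ultimately show "y \<in> ?K +>\<^bsub>M\<^esub> x"
      unfolding a_r_coset_def' by blast
  qed
  have car: "carrier ?Q = fib ` carrier N"
    using coset by (auto simp: quotient_module_def A_RCOSETS_def' image_iff simp flip: surj)
  have ne: "\<exists>x\<in>carrier M. f x = n" if "n \<in> carrier N" for n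
    using that surj by (metis imageE)
  have inj: "inj_on fib (carrier N)"
  proof (rule inj_onI)
    fix n n' assume n: "n \<in> carrier N" "fib n = fib n'"
    then obtain x where "x \<in> carrier M" "f x = n"
      using ne by blast
    then show "n = n'"
      using n(2) by (auto simp: fib_def)
  qed
  have bij: "bij_betw fib (carrier N) (carrier ?Q)"
    unfolding bij_betw_def car using inj by simp
  have add: "fib (m \<oplus>\<^bsub>N\<^esub> n) = fib m \<oplus>\<^bsub>?Q\<^esub> fib n" if mn: "m \<in> carrier N" "n \<in> carrier N" for m n
  proof -
    have "fib (m \<oplus>\<^bsub>N\<^esub> n) = (\<Union>h\<in>fib m. \<Union>k\<in>fib n. {h \<oplus>\<^bsub>M\<^esub> k})"
    proof (intro equalityI subsetI)
      fix y assume "y \<in> fib (m \<oplus>\<^bsub>N\<^esub> n)"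
      then have y: "y \<in> carrier M" "f y = m \<oplus>\<^bsub>N\<^esub> n"
        by (auto simp: fib_def)
      obtain x where x: "x \<in> carrier M" "f x = n"
        using ne mn by blast
      have "y \<ominus>\<^bsub>M\<^esub> x \<in> fib m"
        using x y mn fh right_hom_minus[OF f M.abelian_group_axioms N.abelian_group_axioms x(1)]
        by (simp add: fib_def M.minus_eq N.r_neg N.a_assoc)
      moreover have "y = (y \<ominus>\<^bsub>M\<^esub> x) \<oplus>\<^bsub>M\<^esub> x"
        using x y by (simp add: M.minus_eq M.a_assoc M.l_neg)
      moreover have "x \<in> fib n"
        using x by (simp add: fib_def)
      ultimately show "y \<in> (\<Union>h\<in>fib m. \<Union>k\<in>fib n. {h \<oplus>\<^bsub>M\<^esub> k})"
        by blast
    qed (use fh in \<open>auto simp: fib_def\<close>)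
    then show ?thesis
      by (simp add: quotient_module_def set_add_def')
  qed
  have smult: "fib (a \<odot>\<^bsub>N\<^esub> n) = a \<odot>\<^bsub>?Q\<^esub> fib n" if a: "a \<in> carrier A" "n \<in> carrier N" for a n
  proof -
    have "?K +>\<^bsub>M\<^esub> (a \<odot>\<^bsub>M\<^esub> x) = fib (a \<odot>\<^bsub>N\<^esub> n)" if "x \<in> fib n" for x
      using that a fh coset[of "a \<odot>\<^bsub>M\<^esub> x"] right_moduleD(2)[OF M] by (auto simp: fib_def)
    moreover have "fib n \<noteq> {}"
      using ne a by (auto simp: fib_def)
    ultimately show ?thesis
      by (auto simp: quotient_module_def)
  qed
  have zero: "\<zero>\<^bsub>?Q\<^esub> = fib \<zero>\<^bsub>N\<^esub>"
    by (simp add: quotient_module_def a_kernel_def' fib_def)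
  note t = right_module_transport[OF N bij add smult zero A]
  show "right_module A ?Q"
    by (rule t)
  show "right_iso A ?Q N"
    by (rule right_iso_sym[OF t(2) bij N])
qed

lemma sub_module_simps [simp]:
  "carrier (sub_module M N) = N" "x \<oplus>\<^bsub>sub_module M N\<^esub> y = x \<oplus>\<^bsub>M\<^esub> y" "\<zero>\<^bsub>sub_module M N\<^esub> = \<zero>\<^bsub>M\<^esub>"
  "a \<odot>\<^bsub>sub_module M N\<^esub> x = a \<odot>\<^bsub>M\<^esub> x" "sub_module (sub_module M N) N' = sub_module M N'"
  by (simp_all add: sub_module_def)

lemma regular_module_simps [simp]:
  "carrier (regular_module A) = carrier A" "x \<oplus>\<^bsub>regular_module A\<^esub> y = x \<oplus>\<^bsub>A\<^esub> y"
  "\<zero>\<^bsub>regular_module A\<^esub> = \<zero>\<^bsub>A\<^esub>" "a \<odot>\<^bsub>regular_module A\<^esub> x = x \<otimes>\<^bsub>A\<^esub> a"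
  by (simp_all add: regular_module_def)

section \<open>Right ideals as modules\<close>

locale local_unit_ring = abelian_group A for A :: "'a ring" (structure) +
  assumes m_closed [simp, intro]: "x \<in> carrier A \<Longrightarrow> y \<in> carrier A \<Longrightarrow> x \<otimes> y \<in> carrier A"
    and m_assoc: "x \<in> carrier A \<Longrightarrow> y \<in> carrier A \<Longrightarrow> z \<in> carrier A \<Longrightarrow> (x \<otimes> y) \<otimes> z = x \<otimes> (y \<otimes> z)"
    and l_distr: "x \<in> carrier A \<Longrightarrow> y \<in> carrier A \<Longrightarrow> z \<in> carrier A \<Longrightarrow> (x \<oplus> y) \<otimes> z = x \<otimes> z \<oplus> y \<otimes> z"
    and r_distr: "x \<in> carrier A \<Longrightarrow> y \<in> carrier A \<Longrightarrow> z \<in> carrier A \<Longrightarrow> z \<otimes> (x \<oplus> y) = z \<otimes> x \<oplus> z \<otimes> y"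
    and right_unit: "x \<in> carrier A \<Longrightarrow> \<exists>e\<in>carrier A. x \<otimes> e = x"
begin

lemma l_null [simp]: "x \<in> carrier A \<Longrightarrow> \<zero> \<otimes> x = \<zero>"
  using l_distr[of \<zero> \<zero> x] by (simp add: add.l_cancel_one)

lemma r_null [simp]: "x \<in> carrier A \<Longrightarrow> x \<otimes> \<zero> = \<zero>"
  using r_distr[of \<zero> \<zero> x] by (simp add: add.l_cancel_one)

lemma r_minus: "x \<in> carrier A \<Longrightarrow> y \<in> carrier A \<Longrightarrow> x \<otimes> (\<ominus> y) = \<ominus> (x \<otimes> y)"
  using r_distr[of "\<ominus> y" y x] by (simp add: l_neg minus_equality)

lemma l_minus: "x \<in> carrier A \<Longrightarrow> y \<in> carrier A \<Longrightarrow> (\<ominus> x) \<otimes> y = \<ominus> (x \<otimes> y)"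
  using l_distr[of "\<ominus> x" x y] by (simp add: l_neg minus_equality)

definition rid :: "'a set \<Rightarrow> bool" where
  "rid N \<longleftrightarrow> N \<subseteq> carrier A \<and> \<zero> \<in> N \<and> (\<forall>x\<in>N. \<forall>y\<in>N. x \<oplus> y \<in> N) \<and> (\<forall>x\<in>N. \<ominus> x \<in> N) \<and>
    (\<forall>x\<in>N. \<forall>a\<in>carrier A. x \<otimes> a \<in> N)"

abbreviation mod_of :: "'a set \<Rightarrow> ('a, 'a) module" where
  "mod_of N \<equiv> sub_module (regular_module A) N"

lemma ridD:
  assumes "rid N"
  shows "x \<in> N \<Longrightarrow> x \<in> carrier A" "\<zero> \<in> N" "x \<in> N \<Longrightarrow> y \<in> N \<Longrightarrow> x \<oplus> y \<in> N" "x \<in> N \<Longrightarrow> \<ominus> x \<in> N"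
    "x \<in> N \<Longrightarrow> a \<in> carrier A \<Longrightarrow> x \<otimes> a \<in> N"
  using assms unfolding rid_def by blast+

lemma abelian_group_mod_of:
  assumes "rid N"
  shows "abelian_group (mod_of N)"
proof (rule abelian_groupI)
  fix x assume "x \<in> carrier (mod_of N)"
  then show "\<exists>y\<in>carrier (mod_of N). y \<oplus>\<^bsub>mod_of N\<^esub> x = \<zero>\<^bsub>mod_of N\<^esub>"
    using ridD[OF assms] by (intro bexI[of _ "\<ominus> x"]) (auto simp: l_neg)
qed (use ridD[OF assms] in \<open>auto simp: a_ac\<close>)

lemma right_module_mod_of:
  assumes "rid N"
  shows "right_module A (mod_of N)"
  unfolding right_module_def using abelian_group_mod_of[OF assms] ridD[OF assms] right_unit
  by (auto simp: l_distr r_distr m_assoc)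

lemma a_inv_mod_of:
  assumes "rid N" "x \<in> N"
  shows "\<ominus>\<^bsub>mod_of N\<^esub> x = \<ominus> x"
  using abelian_group.minus_equality[OF abelian_group_mod_of[OF assms(1)], of "\<ominus> x" x] ridD[OF assms(1)] assms(2)
  by (simp add: l_neg)

lemma submodule_mod_of:
  assumes "rid N" "rid N'" "N' \<subseteq> N"
  shows "submodule N' A (mod_of N)"
proof -
  have "inv\<^bsub>add_monoid (mod_of N)\<^esub> x \<in> N'" if "x \<in> N'" for x
    using a_inv_mod_of[OF assms(1), of x] that assms(3) ridD(4)[OF assms(2)] by (auto simp: a_inv_def)
  then show ?thesis
    unfolding submodule_def submodule_axioms_def subgroup_def using ridD[OF assms(2)] assms(3) by auto
qed

lemma rid_of_submodule:
  assumes "rid N" "submodule N' A (mod_of N)"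
  shows "rid N'" "N' \<subseteq> N"
proof -
  interpret submodule N' A "mod_of N" by fact
  show sub: "N' \<subseteq> N"
    using subset by simp
  have "\<ominus> x \<in> N'" if "x \<in> N'" for x
  proof -
    have "\<ominus> x = inv\<^bsub>add_monoid (mod_of N)\<^esub> x"
      using a_inv_mod_of[OF assms(1) subsetD[OF sub that]] by (simp only: a_inv_def)
    then show ?thesis
      using m_inv_closed[OF that] by (simp only:)
  qed
  then show "rid N'"
    unfolding rid_def
  proof (intro conjI ballI)
    show "N' \<subseteq> carrier A"
      using sub ridD(1)[OF assms(1)] by blast
    show "\<zero> \<in> N'"
      using one_closed by simp
    show "x \<oplus> y \<in> N'" if "x \<in> N'" "y \<in> N'" for x y
      using m_closed[OF that] by simp
    show "x \<otimes> a \<in> N'" if "x \<in> N'" "a \<in> carrier A" for x a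
      using smult_closed[OF that(2,1)] by simp
  qed
qed

lemma rid_right_ideal:
  assumes "x \<in> carrier A"
  shows "rid (right_ideal A x)"
  unfolding rid_def right_ideal_def
proof (intro conjI ballI)
  show "\<zero> \<in> (\<lambda>a. x \<otimes> a) ` carrier A"
    using assms by (intro image_eqI[of _ _ \<zero>]) auto
  show "u \<oplus> v \<in> (\<lambda>a. x \<otimes> a) ` carrier A" if "u \<in> (\<lambda>a. x \<otimes> a) ` carrier A" "v \<in> (\<lambda>a. x \<otimes> a) ` carrier A" for u v
    using that assms by (auto simp flip: r_distr)
  show "\<ominus> u \<in> (\<lambda>a. x \<otimes> a) ` carrier A" if "u \<in> (\<lambda>a. x \<otimes> a) ` carrier A" for u
    using that assms by (auto simp flip: r_minus)
  show "u \<otimes> a \<in> (\<lambda>a. x \<otimes> a) ` carrier A" if "u \<in> (\<lambda>a. x \<otimes> a) ` carrier A" "a \<in> carrier A" for u a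
    using that assms by (auto simp: m_assoc)
qed (use assms in auto)

lemma right_ideal_refl: "x \<in> carrier A \<Longrightarrow> x \<in> right_ideal A x"
  using right_unit[of x] unfolding right_ideal_def by force

lemma right_ideal_subset: "rid N \<Longrightarrow> x \<in> N \<Longrightarrow> right_ideal A x \<subseteq> N"
  unfolding right_ideal_def using ridD(5) by auto

lemma rid_add:
  assumes "rid N" "rid N'"
  shows "rid (N <+>\<^bsub>A\<^esub> N')"
proof -
  have c: "N \<subseteq> carrier A" "N' \<subseteq> carrier A"
    using ridD(1) assms by auto
  have mem: "u \<in> N <+>\<^bsub>A\<^esub> N' \<longleftrightarrow> (\<exists>x\<in>N. \<exists>y\<in>N'. u = x \<oplus> y)" for u
    by (auto simp: set_add_def')
  show ?thesis
    unfolding rid_def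
  proof (intro conjI ballI)
    show "N <+>\<^bsub>A\<^esub> N' \<subseteq> carrier A"
      using ridD(1)[OF assms(1)] ridD(1)[OF assms(2)] by (auto simp: mem)
    show "\<zero> \<in> N <+>\<^bsub>A\<^esub> N'"
      unfolding mem using ridD(2)[OF assms(1)] ridD(2)[OF assms(2)] by force
    fix u assume "u \<in> N <+>\<^bsub>A\<^esub> N'"
    then obtain x y where u: "x \<in> N" "y \<in> N'" "u = x \<oplus> y"
      unfolding mem by blast
    have xy: "x \<in> carrier A" "y \<in> carrier A"
      using u c by auto
    show "\<ominus> u \<in> N <+>\<^bsub>A\<^esub> N'"
      unfolding mem using u xy ridD(4)[OF assms(1) u(1)] ridD(4)[OF assms(2) u(2)] minus_add by blast
    show "u \<otimes> a \<in> N <+>\<^bsub>A\<^esub> N'" if "a \<in> carrier A" for a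
      unfolding mem using u xy that ridD(5)[OF assms(1) u(1) that] ridD(5)[OF assms(2) u(2) that] l_distr by blast
    fix v assume "v \<in> N <+>\<^bsub>A\<^esub> N'"
    then obtain x' y' where v: "x' \<in> N" "y' \<in> N'" "v = x' \<oplus> y'"
      unfolding mem by blast
    have "u \<oplus> v = (x \<oplus> x') \<oplus> (y \<oplus> y')"
      using u v xy c by (simp add: a_ac subsetD)
    then show "u \<oplus> v \<in> N <+>\<^bsub>A\<^esub> N'"
      unfolding mem using ridD(3)[OF assms(1) u(1) v(1)] ridD(3)[OF assms(2) u(2) v(2)] by blast
  qed
qed

lemma subset_add_left: "rid N \<Longrightarrow> rid N' \<Longrightarrow> N \<subseteq> N <+>\<^bsub>A\<^esub> N'"
  using ridD(1,2) by (force simp: set_add_def')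

lemma subset_add_right: "rid N \<Longrightarrow> rid N' \<Longrightarrow> N' \<subseteq> N <+>\<^bsub>A\<^esub> N'"
  using ridD(1,2) by (force simp: set_add_def')

lemma left_mult_hom:
  assumes "l \<in> carrier A" "rid N" "\<And>x. x \<in> N \<Longrightarrow> l \<otimes> x \<in> N'"
  shows "(\<lambda>x. l \<otimes> x) \<in> right_hom A (mod_of N) (mod_of N')"
  using assms ridD(1)[OF assms(2)] by (intro right_homI) (auto simp: r_distr m_assoc)

text \<open>The first isomorphism theorem for left multiplication by \<open>l\<close>, which
  commutes with the right action.\<close>

lemma quotient_left_mult:
  assumes l: "l \<in> carrier A" and F': "rid F'" and g: "g \<in> F'"
    and img: "\<And>x. x \<in> F' \<Longrightarrow> l \<otimes> x \<in> right_ideal A (l \<otimes> g)"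
    and ker: "\<And>x. x \<in> F' \<Longrightarrow> l \<otimes> x = \<zero> \<longleftrightarrow> x \<in> F" and "F \<subseteq> F'"
  shows "right_module A (quotient_module (mod_of F') F)"
    "right_iso A (quotient_module (mod_of F') F) (mod_of (right_ideal A (l \<otimes> g)))"
proof -
  let ?N = "right_ideal A (l \<otimes> g)"
  have gc: "g \<in> carrier A"
    using ridD(1)[OF F' g] .
  have N: "rid ?N"
    using l gc by (intro rid_right_ideal) auto
  have "(\<lambda>x. l \<otimes> x) ` F' = ?N"
  proof
    show "?N \<subseteq> (\<lambda>x. l \<otimes> x) ` F'"
      using ridD(5)[OF F' g] l gc by (auto simp: right_ideal_def m_assoc)
  qed (use img in auto)
  moreover have "a_kernel (mod_of F') (mod_of ?N) (\<lambda>x. l \<otimes> x) = F"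
    using ker \<open>F \<subseteq> F'\<close> by (auto simp: a_kernel_def')
  ultimately show "right_module A (quotient_module (mod_of F') F)"
    "right_iso A (quotient_module (mod_of F') F) (mod_of (right_ideal A (l \<otimes> g)))"
    using quotient_module_iso[OF right_module_mod_of[OF F'] right_module_mod_of[OF N] left_mult_hom[OF l F' img]]
    by auto
qed

end

section \<open>Projective covers by a module generated by an idempotent\<close>

locale idempotent_cover = local_unit_ring A for A :: "'a ring" (structure) +
  fixes e :: 'a and \<pi> :: "'a \<Rightarrow> 'm" and T :: "('a, 'm) module"
  assumes e: "e \<in> carrier A" "e \<otimes> e = e"
    and T: "right_module A T"
    and pi: "\<pi> \<in> right_hom A (mod_of (right_ideal A e)) T" "\<pi> ` right_ideal A e = carrier T"
    and nil: "\<And>k. k \<in> right_ideal A e \<Longrightarrow> \<pi> k = \<zero>\<^bsub>T\<^esub> \<Longrightarrow> k \<otimes> e = k \<Longrightarrow> k \<otimes> k \<otimes> k = \<zero>"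
begin

abbreviation "eA \<equiv> right_ideal A e"
abbreviation "K \<equiv> a_kernel (mod_of eA) T \<pi>"

lemma eA: "rid eA" "e \<in> eA" "x \<in> eA \<Longrightarrow> x \<in> carrier A" "x \<in> eA \<Longrightarrow> e \<otimes> x = x"
proof -
  show r: "rid eA" "e \<in> eA"
    using e rid_right_ideal right_ideal_refl by auto
  then show "x \<in> eA \<Longrightarrow> x \<in> carrier A"
    using ridD(1) by blast
  show "x \<in> eA \<Longrightarrow> e \<otimes> x = x"
    using e by (auto simp: right_ideal_def simp flip: m_assoc)
qed

lemma K_iff: "x \<in> K \<longleftrightarrow> x \<in> eA \<and> \<pi> x = \<zero>\<^bsub>T\<^esub>"
  by (simp add: a_kernel_def')

lemma pi_zero: "\<pi> \<zero> = \<zero>\<^bsub>T\<^esub>"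
  using right_hom_zero[OF pi(1) abelian_group_mod_of[OF eA(1)] right_moduleD(1)[OF T]] by simp

lemma smult_zero: "right_module A M \<Longrightarrow> a \<in> carrier A \<Longrightarrow> a \<odot>\<^bsub>M\<^esub> \<zero>\<^bsub>M\<^esub> = \<zero>\<^bsub>M\<^esub>"
proof -
  assume M: "right_module A M" and a: "a \<in> carrier A"
  interpret M: abelian_group M
    by (rule right_moduleD(1)[OF M])
  show ?thesis
    using right_moduleD(4)[OF M a M.zero_closed M.zero_closed] right_moduleD(2)[OF M a M.zero_closed]
    by (simp add: M.add.l_cancel_one)
qed

lemma K_rid: "rid K"
proof -
  interpret T: abelian_group T
    by (rule right_moduleD(1)[OF T])
  note h = right_homD[OF pi(1), simplified]
  have minus: "\<pi> (\<ominus> x) = \<ominus>\<^bsub>T\<^esub> \<pi> x" if "x \<in> eA" for x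
    using right_hom_minus[OF pi(1) abelian_group_mod_of[OF eA(1)] T.abelian_group_axioms, of x]
      a_inv_mod_of[OF eA(1) that] that by simp
  show ?thesis
    unfolding rid_def
    by (intro conjI ballI subsetI)
      (simp_all add: K_iff h pi_zero minus ridD[OF eA(1)] eA(3) smult_zero[OF T])
qed

text \<open>A homomorphism out of \<open>eA\<close> is determined by its value at \<open>e\<close>,
  so acting on a preimage of \<open>h e\<close> gives the lift.\<close>

lemma lift:
  assumes X: "right_module A X" and Y: "right_module A Y" and g: "g \<in> right_hom A X Y" "g ` carrier X = carrier Y"
    and h: "h \<in> right_hom A (mod_of eA) Y"
  shows "\<exists>l\<in>right_hom A (mod_of eA) X. \<forall>x\<in>eA. g (l x) = h x"
proof -
  note hh = right_homD[OF h, simplified] and gg = right_homD[OF g(1)]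
  obtain x0 where x0: "x0 \<in> carrier X" "g x0 = h e"
    using hh(1)[OF eA(2)] g(2) by (metis imageE)
  define x1 where "x1 = e \<odot>\<^bsub>X\<^esub> x0"
  have x1: "x1 \<in> carrier X" "g x1 = h e"
    using right_moduleD(2)[OF X e(1) x0(1)] gg(3)[OF e(1) x0(1)] hh(3)[OF e(1) eA(2)] x0(2) e(2)
    by (simp_all add: x1_def)
  have hom: "(\<lambda>a. a \<odot>\<^bsub>X\<^esub> x1) \<in> right_hom A (mod_of eA) X"
    using right_moduleD[OF X] x1 eA(3) by (intro right_homI) auto
  have "g (a \<odot>\<^bsub>X\<^esub> x1) = h a" if "a \<in> eA" for a
    using gg(3)[OF eA(3)[OF that] x1(1)] hh(3)[OF eA(3)[OF that] eA(2)] x1(2) eA(4)[OF that] by simp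
  then show ?thesis
    by (intro bexI[OF _ hom] ballI)
qed

text \<open>Write \<open>e\<close> as n + k with n in \<open>N\<close> and k in the kernel, both
  multiplied by \<open>e\<close> on the right. Then x = n x + k x on \<open>eA\<close>, and as k k k
  = 0 this puts first k k, then k, then \<open>e\<close> into \<open>N\<close>.\<close>

lemma superfluous:
  assumes N: "rid N" "N \<subseteq> eA" and sum: "N <+>\<^bsub>A\<^esub> K = eA"
  shows "N = eA"
proof -
  obtain n0 k0 where nk: "n0 \<in> N" "k0 \<in> K" "e = n0 \<oplus> k0"
  proof -
    have "e \<in> N <+>\<^bsub>A\<^esub> K"
      using eA(2) sum by simp
    then show ?thesis
      using that unfolding set_add_def' by blast
  qed
  define n k where "n = n0 \<otimes> e" and "k = k0 \<otimes> e"
  have nk0c: "n0 \<in> carrier A" "k0 \<in> carrier A"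
    using nk ridD(1)[OF N(1)] ridD(1)[OF K_rid] by auto
  have n: "n \<in> N" and k: "k \<in> K" and kc: "k \<in> carrier A" and nc: "n \<in> carrier A"
    using nk nk0c e ridD(5)[OF N(1)] ridD(5)[OF K_rid] by (auto simp: n_def k_def)
  have ke: "k \<otimes> e = k"
    using nk0c e by (simp add: k_def m_assoc)
  have enk: "e = n \<oplus> k"
    using l_distr[OF nk0c e(1)] nk(3) e(2) by (simp add: n_def k_def)
  have step: "x = n \<otimes> x \<oplus> k \<otimes> x" if "x \<in> eA" for x
    using l_distr[OF nc kc eA(3)[OF that]] eA(4)[OF that] by (simp flip: enk)
  have kk: "k \<in> eA" "k \<otimes> k \<in> eA" "k \<otimes> (k \<otimes> k) = \<zero>"
    using k kc ke ridD(5)[OF eA(1)] nil[of k] by (auto simp: K_iff m_assoc)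
  have nN: "n \<otimes> x \<in> N" if "x \<in> carrier A" for x
    using ridD(5)[OF N(1) n that] .
  have "k \<otimes> k = n \<otimes> (k \<otimes> k)"
    using step[OF kk(2)] kk(3) nc kc by simp
  then have "k \<otimes> k \<in> N"
    using nN[of "k \<otimes> k"] kc by simp
  then have "k \<in> N"
    using step[OF kk(1)] nN[OF kc] ridD(3)[OF N(1)] by metis
  then have "e \<in> N"
    using enk n ridD(3)[OF N(1)] by simp
  then show ?thesis
    using right_ideal_subset[OF N(1)] N(2) by blast
qed

lemma projective_cover_exists: "projective_cover A (mod_of eA) \<pi> T"
proof -
  have "N = eA" if "submodule N A (mod_of eA)" "N <+>\<^bsub>mod_of eA\<^esub> K = eA" for N
  proof -
    have "N <+>\<^bsub>mod_of eA\<^esub> K = N <+>\<^bsub>A\<^esub> K"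
      by (simp add: set_add_def')
    then show ?thesis
      using superfluous rid_of_submodule[OF eA(1) that(1)] that(2) by simp
  qed
  then show ?thesis
    unfolding projective_cover_def projective_def using right_module_mod_of[OF eA(1)] T pi lift by auto
qed

text \<open>The element k = e - u lies in the kernel, so its cube vanishes. But u a = 0 gives k a =
  a, and hence a = k k k a = 0.\<close>

lemma unipotent_cancel:
  assumes "u \<in> eA" "u \<otimes> e = u" "\<pi> u = \<pi> e" "a \<in> eA" "u \<otimes> a = \<zero>"
  shows "a = \<zero>"
proof -
  interpret T: abelian_group T
    by (rule right_moduleD(1)[OF T])
  define k where "k = e \<ominus> u"
  have c: "u \<in> carrier A" "a \<in> carrier A" "k \<in> carrier A"
    using assms eA(3) e by (auto simp: k_def minus_eq)
  have kA: "k \<in> eA"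
    unfolding k_def minus_eq using ridD[OF eA(1)] eA(2) assms(1) by blast
  have "\<pi> k = \<pi> e \<oplus>\<^bsub>T\<^esub> \<pi> (\<ominus> u)"
    unfolding k_def minus_eq using right_homD(2)[OF pi(1), simplified, of e "\<ominus> u"] eA(2) assms(1) ridD(4)[OF eA(1)] by auto
  also have "\<pi> (\<ominus> u) = \<ominus>\<^bsub>T\<^esub> \<pi> u"
    using right_hom_minus[OF pi(1) abelian_group_mod_of[OF eA(1)] T.abelian_group_axioms, of u] a_inv_mod_of[OF eA(1) assms(1)] assms(1)
    by simp
  finally have "\<pi> k = \<zero>\<^bsub>T\<^esub>"
    using right_homD(1)[OF pi(1), simplified, of e] eA(2) assms(3) by (simp add: T.r_neg)
  moreover have "k \<otimes> e = k"
    using c e assms(2) by (simp add: k_def minus_eq l_distr l_minus)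
  ultimately have kkk: "k \<otimes> k \<otimes> k = \<zero>"
    using nil[OF kA] by blast
  have "k \<otimes> a = a"
    using c e eA(4)[OF assms(4)] assms(5) by (simp add: k_def minus_eq l_distr l_minus)
  then have "a = k \<otimes> k \<otimes> k \<otimes> a"
    using c by (simp add: m_assoc)
  then show ?thesis
    using kkk c by simp
qed

lemma projective_cover_kernel:
  fixes P :: "('a, 'p) module"
  assumes "projective_cover A P \<rho> T"
  shows "right_iso A (sub_module P (a_kernel P T \<rho>)) (mod_of K)"
proof -
  have P: "right_module A P" and rho: "\<rho> \<in> right_hom A P T" "\<rho> ` carrier P = carrier T"
    and sup: "\<And>N. submodule N A P \<Longrightarrow> N <+>\<^bsub>P\<^esub> a_kernel P T \<rho> = carrier P \<Longrightarrow> N = carrier P"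
    and lifting: "\<And>(M :: ('a, 'p \<Rightarrow> 'a) module) (N :: ('a, 'p) module) g h.
      right_module A M \<Longrightarrow> right_module A N \<Longrightarrow> g \<in> right_hom A M N \<Longrightarrow> g ` carrier M = carrier N \<Longrightarrow>
      h \<in> right_hom A P N \<Longrightarrow> \<exists>l\<in>right_hom A P M. \<forall>x\<in>carrier P. g (l x) = h x"
    using assms unfolding projective_cover_def projective_def by blast+
  interpret P: abelian_group P
    by (rule right_moduleD(1)[OF P])
  interpret T: abelian_group T
    by (rule right_moduleD(1)[OF T])
  have cl: "a \<oplus> b \<in> carrier A \<and> a \<otimes> b \<in> carrier A" if "a \<in> carrier A" "b \<in> carrier A" for a b
    using that by simp
  text \<open>The lifting property of \<open>P\<close> is available only for modules over two particular types, so \<open>eA\<close>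
    and \<open>T\<close> are replaced by the copies \<open>M'\<close> and \<open>N'\<close> over these types.\<close>
  define M' :: "('a, 'p \<Rightarrow> 'a) module" where
    "M' = \<lparr>carrier = (\<lambda>x _. x) ` eA, mult = undefined, one = undefined, zero = (\<lambda>_. \<zero>),
      add = (\<lambda>u v p. u p \<oplus> v p), smult = (\<lambda>a u p. u p \<otimes> a)\<rparr>"
  have "right_module A M'" and M'hom: "(\<lambda>x _. x) \<in> right_hom A (mod_of eA) M'"
    by (rule right_module_transport[OF right_module_mod_of[OF eA(1)], of "\<lambda>x _. x" M'];
        auto simp: M'_def bij_betw_def inj_on_def fun_eq_iff)+
  \<comment> \<open>A set-theoretic section of \<open>\<rho>\<close> embeds \<open>T\<close> into
    the type of \<open>P\<close>.\<close>
  define sec where "sec = inv_into (carrier P) \<rho>"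
  have sec: "\<rho> (sec t) = t" if "t \<in> carrier T" for t
    using that rho(2) by (simp add: sec_def f_inv_into_f)
  define N' :: "('a, 'p) module" where
    "N' = \<lparr>carrier = sec ` carrier T, mult = undefined, one = undefined, zero = sec \<zero>\<^bsub>T\<^esub>,
      add = (\<lambda>u v. sec (\<rho> u \<oplus>\<^bsub>T\<^esub> \<rho> v)), smult = (\<lambda>a u. sec (a \<odot>\<^bsub>T\<^esub> \<rho> u))\<rparr>"
  have "right_module A N'" and N'hom: "sec \<in> right_hom A T N'"
    by (rule right_module_transport[OF T, of sec N'];
        auto simp: N'_def bij_betw_def sec cl intro: inj_on_inverseI[where g = \<rho>])+
  \<comment> \<open>The elements of \<open>M'\<close> are constant functions, so the value at any
    argument, here \<open>undefined\<close>, recovers the element of \<open>eA\<close>.\<close>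
  define g where "g u = sec (\<pi> (u undefined))" for u :: "'p \<Rightarrow> 'a"
  note ph = right_homD[OF pi(1), simplified] and th = right_moduleD[OF T]
  have "g \<in> right_hom A M' N'"
    using ph th by (intro right_homI) (auto simp: g_def M'_def N'_def sec eA(3))
  moreover have "g ` carrier M' = carrier N'"
    by (simp add: g_def M'_def N'_def image_image flip: pi(2))
  moreover have "(\<lambda>x. sec (\<rho> x)) \<in> right_hom A P N'"
    using right_hom_comp[OF rho(1) N'hom] .
  ultimately have "\<exists>l\<in>right_hom A P M'. \<forall>x\<in>carrier P. g (l x) = sec (\<rho> x)"
    by (rule lifting[OF \<open>right_module A M'\<close> \<open>right_module A N'\<close>])
  then obtain l where l: "l \<in> right_hom A P M'" "\<And>x. x \<in> carrier P \<Longrightarrow> g (l x) = sec (\<rho> x)"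
    by metis
  define \<phi> where "\<phi> x = l x undefined" for x
  have phi: "\<phi> \<in> right_hom A P (mod_of eA)"
  proof (rule right_homI)
    fix x assume "x \<in> carrier P"
    then have "l x \<in> (\<lambda>x _. x) ` eA"
      using right_homD(1)[OF l(1)] by (simp add: M'_def)
    then show "\<phi> x \<in> carrier (mod_of eA)"
      by (auto simp: \<phi>_def)
  qed (use right_homD(2,3)[OF l(1)] in \<open>simp_all add: \<phi>_def M'_def\<close>)
  have pi_phi: "\<pi> (\<phi> x) = \<rho> x" if "x \<in> carrier P" for x
    using l(2)[OF that] sec right_homD(1)[OF rho(1) that] ph(1) right_homD(1)[OF phi that, simplified]
    unfolding g_def \<phi>_def[symmetric] by metis
  obtain \<psi> where psi: "\<psi> \<in> right_hom A (mod_of eA) P" "\<And>x. x \<in> eA \<Longrightarrow> \<rho> (\<psi> x) = \<pi> x"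
    using lift[OF P T rho pi(1)] by blast
  note psih = right_homD[OF psi(1), simplified] and phih = right_homD[OF phi, simplified]
  define u where "u = \<phi> (\<psi> e)"
  have ua: "\<phi> (\<psi> a) = u \<otimes> a" if "a \<in> eA" for a
    using psih(3)[OF eA(3)[OF that] eA(2)] phih(3)[OF eA(3)[OF that] psih(1)[OF eA(2)]] eA(4)[OF that]
    by (simp add: u_def)
  have u: "u \<in> eA" "u \<otimes> e = u" "\<pi> u = \<pi> e"
    using psih(1)[OF eA(2)] phih(1) ua[OF eA(2)] pi_phi psi(2)[OF eA(2)] by (auto simp: u_def)
  have psi0: "\<psi> \<zero> = \<zero>\<^bsub>P\<^esub>" and phi0: "\<phi> \<zero>\<^bsub>P\<^esub> = \<zero>"
    using right_hom_zero[OF psi(1) abelian_group_mod_of[OF eA(1)] P.abelian_group_axioms]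
      right_hom_zero[OF phi P.abelian_group_axioms abelian_group_mod_of[OF eA(1)]] by simp_all
  have inj0: "a = \<zero>" if "a \<in> eA" "\<psi> a = \<zero>\<^bsub>P\<^esub>" for a
    using unipotent_cancel[OF u that(1)] ua[OF that(1)] that(2) phi0 by simp
  have psi_minus: "\<psi> (\<ominus> b) = \<ominus>\<^bsub>P\<^esub> \<psi> b" if "b \<in> eA" for b
    using right_hom_minus[OF psi(1) abelian_group_mod_of[OF eA(1)] P.abelian_group_axioms, of b] a_inv_mod_of[OF eA(1) that] that
    by simp
  have inj: "inj_on \<psi> eA"
  proof (rule inj_onI)
    fix a b assume ab: "a \<in> eA" "b \<in> eA" "\<psi> a = \<psi> b"
    have nb: "\<ominus> b \<in> eA"
      using ridD(4)[OF eA(1) ab(2)] .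
    have "\<psi> (a \<oplus> \<ominus> b) = \<zero>\<^bsub>P\<^esub>"
      using psih(2)[OF ab(1) nb] psi_minus[OF ab(2)] ab(3) psih(1)[OF ab(2)] by (simp add: P.r_neg)
    then have "a \<oplus> \<ominus> b = \<zero>"
      using inj0 ridD(3)[OF eA(1) ab(1) nb] by blast
    then show "a = b"
      using ab eA(3) minus_equality[of a "\<ominus> b"] by (metis a_inv_closed minus_minus)
  qed
  have surj: "\<psi> ` eA = carrier P"
  proof (rule sup)
    show "submodule (\<psi> ` eA) A P"
    proof (intro submodule.intro submodule_axioms.intro subgroup.intro)
      show "\<psi> ` eA \<subseteq> carrier (add_monoid P)"
        using psih(1) by auto
      show "x \<otimes>\<^bsub>add_monoid P\<^esub> y \<in> \<psi> ` eA" if xy: "x \<in> \<psi> ` eA" "y \<in> \<psi> ` eA" for x y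
      proof -
        obtain a where a: "x = \<psi> a" "a \<in> eA"
          using xy(1) by (rule imageE)
        obtain b where b: "y = \<psi> b" "b \<in> eA"
          using xy(2) by (rule imageE)
        show ?thesis
          using psih(2)[OF a(2) b(2)] imageI[OF ridD(3)[OF eA(1) a(2) b(2)], of \<psi>] a(1) b(1) by simp
      qed
      show "\<one>\<^bsub>add_monoid P\<^esub> \<in> \<psi> ` eA"
        using psi0 ridD(2)[OF eA(1)] by (metis imageI monoid.select_convs(2))
      show "inv\<^bsub>add_monoid P\<^esub> x \<in> \<psi> ` eA" if x: "x \<in> \<psi> ` eA" for x
      proof -
        obtain a where a: "x = \<psi> a" "a \<in> eA"
          using x by (rule imageE)
        show ?thesis
          using psi_minus[OF a(2)] imageI[OF ridD(4)[OF eA(1) a(2)], of \<psi>] a(1) unfolding a_inv_def[symmetric] by simp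
      qed
      show "a \<odot>\<^bsub>P\<^esub> x \<in> \<psi> ` eA" if ax: "a \<in> carrier A" "x \<in> \<psi> ` eA" for a x
      proof -
        obtain b where b: "x = \<psi> b" "b \<in> eA"
          using ax(2) by (rule imageE)
        show ?thesis
          using psih(3)[OF ax(1) b(2)] imageI[OF ridD(5)[OF eA(1) b(2) ax(1)], of \<psi>] b(1) by simp
      qed
    qed
    show "\<psi> ` eA <+>\<^bsub>P\<^esub> a_kernel P T \<rho> = carrier P"
    proof
      show "\<psi> ` eA <+>\<^bsub>P\<^esub> a_kernel P T \<rho> \<subseteq> carrier P"
        using psih(1) by (auto simp: set_add_def' a_kernel_def')
      show "carrier P \<subseteq> \<psi> ` eA <+>\<^bsub>P\<^esub> a_kernel P T \<rho>"
      proof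
        fix x assume x: "x \<in> carrier P"
        then obtain a where a: "a \<in> eA" "\<pi> a = \<rho> x"
          using right_homD(1)[OF rho(1)] pi(2) by (metis imageE)
        have k: "\<ominus>\<^bsub>P\<^esub> \<psi> a \<oplus>\<^bsub>P\<^esub> x \<in> a_kernel P T \<rho>"
          using x a psih(1)[OF a(1)] psi(2)[OF a(1)] right_homD(1,2)[OF rho(1)]
            right_hom_minus[OF rho(1) P.abelian_group_axioms T.abelian_group_axioms]
          by (simp add: a_kernel_def' T.l_neg)
        have "x = \<psi> a \<oplus>\<^bsub>P\<^esub> (\<ominus>\<^bsub>P\<^esub> \<psi> a \<oplus>\<^bsub>P\<^esub> x)"
          using x psih(1)[OF a(1)] by (simp add: P.r_neg flip: P.a_assoc)
        then show "x \<in> \<psi> ` eA <+>\<^bsub>P\<^esub> a_kernel P T \<rho>"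
          unfolding set_add_def' using a(1) k by blast
      qed
    qed
  qed
  have "bij_betw \<psi> K (a_kernel P T \<rho>)"
    unfolding bij_betw_def
  proof
    show "inj_on \<psi> K"
      using inj by (rule inj_on_subset) (auto simp: K_iff)
    show "\<psi> ` K = a_kernel P T \<rho>"
    proof (intro equalityI subsetI)
      fix y assume "y \<in> a_kernel P T \<rho>"
      then have y: "y \<in> carrier P" "\<rho> y = \<zero>\<^bsub>T\<^esub>"
        by (simp_all add: a_kernel_def')
      then obtain a where "a \<in> eA" "y = \<psi> a"
        using surj by (metis imageE)
      then show "y \<in> \<psi> ` K"
        using psi(2) y(2) K_iff by (metis imageI)
    qed (auto simp: K_iff a_kernel_def' psih(1) psi(2))
  qed
  moreover have "\<psi> \<in> right_hom A (mod_of K) (sub_module P (a_kernel P T \<rho>))"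
    using psih psi(2) by (intro right_homI) (auto simp: K_iff a_kernel_def' eA(3))
  ultimately show ?thesis
    using right_module_mod_of[OF K_rid] by (intro right_iso_sym[of \<psi>]) simp_all
qed

end

section \<open>Paths modulo right ideals\<close>

text \<open>An edge lies on two rhombi. The candidates at \<open>x\<close> are
  \<open>x \<plusminus> st j b\<close> and \<open>x \<plusminus> st k b\<close>: a minus is adjacent
  to \<open>z\<close> exactly if it is an arrow, and a plus exactly if the minus in the other
  direction is no arrow, so two of the four survive.\<close>

lemma edge_completions:
  assumes "adj3 z x y1" "adj3 z x y2" "adj3 z x w" "y1 \<noteq> z" "y2 \<noteq> z" "w \<noteq> z" "y1 \<noteq> y2"
  shows "w = y1 \<or> w = y2"
proof -
  obtain i b where z: "z = x + st i b"
    using adj3_arrows(2)[OF assms(1)] arrowsE by metis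
  have x: "x \<in> vertices" and arr: "(x, x + st i b) \<in> arrows"
    using adj3_arrows(2)[OF assms(1)] arrows_vertices unfolding z by blast+
  obtain j where j: "j \<noteq> i"
    using other3 by blast
  obtain k where k: "k \<noteq> i" "k \<noteq> j"
    using distinct3_cases[OF j] by blast
  have opp: "adj3 z x (x - st l b) \<longleftrightarrow> (x, x - st l b) \<in> arrows" if "l \<noteq> i" for l
    using adj3_opp[OF x, of i l b] arr that unfolding z by blast
  have same: "adj3 z x (x + st j b) \<longleftrightarrow> (x, x - st k b) \<notin> arrows" "adj3 z x (x + st k b) \<longleftrightarrow> (x, x - st j b) \<notin> arrows"
    using adj3_same[OF x, of i j k b] adj3_same[OF x, of i k j b] j k unfolding z by blast+
  have form: "y = x + st j b \<or> y = x - st j b \<or> y = x + st k b \<or> y = x - st k b" if y: "adj3 z x y" "y \<noteq> z" for y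
  proof -
    obtain i' b' l c where l: "i' \<noteq> l" "z = x + st i' b'" "y = x + st l c"
      using y by (metis adj3E)
    then have "l = j \<or> l = k"
      using distinct3_third[of i j k l] j k z by auto
    moreover have "st l c = st l b \<or> st l c = - st l b"
      by (cases "c = b") auto
    ultimately show ?thesis
      using l(3) by auto
  qed
  show ?thesis
    using form[OF assms(1,4)] form[OF assms(2,5)] form[OF assms(3,6)] assms opp[OF j] opp[OF k(1)] same by metis
qed

text \<open>If \<open>u\<close>, \<open>v\<close> and \<open>w\<close> are pairwise adjacent at
  \<open>y\<close>, their steps have one sign and three different directions. The rhombus at
  \<open>y\<close> with sides towards \<open>u\<close> and \<open>w\<close> has \<open>u'\<close> as
  its far corner, and at \<open>u\<close> the edge back to \<open>y\<close> separates
  \<open>z\<close> from \<open>u'\<close>.\<close>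

lemma straight_three:
  assumes "tiling_rhombus z u y v" "(y, w) \<in> arrows" "w \<noteq> u" "w \<noteq> v"
  shows "\<not> adj3 u y w \<or> \<not> adj3 v y w \<or> (\<exists>u'. tiling_rhombus u u' w y \<and> z \<noteq> u' \<and> \<not> adj3 z u u')"
proof (rule ccontr)
  assume "\<not> ?thesis"
  then have a: "adj3 u y w" "adj3 v y w" and n: "\<And>u'. tiling_rhombus u u' w y \<Longrightarrow> z \<noteq> u' \<Longrightarrow> adj3 z u u'"
    by blast+
  have a0: "adj3 u y v" "u \<noteq> v" and zuv: "z = u + v - y"
    using tiling_rhombusD(3,5,7)[OF assms(1)] by auto
  obtain i b j c where u: "i \<noteq> j" "u = y + st i b" "v = y + st j c"
    using a0 by (rule adj3E)
  obtain i' b' k d where w': "i' \<noteq> k" "u = y + st i' b'" "w = y + st k d"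
    using a(1) assms(3) by (metis adj3E)
  obtain j' c' k' d' where w'': "j' \<noteq> k'" "v = y + st j' c'" "w = y + st k' d'"
    using a(2) assms(4) by (metis adj3E)
  have ijk: "k \<noteq> i" "k \<noteq> j"
    using u w' w'' by auto
  have y: "y \<in> vertices"
    using assms(2) arrows_vertices by blast
  have arrs: "(y, y + st i b) \<in> arrows" "(y, y + st j c) \<in> arrows" "(y, y + st k d) \<in> arrows"
    using adj3_arrows[OF a(1)] adj3_arrows[OF a(2)] u w' by auto
  have same: "r = p" if "adj3 (y + st l p) y (y + st m p)" "(y, y + st n r) \<in> arrows" "l \<noteq> m" "n \<noteq> l" "n \<noteq> m" for l m n p r
    using adj3_same[OF y, of l m n p] that by (cases "r = p") auto
  have "adj3 (y + st i b) y (y + st j c)" "adj3 (y + st i b) y (y + st k d)" "adj3 (y + st j c) y (y + st k d)"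
    using a a0(1) by (simp_all only: u(2,3) w'(3))
  note adj = this
  have "d = b" if "c = b"
    using same[of i b j k d] adj(1) arrs(3) u(1) ijk unfolding that by blast
  moreover have "c = b" if "d = b"
    using same[of i b k j c] adj(2) arrs(2) u(1) ijk unfolding that by blast
  moreover have "b = c" if "d = c"
    using same[of j c k i b] adj(3) arrs(1) u(1) ijk unfolding that by blast
  ultimately have "c = b \<and> d = b"
    by (cases b; cases c; cases d) auto
  then have bcd: "c = b" "d = b"
    by auto
  define u' where "u' = u + st k b"
  have "tiling_rhombus y u (u + w - y) w"
    using a(1) assms(3) by (intro tiling_rhombusI) auto
  moreover have "u + w - y = u'"
    using w'(3) bcd by (simp add: u'_def)
  ultimately have R: "tiling_rhombus u u' w y"
    using tiling_rhombus_rotate by metis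
  have zz: "z = u + st j b"
    using zuv u bcd by simp
  then have "z \<noteq> u'"
    using ijk by (simp add: u'_def)
  then have "adj3 (u + st j b) u (u + st k b)"
    using n[OF R] zz by (simp add: u'_def)
  moreover have "u \<in> vertices"
    using adj3_arrows(1)[OF a(1)] arrows_vertices by blast
  ultimately have "(u, u - st i b) \<notin> arrows"
    using adj3_same[of u j k i b] ijk u(1) by blast
  moreover have "u - st i b = y"
    using u(2) by simp
  ultimately show False
    using adj3_arrows(1)[OF a(1)] by simp
qed

lemma pcar_sum: "(\<And>i. i \<in> S \<Longrightarrow> F i \<in> pcar) \<Longrightarrow> (\<Sum>i\<in>S. F i) \<in> pcar"
  by (induction S rule: infinite_finite_induct) (simp_all add: pcar_zero pcar_add del: mem_Collect_eq)

section \<open>Residue classes of paths\<close>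

locale rauzy =
  fixes s :: "3 \<Rightarrow> real^2 \<Rightarrow> int" and A :: "'k::field path_comb set ring" (structure)
  assumes sign_choice: "sign_choice s" and A_eq: "A = rauzy_algebra s"
begin

abbreviation W :: "(real^2) list \<Rightarrow> 'k \<Rightarrow> 'k path_comb set" where
  "W p c \<equiv> cls s (single p c)"

lemma carrier_A: "carrier A = cls s ` pcar"
  by (simp add: A_eq carrier_rauzy)

lemma cls_add: "cls s f \<oplus> cls s g = cls s (f + g)"
  by (simp add: A_eq add_rauzy)

lemma cls_mult: "f \<in> pcar \<Longrightarrow> g \<in> pcar \<Longrightarrow> cls s f \<otimes> cls s g = cls s (path_mult f g)"
  by (simp add: A_eq mult_rauzy)

lemma cls_zero: "\<zero> = cls s 0"
  by (simp add: A_eq zero_rauzy)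

lemma cls_carrier: "f \<in> pcar \<Longrightarrow> cls s f \<in> carrier A"
  by (simp add: carrier_A)

lemma carrierE:
  assumes "x \<in> carrier A"
  obtains f where "f \<in> pcar" "x = cls s f"
  using assms by (auto simp: carrier_A)

sublocale local_unit_ring A
proof (intro local_unit_ring.intro local_unit_ring_axioms.intro)
  show "abelian_group A"
  proof (rule abelian_groupI)
    fix x assume "x \<in> carrier A"
    then obtain f where "f \<in> pcar" "x = cls s f"
      by (rule carrierE)
    then show "\<exists>y\<in>carrier A. y \<oplus> x = \<zero>"
      using cls_carrier[OF pcar_uminus, of f] by (intro bexI[of _ "cls s (- f)"]) (auto simp: cls_add cls_zero)
  qed ((elim carrierE)?; simp add: cls_add cls_zero cls_carrier pcar_add pcar_zero add_ac del: mem_Collect_eq)+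
  fix x assume "x \<in> carrier A"
  then obtain f where f: "f \<in> pcar" "x = cls s f"
    by (auto simp: carrier_A)
  \<comment> \<open>A right unit for \<open>x\<close> is the sum of the trivial paths at the
    finitely many end points of walks in the support of \<open>f\<close>.\<close>
  define V where "V = last ` keys f"
  define e where "e = (\<Sum>v\<in>V. single [v] (1 :: 'k))"
  have "v \<in> vertices" if "v \<in> V" for v
  proof -
    obtain p where p: "p \<in> keys f" "v = last p"
      using \<open>v \<in> V\<close> by (auto simp: V_def)
    then have "p \<in> walks"
      using f(1) by auto
    then show ?thesis
      using p(2) by (auto simp: walks_def)
  qed
  then have e: "e \<in> pcar"
    unfolding e_def by (intro pcar_sum pcar_single) (simp add: walks_single)
  have "path_mult f e = (\<Sum>p\<in>keys f. path_mult (single p (lookup f p)) e)"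
    by (subst poly_mapping_sum_single[of f]) (rule path_mult_sum_left)
  also have "\<dots> = (\<Sum>p\<in>keys f. single p (lookup f p))"
    by (rule sum.cong) (auto simp: e_def path_mult_sum_right V_def)
  finally have "path_mult f e = f"
    by (simp flip: poly_mapping_sum_single)
  then show "\<exists>e\<in>carrier A. x \<otimes> e = x"
    using e f cls_carrier by (intro bexI[of _ "cls s e"]) (auto simp: cls_mult)
qed (elim carrierE; simp add: cls_add cls_mult cls_carrier pcar_mult pcar_add path_mult_assoc path_mult_add_left
    path_mult_add_right del: mem_Collect_eq)+

lemma W_carrier: "p \<in> walks \<Longrightarrow> W p c \<in> carrier A"
  by (intro cls_carrier pcar_single)

lemma W_mult: "p \<in> walks \<Longrightarrow> q \<in> walks \<Longrightarrow>
    W p c \<otimes> W q d = (if last p = hd q then W (p @ tl q) (c * d) else \<zero>)"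
  by (simp add: cls_mult pcar_single cls_zero del: mem_Collect_eq)

lemma carrier_induct [consumes 1, case_names zero add walk]:
  assumes "a \<in> carrier A" "P \<zero>"
    "\<And>a b. a \<in> carrier A \<Longrightarrow> b \<in> carrier A \<Longrightarrow> P a \<Longrightarrow> P b \<Longrightarrow> P (a \<oplus> b)"
    "\<And>p c. p \<in> walks \<Longrightarrow> P (W p c)"
  shows "P a"
proof -
  obtain f where f: "f \<in> pcar" "a = cls s f"
    using assms(1) by (auto simp: carrier_A)
  have "P (cls s f)"
    using f(1)
  proof (induction f rule: pcar_induct)
    case (add f g)
    then show ?case
      using assms(3)[of "cls s f" "cls s g"] cls_carrier by (simp add: cls_add)
  qed (use assms(2,4) cls_zero in auto)
  then show ?thesis
    by (simp add: f)
qed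

text \<open>All scalars are quantified over because \<open>N\<close> is used only as a right ideal.
  Lists that are not walks satisfy it vacuously, so that neighbours can be treated without asking
  whether the arrow exists.\<close>

definition Z :: "'k path_comb set set \<Rightarrow> (real^2) list \<Rightarrow> bool" where
  "Z N p \<longleftrightarrow> (p \<in> walks \<longrightarrow> (\<forall>c. W p c \<in> N))"

lemma ZI: "(\<And>c. p \<in> walks \<Longrightarrow> W p c \<in> N) \<Longrightarrow> Z N p"
  by (simp add: Z_def)

lemma walks_appendD: "p @ q \<in> walks \<Longrightarrow> p \<noteq> [] \<Longrightarrow> p \<in> walks" "p @ q \<in> walks \<Longrightarrow> q \<noteq> [] \<Longrightarrow> q \<in> walks"
  by (auto simp: walks_def successively_append_iff)

lemma walks_split: "p @ [x] @ q \<in> walks \<longleftrightarrow> p @ [x] \<in> walks \<and> x # q \<in> walks"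
  by (cases q) (auto simp: walks_def successively_append_iff)

lemma Z_append:
  assumes "rid N" "Z N p" "p \<noteq> []"
  shows "Z N (p @ q)"
proof (rule ZI)
  fix c assume w: "p @ q \<in> walks"
  have p: "p \<in> walks"
    using walks_appendD(1)[OF w assms(3)] .
  have "butlast p @ [last p] @ q \<in> walks"
    using w assms(3) by (metis append.assoc append_butlast_last_id)
  then have q: "last p # q \<in> walks"
    unfolding walks_split by blast
  have "W (p @ q) c = W p 1 \<otimes> W (last p # q) c"
    using W_mult[OF p q] by simp
  then show "W (p @ q) c \<in> N"
    using assms(2) p ridD(5)[OF assms(1) _ W_carrier[OF q]] by (simp add: Z_def)
qed

lemma Z_mono: "Z N p \<Longrightarrow> N \<subseteq> N' \<Longrightarrow> Z N' p"
  by (auto simp: Z_def)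

section \<open>Relations applied inside a path\<close>

lemma rels_mult:
  assumes "f \<in> rels s" "p @ [x] \<in> walks" "y # q \<in> walks"
  shows "path_mult (path_mult (single (p @ [x]) c) f) (single (y # q) 1) \<in> rauzy_ideal s"
  using assms rels_ideal pcar_single by (intro J_mult_right J_mult_left) blast+

lemma W_zero:
  assumes "\<not> adj3 a b c" "a \<noteq> c" "p @ [a, b, c] @ q \<in> walks"
  shows "W (p @ [a, b, c] @ q) k = \<zero>"
proof -
  have w: "p @ [a] \<in> walks" "c # q \<in> walks" "[a, b, c] \<in> walks"
    using walks_appendD(1)[of "p @ [a]" "[b, c] @ q"] walks_appendD(2)[of "p @ [a, b]" "c # q"]
      walks_appendD(1)[of "[a, b, c]" q] walks_appendD(2)[of p "[a, b, c] @ q"] assms(3) by auto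
  then have "single [a, b, c] 1 \<in> rels s"
    using assms unfolding rels_def rel_zero_def adj3_def walks_triple by blast
  then have "single (p @ [a, b, c] @ q) k \<in> rauzy_ideal s"
    using rels_mult[OF _ w(1,2), of "single [a, b, c] 1" k] by simp
  then show ?thesis
    by (simp add: cls_zero cls_eq_iff)
qed

lemma Z_zero:
  assumes "rid N" "\<not> adj3 a b c" "a \<noteq> c"
  shows "Z N (p @ [a, b, c] @ q)"
  using W_zero[OF assms(2,3)] ridD(2)[OF assms(1)] by (simp add: Z_def)

lemma rhombus_walks:
  assumes "tiling_rhombus z u y v"
  shows "p @ [z, u, y] @ q \<in> walks \<longleftrightarrow> p @ [z] \<in> walks \<and> y # q \<in> walks"
  using tiling_rhombus_arrows[OF assms] walks_split[of p z "u # y # q"] by (simp add: walks_Cons)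

lemma W_commute:
  assumes "tiling_rhombus z u y v" "p @ [z, u, y] @ q \<in> walks"
  shows "W (p @ [z, u, y] @ q) k = W (p @ [z, v, y] @ q) k"
proof -
  have w: "p @ [z] \<in> walks" "y # q \<in> walks"
    using assms rhombus_walks by blast+
  have "single [z, u, y] 1 - single [z, v, y] 1 \<in> rels s"
    using assms unfolding rels_def rel_commute_def by blast
  then have "single (p @ [z, u, y] @ q) k - single (p @ [z, v, y] @ q) k \<in> rauzy_ideal s"
    using rels_mult[OF _ w, of "single [z, u, y] 1 - single [z, v, y] 1" k] by (simp add: path_mult_diff_left path_mult_diff_right)
  then show ?thesis
    by (simp add: cls_eq_iff)
qed

lemma Z_commute:
  assumes "tiling_rhombus z u y v"
  shows "Z N (p @ [z, u, y] @ q) \<longleftrightarrow> Z N (p @ [z, v, y] @ q)"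
  using W_commute[OF assms, of p q] rhombus_walks[OF assms, of p q] rhombus_walks[OF tiling_rhombus_reflect[OF assms], of p q]
  by (simp add: Z_def)

lemma sign_unit: "z \<in> vertices \<Longrightarrow> (of_int (s a z) :: 'k) * of_int (s a z) = 1"
  using sign_square[OF sign_choice, of z a] by (metis of_int_1 of_int_mult)

text \<open>The summands of \<open>D\<close> in the direction \<open>a0\<close> vanish modulo \<open>N\<close>, so the loop relation makes the two
  summands in the direction \<open>a\<close> agree modulo \<open>N\<close>.\<close>

lemma Z_loop:
  assumes N: "rid N" and a0: "\<And>b. Z N (p @ [x, x + st a0 b, x] @ q)"
    and b: "Z N (p @ [x, x + st a b, x] @ q)"
  shows "Z N (p @ [x, x - st a b, x] @ q)"
proof (rule ZI)
  fix c assume w: "p @ [x, x - st a b, x] @ q \<in> walks"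
  have wp: "p @ [x] \<in> walks" "x # q \<in> walks" and arr: "(x, x - st a b) \<in> arrows"
    using w walks_appendD(1)[of "p @ [x]" "[x - st a b, x] @ q"] walks_appendD(2)[of "p @ [x, x - st a b]" "x # q"]
      walks_appendD(2)[of p "[x, x - st a b, x] @ q"] by (auto simp: walks_Cons)
  have x: "x \<in> vertices"
    using arr arrows_vertices by blast
  have walk: "p @ [x, x + st a b, x] @ q \<in> walks" if "(x, x + st a b) \<in> arrows" for a b
    using that wp arrows_sym walks_split[of p x "(x + st a b) # x # q"] by (simp add: walks_Cons)
  define t where "t a b k = (if (x, x + st a b) \<in> arrows then single (p @ [x, x + st a b, x] @ q) k else 0)" for a b and k :: 'k
  define f where "f a = t a True (c * of_int (s a x)) - t a False (c * of_int (s a x))" for a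
  have t_pcar: "t a b k \<in> pcar" for a b k
    unfolding t_def using walk pcar_single pcar_zero by auto
  have f_pcar: "f a \<in> pcar" for a
    unfolding f_def by (rule pcar_diff[OF t_pcar t_pcar])
  have f_eq: "f a = path_mult (path_mult (single (p @ [x]) c) (signed_D s a x)) (single (x # q) 1)" for a
    unfolding f_def t_def signed_D_eq by (simp add: path_mult_diff_left path_mult_diff_right st_True st_False)
  have "signed_D s a x - signed_D s a0 x \<in> rels s"
    unfolding rels_def rel_loop_def using x by blast
  then have "f a - f a0 \<in> rauzy_ideal s"
    using rels_mult[OF _ wp, of "signed_D s a x - signed_D s a0 x" c] unfolding f_eq
    by (simp add: path_mult_diff_left path_mult_diff_right)
  then have eq: "cls s (f a) = cls s (f a0)"
    by (simp add: cls_eq_iff)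
  have tN: "cls s (t a b k) \<in> N" if "Z N (p @ [x, x + st a b, x] @ q)" for a b k
    using that walk ridD(2)[OF N] unfolding t_def Z_def by (auto simp: cls_zero)
  have minus: "cls s (- g) = \<ominus> cls s g" if "g \<in> pcar" for g
    using minus_equality[of "cls s (- g)" "cls s g"] cls_carrier that pcar_uminus[OF that] by (simp add: cls_add cls_zero)
  have diffN: "cls s (g - h) \<in> N" if "cls s g \<in> N" "cls s h \<in> N" "h \<in> pcar" for g h
    using ridD(3)[OF N that(1) ridD(4)[OF N that(2)]] minus[OF that(3)] cls_add[of g "- h"] by simp
  have "cls s (f a0) \<in> N"
    unfolding f_def using a0 tN t_pcar diffN by blast
  then have fN: "cls s (f a) \<in> N"
    using eq by simp
  have tb: "cls s (t a b (c * of_int (s a x))) \<in> N"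
    using tN[OF b] .
  have "cls s (t a (\<not> b) (c * of_int (s a x))) \<in> N"
  proof (cases b)
    case True
    have "t a False (c * of_int (s a x)) = t a True (c * of_int (s a x)) - f a"
      by (simp add: f_def)
    then show ?thesis
      using diffN[OF tb fN f_pcar] True by simp
  next
    case False
    have "t a True (c * of_int (s a x)) = f a - (0 - t a False (c * of_int (s a x)))"
      by (simp add: f_def)
    moreover have "cls s 0 \<in> N"
      using ridD(2)[OF N] cls_zero by simp
    ultimately show ?thesis
      using diffN[OF fN diffN[OF _ tb t_pcar] pcar_diff[OF pcar_zero t_pcar]] False by simp
  qed
  then have "W (p @ [x, x - st a b, x] @ q) (c * of_int (s a x)) \<in> N"
    using arr by (simp add: t_def)
  \<comment> \<open>Multiplying by the trivial path at the end with coefficient \<open>s a x\<close>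
    removes the sign, whose square is 1.\<close>
  moreover define v where "v = last (x # q)"
  moreover have "[v] \<in> walks"
    using wp(2) by (auto simp: v_def walks_def)
  ultimately have "W (p @ [x, x - st a b, x] @ q) (c * of_int (s a x)) \<otimes> W [v] (of_int (s a x)) \<in> N"
    using ridD(5)[OF N] W_carrier by blast
  then show "W (p @ [x, x - st a b, x] @ q) c \<in> N"
    using W_mult[OF w \<open>[v] \<in> walks\<close>] sign_unit[OF x, of a] by (simp add: v_def mult.assoc)
qed

text \<open>After the edge from \<open>z\<close> to \<open>x\<close>, only the loops at
  \<open>x\<close> towards \<open>z\<close>, \<open>y1\<close> and \<open>y2\<close> can survive,
  and the one towards \<open>y1\<close> is assumed to vanish. Hence some direction carries no
  surviving loop. Comparison with it kills the loop towards \<open>z\<close>, whose opposite is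
  collinear, and then the one towards \<open>y2\<close>.\<close>

lemma Z_completions:
  assumes N: "rid N" and adj: "adj3 z x y1" "adj3 z x y2" "y1 \<noteq> z" "y2 \<noteq> z" "y1 \<noteq> y2"
    and Z: "Z N (p @ [z, x, y1, x] @ q)"
  shows "Z N (p @ [z, x, z, x] @ q)" "Z N (p @ [z, x, y2, x] @ q)"
proof -
  obtain i b j c where 1: "i \<noteq> j" "z = x + st i b" "y1 = x + st j c"
    using adj(1,3) by (metis adj3E)
  obtain i' b' l d where 2: "i' \<noteq> l" "z = x + st i' b'" "y2 = x + st l d"
    using adj(2,4) by (metis adj3E)
  have l: "l \<noteq> i"
    using 1 2 by auto
  have other: "Z N (p @ [z, x, w, x] @ q)" if "w \<noteq> z" "w \<noteq> y1" "w \<noteq> y2" for w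
  proof -
    have "\<not> adj3 z x w"
      using edge_completions[of z x y1 y2 w] adj that by blast
    then show ?thesis
      using Z_zero[OF N, of z x w p "x # q"] that by simp
  qed
  have loop: "Z N (p @ [z, x, x - st a e, x] @ q)"
    if "\<And>b. Z N (p @ [z, x, x + st a0 b, x] @ q)" "Z N (p @ [z, x, x + st a e, x] @ q)" for a0 a e
    using Z_loop[OF N, of "p @ [z]" x a0 q a e] that by simp
  have zi: "x - st i (\<not> b) = z"
    using 1 by simp
  have opp_i: "Z N (p @ [z, x, x + st i (\<not> b), x] @ q)"
    using other[of "x + st i (\<not> b)"] 1 2 l by auto
  \<comment> \<open>If \<open>y1\<close> and \<open>y2\<close> lie on one line through
    \<open>x\<close>, the third direction serves; otherwise the direction of \<open>y1\<close>
    does.\<close>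
  have "\<exists>a0. \<forall>e. Z N (p @ [z, x, x + st a0 e, x] @ q)"
  proof (cases "l = j")
    case True
    obtain k where "k \<noteq> i" "k \<noteq> j"
      using distinct3_cases[OF 1(1)] by blast
    then show ?thesis
      using other 1 2 True by (intro exI[of _ k] allI other) auto
  next
    case False
    have "Z N (p @ [z, x, x + st j e, x] @ q)" for e
      using Z other[of "x + st j e"] 1 2 False by (cases "e = c") auto
    then show ?thesis
      by blast
  qed
  then obtain a0 where a0: "\<And>e. Z N (p @ [z, x, x + st a0 e, x] @ q)"
    by blast
  show "Z N (p @ [z, x, z, x] @ q)"
    using loop[OF a0 opp_i] unfolding zi .
  have yl: "x - st l (\<not> d) = y2"
    using 2 by simp
  have "Z N (p @ [z, x, x + st l (\<not> d), x] @ q)"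
  proof (cases "x + st l (\<not> d) = y1")
    case False
    then show ?thesis
      using other[of "x + st l (\<not> d)"] 1(2) 2(3) l by auto
  qed (use Z in simp)
  from loop[OF a0 this] show "Z N (p @ [z, x, y2, x] @ q)"
    unfolding yl .
qed

text \<open>The path can be rewritten via \<open>v\<close>, or across the neighbouring rhombus with
  corners \<open>u\<close>, \<open>u'\<close>, \<open>w\<close>, \<open>y\<close>. By
  \<open>straight_three\<close> one of its forms contains two consecutive edges that are not
  adjacent.\<close>

lemma Z_straight:
  assumes N: "rid N" and R: "tiling_rhombus z u y v" and w: "w \<noteq> u" "w \<noteq> v"
  shows "Z N (p @ [z, u, y, w] @ q)"
proof (cases "(y, w) \<in> arrows")
  case False
  have "p @ [z, u, y, w] @ q \<notin> walks"
    using False by (auto simp: walks_def successively_append_iff)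
  then show ?thesis
    by (simp add: Z_def)
next
  case True
  have comm: "Z N (p @ [z, u, y, w] @ q) \<longleftrightarrow> Z N (p @ [z, v, y, w] @ q)"
    using Z_commute[OF R, of N p "w # q"] by simp
  consider "\<not> adj3 u y w" | "\<not> adj3 v y w" | u' where "tiling_rhombus u u' w y" "z \<noteq> u'" "\<not> adj3 z u u'"
    using straight_three[OF R True w] by blast
  then show ?thesis
  proof cases
    case 1
    then show ?thesis
      using Z_zero[OF N, of u y w "p @ [z]" q] w by simp
  next
    case 2
    then show ?thesis
      using Z_zero[OF N, of v y w "p @ [z]" q] w comm by simp
  next
    case 3
    have "Z N ((p @ [z]) @ [u, u', w] @ q)"
      using Z_zero[OF N 3(3,2), of p "w # q"] by simp
    then show ?thesis
      unfolding Z_commute[OF 3(1)] by simp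
  qed
qed

text \<open>The last two edges are moved to the other side of their rhombus, through the corner
  \<open>t\<close>. The condition on \<open>w\<close> gives \<open>t \<noteq> x\<close>, and the
  absence of triangles at \<open>z\<close> makes the edges to \<open>x\<close> and \<open>t\<close>
  nonadjacent.\<close>

lemma Z_turn:
  assumes N: "rid N" and adj: "adj3 x z x'" "x \<noteq> x'" and w: "w \<noteq> z" "w \<noteq> x + x' - z"
    and no_triangle: "\<And>t. t \<noteq> x \<Longrightarrow> t \<noteq> x' \<Longrightarrow> adj3 x' z t \<Longrightarrow> \<not> adj3 x z t"
  shows "Z N (p @ [x, z, x', w] @ q)"
proof (cases "adj3 z x' w")
  case False
  then show ?thesis
    using Z_zero[OF N, of z x' w "p @ [x]" q] w by simp
next
  case True
  define t where "t = z + w - x'"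
  have R: "tiling_rhombus z x' w t"
    using tiling_rhombusI[OF True] w(1) tiling_rhombus_rotate tiling_rhombus_reflect unfolding t_def by metis
  have "t \<noteq> x"
    using w(2) by (auto simp: t_def)
  moreover have "t \<noteq> x'"
    using tiling_rhombusD(7)[OF R] by simp
  moreover have "adj3 x' z t"
    using tiling_rhombusD(1)[OF R] .
  ultimately have "\<not> adj3 x z t"
    using no_triangle by blast
  then have "Z N (p @ [x, z, t] @ w # q)"
    using Z_zero[OF N] \<open>t \<noteq> x\<close> by metis
  then have "Z N ((p @ [x]) @ [z, t, w] @ q)"
    by simp
  then show ?thesis
    using Z_commute[OF R, of N "p @ [x]" q] by simp
qed

text \<open>A right ideal \<open>N\<close> such that, modulo \<open>N\<close>, the module generated by the path \<open>g\<close> ending in \<open>y\<close>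
  is spanned by the images of the four basis paths of the rhombus module with top \<open>y\<close> and socle \<open>w\<close>.\<close>

definition rhombus_mod :: "'k path_comb set set \<Rightarrow> (real^2) list \<Rightarrow> real^2 \<Rightarrow> real^2 \<Rightarrow> real^2 \<Rightarrow> real^2 \<Rightarrow> bool" where
  "rhombus_mod N g w u y v \<longleftrightarrow> rid N \<and> g \<in> walks \<and> last g = y \<and> tiling_rhombus w u y v \<and>
    (\<forall>t. t \<noteq> u \<and> t \<noteq> v \<longrightarrow> Z N (g @ [t])) \<and>
    (\<forall>t. t \<noteq> w \<longrightarrow> Z N (g @ [u, t]) \<and> Z N (g @ [v, t])) \<and>
    (\<forall>t. Z N (g @ [u, w, t]))"

lemma Z_append_tail: "rid N \<Longrightarrow> Z N (g @ p) \<Longrightarrow> g \<noteq> [] \<Longrightarrow> Z N (g @ p @ q)"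
  using Z_append[of N "g @ p" q] by simp

lemma Z_commute_last:
  assumes "tiling_rhombus w u y v" "g \<noteq> []" "last g = y"
  shows "Z N (g @ u # w # q) \<longleftrightarrow> Z N (g @ v # w # q)"
proof -
  obtain g' where "g = g' @ [y]"
    using split_walk[OF assms(2,3)] .
  then show ?thesis
    using Z_commute[OF tiling_rhombus_opposite[OF assms(1)], of N g' q] by simp
qed

text \<open>Any other tail has a prefix excluded in \<open>rhombus_mod\<close>, possibly after
  replacing \<open>v\<close> by \<open>u\<close> in front of \<open>w\<close>.\<close>

lemma rhombus_tail:
  assumes "rhombus_mod N g w u y v" "q \<notin> {[], [u], [v], [u, w], [v, w]}"
  shows "Z N (g @ q)"
proof -
  note R = assms(1)[unfolded rhombus_mod_def]
  have N: "rid N" and g: "g \<noteq> []"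
    using R walks_not_Nil by blast+
  obtain a q' where q: "q = a # q'"
    using assms(2) by (cases q) auto
  show ?thesis
  proof (cases "a \<noteq> u \<and> a \<noteq> v")
    case True
    then show ?thesis
      using Z_append_tail[OF N, of g "[a]" q'] R g q by simp
  next
    case False
    then obtain b q'' where q': "q' = b # q''"
      using assms(2) q by (cases q') auto
    show ?thesis
    proof (cases "b = w")
      case False
      then have "Z N (g @ [a, b])"
        using R \<open>\<not> (a \<noteq> u \<and> a \<noteq> v)\<close> by blast
      then show ?thesis
        using Z_append_tail[OF N, of g "[a, b]" q''] g q q' by simp
    next
      case True
      obtain c q3 where q'': "q'' = c # q3"
        using assms(2) q q' True \<open>\<not> (a \<noteq> u \<and> a \<noteq> v)\<close> by (cases q'') auto
      have u: "Z N (g @ u # w # c # q3)"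
        using Z_append_tail[OF N, of g "[u, w, c]" q3] R g by simp
      then have "Z N (g @ v # w # c # q3)"
        using Z_commute_last[of w u y v g N] R g by blast
      with u show ?thesis
        using q q' q'' True \<open>\<not> (a \<noteq> u \<and> a \<noteq> v)\<close> by auto
    qed
  qed
qed

lemma rhombus_span:
  assumes R: "rhombus_mod N g w u y v" and f: "f \<in> pcar"
  shows "\<exists>c0 c1 c2 c3. cls s (path_mult (single g 1) f -
    (single g c0 + single (g @ [u]) c1 + single (g @ [v]) c2 + single (g @ [u, w]) c3)) \<in> N"
  using f
proof (induction f rule: pcar_induct)
  case zero
  have "cls s 0 \<in> N"
    using R ridD(2) cls_zero unfolding rhombus_mod_def by simp
  then show ?case
    by (intro exI[of _ 0]) simp
next
  case (add f f')
  then obtain c0 c1 c2 c3 d0 d1 d2 d3 where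
    "cls s (path_mult (single g 1) f -
      (single g c0 + single (g @ [u]) c1 + single (g @ [v]) c2 + single (g @ [u, w]) c3)) \<in> N"
    "cls s (path_mult (single g 1) f' -
      (single g d0 + single (g @ [u]) d1 + single (g @ [v]) d2 + single (g @ [u, w]) d3)) \<in> N"
    by blast
  then have "cls s ((path_mult (single g 1) f -
      (single g c0 + single (g @ [u]) c1 + single (g @ [v]) c2 + single (g @ [u, w]) c3)) +
      (path_mult (single g 1) f' -
      (single g d0 + single (g @ [u]) d1 + single (g @ [v]) d2 + single (g @ [u, w]) d3))) \<in> N"
    using R ridD(3) cls_add unfolding rhombus_mod_def by metis
  then show ?case
    by (intro exI[of _ "c0 + d0"] exI[of _ "c1 + d1"] exI[of _ "c2 + d2"] exI[of _ "c3 + d3"])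
      (simp add: single_add path_mult_add_right algebra_simps)
next
  case (single q d)
  have z: "cls s 0 \<in> N"
    using R ridD(2) cls_zero unfolding rhombus_mod_def by simp
  have g: "g \<in> walks" "last g = y" "tiling_rhombus w u y v"
    using R unfolding rhombus_mod_def by blast+
  show ?case
  proof (cases "hd q = y")
    case False
    then show ?thesis
      using g z by (intro exI[of _ 0]) simp
  next
    case True
    then obtain q' where q: "q = y # q'"
      using single walks_not_Nil by (cases q) auto
    have m: "path_mult (single g 1) (single q d) = single (g @ q') d"
      using g q by simp
    have w: "g @ q' \<in> walks"
      using walks_append(1)[OF g(1) single] g q by simp
    consider "q' = []" | "q' = [u]" | "q' = [v]" | "q' = [u, w]" | "q' = [v, w]" | "q' \<notin> {[], [u], [v], [u, w], [v, w]}"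
      by blast
    moreover have ex: ?thesis if "cls s (single (g @ q') d -
      (single g c0 + single (g @ [u]) c1 + single (g @ [v]) c2 + single (g @ [u, w]) c3)) \<in> N" for c0 c1 c2 c3
      using that unfolding m by blast
    ultimately show ?thesis
    proof cases
      case 1
      then show ?thesis
        by (intro ex[of d 0 0 0]) (simp add: z)
    next
      case 2
      then show ?thesis
        by (intro ex[of 0 d 0 0]) (simp add: z)
    next
      case 3
      then show ?thesis
        by (intro ex[of 0 0 d 0]) (simp add: z)
    next
      case 4
      then show ?thesis
        by (intro ex[of 0 0 0 d]) (simp add: z)
    next
      case 5
      obtain g' where g': "g = g' @ [y]"
        using split_walk[OF walks_not_Nil[OF g(1)] g(2)] .
      have "W (g @ [v, w]) d = W (g @ [u, w]) d"
        using W_commute[OF tiling_rhombus_opposite[OF tiling_rhombus_reflect[OF g(3)]], of g' "[]" d] w 5 g' by simp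
      then have "cls s (single (g @ [v, w]) d - single (g @ [u, w]) d) = cls s 0"
        by (simp add: cls_eq_iff)
      then show ?thesis
        using 5 by (intro ex[of 0 0 0 d]) (simp add: z)
    next
      case 6
      then have "W (g @ q') d \<in> N"
        using rhombus_tail[OF R] w unfolding Z_def by blast
      then show ?thesis
        by (intro ex[of 0 0 0 0]) simp
    qed
  qed
qed

text \<open>The four paths end in four different vertices. A suitable tail therefore isolates one
  coefficient and completes its path to a closed path of length four around the rhombus, which is
  nonzero.\<close>

lemma rhombus_independent:
  assumes R: "tiling_rhombus w u y v"
    and t: "single [w, u, y] c0 + single [w, u, y, u] c1 + single [w, u, y, v] c2 + single [w, u, y, u, w] c3
      \<in> (rauzy_ideal s :: 'k path_comb set)" (is "?t \<in> _")
  shows "c0 = 0 \<and> c1 = 0 \<and> c2 = 0 \<and> c3 = 0"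
proof -
  note D = tiling_rhombusD[OF R] and arr = tiling_rhombus_arrows[OF R]
  have irrefl: "(a, a) \<notin> arrows" for a
    using arrowsE[of a a] by (metis add_cancel_right_right st_nonzero)
  have ne: "u \<noteq> y" "v \<noteq> y" "w \<noteq> y" "w \<noteq> u" "w \<noteq> v" "u \<noteq> v"
    using arr irrefl D(6,7) by auto
  have walks: "[y, u, w] \<in> walks" "[u, w] \<in> walks" "[v, w] \<in> walks" "[w] \<in> walks"
    using arr arrows_vertices by (auto simp: walks_Cons walks_single)
  have J: "path_mult ?t (single q 1) \<in> rauzy_ideal s" if "q \<in> walks" for q
    using J_mult_right[OF t pcar_single[OF that]] .
  have zero: "c = 0" if "single [w, u, y, u, w] c \<in> (rauzy_ideal s :: 'k path_comb set)" for c
    using rhombus_cycle_nonzero[OF sign_choice R] that by blast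
  have "c0 = 0"
    using J[OF walks(1)] ne by (intro zero) (simp add: path_mult_add_left)
  moreover have "c1 = 0"
    using J[OF walks(2)] ne by (intro zero) (simp add: path_mult_add_left)
  moreover have "c3 = 0"
    using J[OF walks(4)] ne by (intro zero) (simp add: path_mult_add_left)
  moreover have "c2 = 0"
  proof (rule zero)
    have "[w, u, y, v, w] \<in> walks"
      using arr arrows_vertices by (auto simp: walks_Cons walks_single)
    then have "W [w, u, y, v, w] c2 = W [w, u, y, u, w] c2"
      using W_commute[OF tiling_rhombus_opposite[OF tiling_rhombus_reflect[OF R]], of "[w, u]" "[]" c2] by simp
    moreover have "single [w, u, y, v, w] c2 \<in> (rauzy_ideal s :: 'k path_comb set)"
      using J[OF walks(3)] ne by (simp add: path_mult_add_left)
    ultimately show "single [w, u, y, u, w] c2 \<in> (rauzy_ideal s :: 'k path_comb set)"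
      by (metis cls_zero_iff)
  qed
  ultimately show ?thesis
    by simp
qed

text \<open>Left multiplication by \<open>l\<close> kills \<open>N\<close> and turns the four
  spanning paths into the independent paths of the rhombus, so all four coefficients vanish.\<close>

lemma rhombus_kernel:
  assumes R: "rhombus_mod N g w u y v" and l: "l \<in> walks" "last l = hd g" "l @ tl g = [w, u, y]"
    and lN: "\<And>n. n \<in> N \<Longrightarrow> W l 1 \<otimes> n = \<zero>"
    and a: "a \<in> carrier A" "W l 1 \<otimes> (W g 1 \<otimes> a) = \<zero>"
  shows "W g 1 \<otimes> a \<in> N"
proof -
  have g: "g \<in> walks" "last g = y" "tiling_rhombus w u y v" and N: "rid N"
    using R unfolding rhombus_mod_def by blast+
  obtain f where f: "f \<in> pcar" "a = cls s f"
    using a(1) by (rule carrierE)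
  obtain c0 c1 c2 c3 where c: "cls s (path_mult (single g 1) f -
    (single g c0 + single (g @ [u]) c1 + single (g @ [v]) c2 + single (g @ [u, w]) c3)) \<in> N" (is "cls s (?gf - ?t) \<in> N")
    using rhombus_span[OF R f(1)] by blast
  have arr: "(y, u) \<in> arrows" "(y, v) \<in> arrows" "(u, w) \<in> arrows"
    using tiling_rhombus_arrows[OF g(3)] by auto
  have gw: "g @ [u] \<in> walks" "g @ [v] \<in> walks" "g @ [u, w] \<in> walks"
    using walks_append(1)[OF g(1), of "[y, u]"] walks_append(1)[OF g(1), of "[y, v]"] walks_append(1)[OF g(1), of "[y, u, w]"]
      arr arrows_vertices g(2) by (auto simp: walks_Cons walks_single)
  have tp: "?t \<in> pcar"
    using gw g(1) by (intro pcar_add pcar_single)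
  have gfp: "?gf \<in> pcar"
    using pcar_mult[OF pcar_single[OF g(1)] f(1)] .
  have lg: "path_mult (single l 1) ?t = single [w, u, y] c0 + single [w, u, y, u] c1 + single [w, u, y, v] c2 + single [w, u, y, u, w] c3"
  proof -
    have "hd (g @ q) = hd g" "l @ tl (g @ q) = [w, u, y] @ q" for q
      using walks_not_Nil[OF g(1)] l(3) by simp_all
    then show ?thesis
      using l(2,3) by (simp add: path_mult_add_right)
  qed
  have 1: "cls s (path_mult (single l 1) (?gf - ?t)) = \<zero>"
    using lN[OF c] cls_mult[OF pcar_single[OF l(1)] pcar_diff[OF gfp tp]] by metis
  have 2: "cls s (path_mult (single l 1) ?gf) = \<zero>"
    using a(2) unfolding f(2) cls_mult[OF pcar_single[OF g(1)] f(1)] cls_mult[OF pcar_single[OF l(1)] gfp] .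
  have "path_mult (single l 1) ?gf - path_mult (single l 1) (?gf - ?t) \<in> rauzy_ideal s"
    using J_diff[OF 2[unfolded A_eq cls_zero_iff] 1[unfolded A_eq cls_zero_iff]] .
  then have "path_mult (single l 1) ?t \<in> rauzy_ideal s"
    by (simp add: path_mult_diff_right)
  then have "c0 = 0 \<and> c1 = 0 \<and> c2 = 0 \<and> c3 = 0"
    using rhombus_independent[OF g(3)] unfolding lg by blast
  then show ?thesis
    using c f cls_mult[OF pcar_single[OF g(1)] f(1)] by simp
qed

text \<open>A tail of length at least two that survives modulo \<open>N\<close> ends in
  \<open>w\<close>. Here \<open>y \<noteq> z\<close> makes the tail that long, and it ends in
  \<open>x\<close>.\<close>

lemma rhombus_mult:
  assumes R: "rhombus_mod N g w u y v" and a: "a \<in> carrier A" and zx: "(z, x) \<in> arrows" "y \<noteq> z" "x \<noteq> w"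
  shows "(W g 1 \<otimes> a) \<otimes> W [z, x] 1 \<in> N"
proof -
  have g: "g \<in> walks" "last g = y" and N: "rid N"
    using R unfolding rhombus_mod_def by blast+
  have zxw: "[z, x] \<in> walks"
    using zx(1) arrows_vertices by (auto simp: walks_Cons walks_single)
  note WW = W_carrier[OF g(1), of 1] W_carrier[OF zxw, of 1]
  show ?thesis
    using a
  proof (induction a rule: carrier_induct)
    case zero
    then show ?case
      using WW ridD(2)[OF N] by simp
  next
    case (add a b)
    then show ?case
      using WW ridD(3)[OF N add(3,4)] by (simp add: r_distr l_distr)
  next
    case (walk q c)
    show ?case
    proof (cases "last g = hd q \<and> last q = z")
      case True
      note w = walks_append[OF g(1) walk conjunct1[OF True]]
      have gqx: "g @ (tl q @ [x]) \<in> walks"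
        using walks_append(1)[OF w(1) zxw] w(3) True by simp
      have tail: "tl q @ [x] \<notin> {[], [u], [v], [u, w], [v, w]}"
      proof -
        have "tl q \<noteq> []"
          using zx(2) True g(2) walks_not_Nil[OF walk] by (cases q) auto
        then show ?thesis
          using zx(3) by (cases "tl q") auto
      qed
      have "W (g @ (tl q @ [x])) c \<in> N"
        using rhombus_tail[OF R tail] gqx unfolding Z_def by blast
      moreover have "W g 1 \<otimes> W q c = W (g @ tl q) c"
        using W_mult[OF g(1) walk, of 1 c] True by simp
      moreover have "W (g @ tl q) c \<otimes> W [z, x] 1 = W (g @ (tl q @ [x])) c"
      proof -
        have "last (g @ tl q) = hd [z, x]"
          using w(3) True by simp
        from W_mult[OF w(1) zxw, of c 1, unfolded if_P[OF this]] show ?thesis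
          by (simp only: list.sel append_assoc mult_1_right)
      qed
      ultimately show ?thesis
        by (simp only:)
    next
      case False
      then have "(W g 1 \<otimes> W q c) \<otimes> W [z, x] 1 = \<zero>"
      proof (cases "last g = hd q")
        case True
        then have "last q \<noteq> z"
          using False by blast
        then show ?thesis
          using walks_append[OF g(1) walk True] W_mult[OF g(1) walk, of 1 c] W_mult[OF _ zxw, of "g @ tl q" c 1] True
          by (simp only: list.sel refl if_True if_False mult_1_left)
      next
        case False
        then show ?thesis
          using WW(2) W_mult[OF g(1) walk, of 1 c] by simp
      qed
      then show ?thesis
        using ridD(2)[OF N] by simp
    qed
  qed
qed

section \<open>The three kinds of rhombus subquotients at a vertex\<close>

lemma rid_zero: "rid {\<zero>}"
  by (simp add: rid_def)

text \<open>Whatever leaves the rhombus dies: at \<open>y\<close> by \<open>Z_straight\<close>, and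
  after a return to \<open>z\<close> by \<open>no_triangle\<close>. The third direction at
  \<open>y\<close> has no surviving loop, so the loop relation also kills the two remaining loops at
  \<open>y\<close>.\<close>

lemma rhombus_mod_corner:
  assumes x12: "adj3 x1 z x2" "x1 \<noteq> x2"
    and no_triangle: "\<And>t. t \<noteq> x1 \<Longrightarrow> t \<noteq> x2 \<Longrightarrow> adj3 x1 z t \<Longrightarrow> \<not> adj3 x2 z t"
    and y: "y = x1 + x2 - z"
  shows "rhombus_mod {\<zero>} [z, x1, y] z x1 y x2"
proof -
  let ?N = "{\<zero>}"
  have N: "rid ?N"
    by (rule rid_zero)
  have R: "tiling_rhombus z x1 y x2"
    using tiling_rhombusI[OF x12] y by simp
  note R' = tiling_rhombus_reflect[OF R]
  note arr = tiling_rhombus_arrows[OF R]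
  have a12: "adj3 x1 y x2"
    using tiling_rhombusD(3)[OF R] .
  have a21: "adj3 x2 z x1"
    using adj3_sym[OF x12(1)] .
  have walk: "[z, x1, y] \<in> walks"
    using arr by (simp add: walks_triple)
  have far: "Z ?N (p @ [z, x1, y, t] @ q)" if "t \<noteq> x1" "t \<noteq> x2" for t p q
    using Z_straight[OF N R that] .
  obtain i b j c where ij: "i \<noteq> j" "x1 = y + st i b" "x2 = y + st j c"
    using a12 x12(2) by (rule adj3E)
  obtain k where k: "k \<noteq> i" "k \<noteq> j"
    using distinct3_cases[OF ij(1)] by blast
  have loop: "Z ?N ([z, x1, y, x1, y] @ q)" "Z ?N ([z, x1, y, x2, y] @ q)" for q
  proof -
    have l: "Z ?N ([z, x1] @ [y, y - st a d, y] @ q)" if "Z ?N ([z, x1] @ [y, y + st a d, y] @ q)" for a d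
      using Z_loop[OF N _ that, of k] far[of "y + st k _" "[]" "y # q"] ij k by auto
    have "Z ?N ([z, x1] @ [y, y + st i (\<not> b), y] @ q)" "Z ?N ([z, x1] @ [y, y + st j (\<not> c), y] @ q)"
      using far[of "y + st i (\<not> b)" "[]" "y # q"] far[of "y + st j (\<not> c)" "[]" "y # q"] ij by auto
    from this[THEN l] show "Z ?N ([z, x1, y, x1, y] @ q)" "Z ?N ([z, x1, y, x2, y] @ q)"
      using ij by simp_all
  qed
  have top: "Z ?N ([z, x1, y] @ q) \<longleftrightarrow> Z ?N ([z, x2, y] @ q)" for q
    using Z_commute[OF R, of ?N "[]" q] by simp
  have side1: "Z ?N (p @ [x1, y, x2] @ q) \<longleftrightarrow> Z ?N (p @ [x1, z, x2] @ q)" for p q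
    using Z_commute[OF tiling_rhombus_rotate[OF R], of ?N p q] .
  have side2: "Z ?N (p @ [x2, y, x1] @ q) \<longleftrightarrow> Z ?N (p @ [x2, z, x1] @ q)" for p q
    using Z_commute[OF tiling_rhombus_rotate[OF R'], of ?N p q] .
  have bottom: "Z ?N (p @ [y, x1, z] @ q) \<longleftrightarrow> Z ?N (p @ [y, x2, z] @ q)" for p q
    using Z_commute[OF tiling_rhombus_opposite[OF R], of ?N p q] .
  have b1: "Z ?N ([z, x1, y] @ [x1, t])" if "t \<noteq> z" for t
  proof (cases "t = y")
    case True
    then show ?thesis
      using loop(1)[of "[]"] by simp
  next
    case False
    have "Z ?N ([z] @ [x2, z, x1, t] @ [])"
      by (rule Z_turn[OF N a21]) (use that False x12(2) no_triangle y in \<open>auto simp: add.commute\<close>)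
    then show ?thesis
      using top[of "[x1, t]"] side2[of "[z]" "[t]"] by simp
  qed
  have b2: "Z ?N ([z, x1, y] @ [x2, t])" if "t \<noteq> z" for t
  proof (cases "t = y")
    case True
    then show ?thesis
      using loop(2)[of "[]"] by simp
  next
    case False
    have "Z ?N ([z] @ [x1, z, x2, t] @ [])"
      by (rule Z_turn[OF N x12]) (use that False no_triangle y in auto)
    then show ?thesis
      using side1[of "[z]" "[t]"] by simp
  qed
  have c: "Z ?N ([z, x1, y] @ [x1, z, t])" for t
  proof -
    consider "t = x1" | "t = x2" | "t \<noteq> x1" "t \<noteq> x2" "\<not> adj3 x1 z t" | "t \<noteq> x1" "t \<noteq> x2" "\<not> adj3 x2 z t"
      using no_triangle by blast
    then show ?thesis
    proof cases
      case 1
      then show ?thesis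
        using loop(2)[of "[x1]"] bottom[of "[z, x1]" "[x1]"] side2[of "[z, x1, y]" "[]"] by simp
    next
      case 2
      then show ?thesis
        using loop(1)[of "[x2]"] side1[of "[z, x1, y]" "[]"] by simp
    next
      case 3
      then show ?thesis
        using Z_zero[OF N, of x1 z t "[z, x1, y]" "[]"] by simp
    next
      case 4
      then show ?thesis
        using Z_zero[OF N, of x2 z t "[z, x1, y]" "[]"] bottom[of "[z, x1]" "[t]"] by simp
    qed
  qed
  show ?thesis
    unfolding rhombus_mod_def using N walk R b1 b2 c far[of _ "[]" "[]"] by simp
qed

text \<open>The last assumption kills the far corner of the rhombus shared with \<open>xh\<close>.
  The edge to \<open>xi\<close> lies on only one further rhombus, the one with \<open>xj\<close>,
  and \<open>Z_completions\<close> kills the loops at \<open>xi\<close>.\<close>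

lemma rhombus_mod_arrow:
  assumes N: "rid N" and h: "adj3 xh z xi" "xh \<noteq> xi" and j: "adj3 xi z xj" "xi \<noteq> xj" and hj: "xh \<noteq> xj"
    and no_triangle: "\<And>t. t \<noteq> xi \<Longrightarrow> t \<noteq> xj \<Longrightarrow> adj3 xj z t \<Longrightarrow> \<not> adj3 xi z t"
    and ZN: "Z N [z, xi, xh + xi - z]"
  shows "rhombus_mod N [z, xi] xj z xi (xi + xj - z)"
proof -
  define yh yj where "yh = xh + xi - z" and "yj = xi + xj - z"
  have Rh: "tiling_rhombus z xh yh xi" and Rj: "tiling_rhombus z xi yj xj"
    using tiling_rhombusI[OF h] tiling_rhombusI[OF j] by (simp_all add: yh_def yj_def)
  have R: "tiling_rhombus xj z xi yj"
    using tiling_rhombus_rotate[OF tiling_rhombus_rotate[OF tiling_rhombus_rotate[OF Rj]]] .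
  have adjs: "adj3 z xi yh" "adj3 z xi yj" "yh \<noteq> z" "yj \<noteq> z" "yh \<noteq> yj"
    using tiling_rhombusD[OF Rh] tiling_rhombusD[OF Rj] hj by (auto simp: yh_def yj_def)
  have yh: "Z N ([z, xi, yh] @ q)" for q
    using Z_append[OF N, of "[z, xi, yh]" q] ZN by (simp add: yh_def)
  have comp: "Z N ([z, xi, z, xi] @ q)" "Z N ([z, xi, yj, xi] @ q)" for q
    using Z_completions[OF N adjs, of "[]" q] yh[of "xi # q"] by simp_all
  have a: "Z N ([z, xi] @ [t])" if "t \<noteq> z" "t \<noteq> yj" for t
  proof (cases "t = yh")
    case True
    then show ?thesis
      using yh[of "[]"] by simp
  next
    case False
    then have "\<not> adj3 z xi t"
      using edge_completions[of z xi yh yj t] adjs that by blast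
    then show ?thesis
      using Z_zero[OF N, of z xi t "[]" "[]"] that by simp
  qed
  have b1: "Z N ([z, xi] @ [z, t])" if "t \<noteq> xj" for t
  proof -
    consider "t = xi" | "t = xh" | "t \<noteq> xi" "t \<noteq> xh"
      by blast
    then show ?thesis
    proof cases
      case 1
      then show ?thesis
        using comp(1)[of "[]"] by simp
    next
      case 2
      then show ?thesis
        using Z_commute[OF tiling_rhombus_rotate[OF tiling_rhombus_reflect[OF Rh]], of N "[z]" "[]"] yh[of "[xh]"] by simp
    next
      case 3
      then have "\<not> adj3 xi z t"
        using edge_completions[of xi z xh xj t] adj3_sym[OF h(1)] j h(2) hj that by blast
      then show ?thesis
        using Z_zero[OF N, of xi z t "[z]" "[]"] 3 by simp
    qed
  qed
  have b2: "Z N ([z, xi] @ [yj, t])" if "t \<noteq> xj" for t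
  proof (cases "t = xi")
    case True
    then show ?thesis
      using comp(2)[of "[]"] by simp
  next
    case False
    then show ?thesis
      using Z_straight[OF N Rj False that, of "[]" "[]"] by simp
  qed
  have side: "Z N (p @ [xi, z, xj] @ q) \<longleftrightarrow> Z N (p @ [xi, yj, xj] @ q)" for p q
    using Z_commute[OF tiling_rhombus_rotate[OF Rj], of N p q] by blast
  have c: "Z N ([z, xi] @ [z, xj, t])" for t
  proof -
    consider "t = z" | "t = yj" | "t \<noteq> z" "t \<noteq> yj"
      by blast
    then show ?thesis
    proof cases
      case 1
      then show ?thesis
        using side[of "[z]" "[z]"] Z_commute[OF tiling_rhombus_opposite[OF Rj], of N "[z, xi]" "[]"] comp(2)[of "[z]"] by simp
    next
      case 2
      then show ?thesis
        using Z_commute[OF Rj, of N "[z, xi]" "[]"] comp(1)[of "[yj]"] by simp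
    next
      case 3
      have "Z N ([z] @ [xi, z, xj, t] @ [])"
        by (rule Z_turn[OF N j]) (use 3 no_triangle in \<open>auto simp: yj_def\<close>)
      then show ?thesis
        by simp
    qed
  qed
  have walk: "[z, xi] \<in> walks"
    using tiling_rhombus_arrows[OF Rj] arrows_vertices by (auto simp: walks_Cons walks_single)
  show ?thesis
    unfolding rhombus_mod_def yj_def[symmetric] using N walk R a b1 b2 c by simp
qed

text \<open>Only two edges at \<open>z\<close> survive modulo \<open>N\<close>, so a direction
  without loops is available and the loop relation kills all loops at \<open>z\<close>. A path that
  leaves the rhombus at \<open>x4\<close> or \<open>x5\<close> is moved across another rhombus,
  where it starts with an edge in \<open>N\<close>.\<close>

lemma rhombus_mod_vertex:
  assumes N: "rid N" and adj: "adj3 x4 z x5" "x4 \<noteq> x5" and ZN: "\<And>t. t \<noteq> x4 \<Longrightarrow> t \<noteq> x5 \<Longrightarrow> Z N [z, t]"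
  shows "rhombus_mod N [z] (x4 + x5 - z) x4 z x5"
proof -
  define y where "y = x4 + x5 - z"
  have R0: "tiling_rhombus z x4 y x5"
    using tiling_rhombusI[OF adj] by (simp add: y_def)
  note R = tiling_rhombus_opposite[OF R0]
  have zt: "Z N ([z, t] @ q)" if "t \<noteq> x4" "t \<noteq> x5" for t q
    using Z_append[OF N, of "[z, t]" q] ZN[OF that] by simp
  obtain i b j c where ij: "i \<noteq> j" "x4 = z + st i b" "x5 = z + st j c"
    using adj by (rule adj3E)
  obtain k where k: "k \<noteq> i" "k \<noteq> j"
    using distinct3_cases[OF ij(1)] by blast
  have loop: "Z N ([z, x4, z] @ q)" "Z N ([z, x5, z] @ q)" for q
  proof -
    have l: "Z N ([] @ [z, z - st a d, z] @ q)" if "Z N ([] @ [z, z + st a d, z] @ q)" for a d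
      using Z_loop[OF N _ that, of k] zt[of "z + st k _" "z # q"] ij k by auto
    have "Z N ([] @ [z, z + st i (\<not> b), z] @ q)" "Z N ([] @ [z, z + st j (\<not> c), z] @ q)"
      using zt[of "z + st i (\<not> b)" "z # q"] zt[of "z + st j (\<not> c)" "z # q"] ij by auto
    from this[THEN l] show "Z N ([z, x4, z] @ q)" "Z N ([z, x5, z] @ q)"
      using ij by simp_all
  qed
  have edge: "Z N ([z, x] @ [t])" if R1: "tiling_rhombus z x y x'" and x: "{x, x'} = {x4, x5}" and t: "t \<noteq> y" for x x' t
  proof -
    consider "t = z" | "t \<noteq> z" "\<not> adj3 z x t" | "t \<noteq> z" "adj3 z x t"
      by blast
    then show ?thesis
    proof cases
      case 1
      then show ?thesis
        using loop[of "[]"] x by (auto simp: doubleton_eq_iff)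
    next
      case 2
      then show ?thesis
        using Z_zero[OF N, of z x t "[]" "[]"] by simp
    next
      case 3
      define u where "u = z + t - x"
      have Ru: "tiling_rhombus z x t u"
        using tiling_rhombusI[OF 3(2)] 3(1) tiling_rhombus_rotate tiling_rhombus_reflect unfolding u_def by metis
      have "u \<noteq> x"
        using tiling_rhombusD(7)[OF Ru] by simp
      moreover have "u \<noteq> x'"
        using t tiling_rhombusD(5)[OF R1] by (auto simp: u_def)
      ultimately have "Z N ([z, u] @ [t])"
        using x by (intro zt) (auto simp: doubleton_eq_iff)
      then show ?thesis
        using Z_commute[OF Ru, of N "[]" "[]"] by simp
    qed
  qed
  have side: "Z N (p @ [x5, y, x4] @ q) \<longleftrightarrow> Z N (p @ [x5, z, x4] @ q)"
    "Z N (p @ [x4, y, x5] @ q) \<longleftrightarrow> Z N (p @ [x4, z, x5] @ q)" for p q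
    using Z_commute[OF tiling_rhombus_rotate[OF R0], of N p q]
      Z_commute[OF tiling_rhombus_rotate[OF tiling_rhombus_reflect[OF R0]], of N p q] by blast+
  have c: "Z N ([z] @ [x4, y, t])" for t
  proof -
    consider "t = x4" | "t = x5" | "t \<noteq> x4" "t \<noteq> x5"
      by blast
    then show ?thesis
    proof cases
      case 1
      then show ?thesis
        using Z_commute[OF R0, of N "[]" "[x4]"] side(1)[of "[z]" "[]"] loop(2)[of "[x4]"] by simp
    next
      case 2
      then show ?thesis
        using side(2)[of "[z]" "[]"] loop(1)[of "[x5]"] by simp
    next
      case 3
      then show ?thesis
        using Z_straight[OF N R0 3, of "[]" "[]"] by simp
    qed
  qed
  have walk: "[z] \<in> walks"
    using tiling_rhombus_arrows[OF R0] arrows_vertices by (auto simp: walks_single)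
  show ?thesis
    unfolding rhombus_mod_def y_def[symmetric]
    using N walk R ZN c edge[OF R0] edge[OF tiling_rhombus_reflect[OF R0]] by auto
qed

section \<open>Annihilators and rhombus quotients of right ideals\<close>

lemma Z_right_ideal: "p \<in> walks \<Longrightarrow> Z (right_ideal A (W p 1)) p"
proof (rule ZI)
  fix c assume p: "p \<in> walks"
  then have "[last p] \<in> walks"
    by (auto simp: walks_def)
  then have "W p c = W p 1 \<otimes> W [last p] c" "W [last p] c \<in> carrier A"
    using W_mult[OF p, of "[last p]" 1 c] W_carrier by simp_all
  then show "W p c \<in> right_ideal A (W p 1)"
    unfolding right_ideal_def by blast
qed

lemma annihilate_right_ideal:
  assumes "l \<in> carrier A" "g \<in> carrier A" "l \<otimes> g = \<zero>" "n \<in> right_ideal A g"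
  shows "l \<otimes> n = \<zero>"
proof -
  obtain a where "a \<in> carrier A" "n = g \<otimes> a"
    using assms(4) unfolding right_ideal_def by (rule imageE)
  then show ?thesis
    using m_assoc[OF assms(1,2), of a] assms(3) by simp
qed

lemma annihilate_add:
  assumes "l \<in> carrier A" "rid N" "rid N'" "\<And>n. n \<in> N \<Longrightarrow> l \<otimes> n = \<zero>"
    "\<And>n. n \<in> N' \<Longrightarrow> l \<otimes> n = \<zero>" "n \<in> N <+>\<^bsub>A\<^esub> N'"
  shows "l \<otimes> n = \<zero>"
  using assms ridD(1)[OF assms(2)] ridD(1)[OF assms(3)] by (auto simp: set_add_def' r_distr)

text \<open>As \<open>l\<close> kills \<open>N\<close>, its effect on a sum depends only on the
  summand from the ideal generated by \<open>g\<close>.\<close>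

lemma add_right_ideal_kernel:
  assumes l: "l \<in> carrier A" and g: "g \<in> carrier A" and N: "rid N"
    and lN: "\<And>n. n \<in> N \<Longrightarrow> l \<otimes> n = \<zero>"
    and ker: "\<And>a. a \<in> carrier A \<Longrightarrow> l \<otimes> (g \<otimes> a) = \<zero> \<Longrightarrow> g \<otimes> a \<in> N"
    and m: "m \<in> N <+>\<^bsub>A\<^esub> right_ideal A g"
  shows "l \<otimes> m \<in> right_ideal A (l \<otimes> g)" "l \<otimes> m = \<zero> \<longleftrightarrow> m \<in> N"
proof -
  obtain n a where na: "n \<in> N" "a \<in> carrier A" "m = n \<oplus> g \<otimes> a"
    using m by (auto simp: set_add_def' right_ideal_def)
  have n: "n \<in> carrier A"
    using ridD(1)[OF N na(1)] .
  have lm: "l \<otimes> m = l \<otimes> (g \<otimes> a)"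
    using n l g na(2) lN[OF na(1)] by (simp add: na(3) r_distr)
  then show "l \<otimes> m \<in> right_ideal A (l \<otimes> g)"
    using l g na(2) by (auto simp: right_ideal_def m_assoc)
  show "l \<otimes> m = \<zero> \<longleftrightarrow> m \<in> N"
    using lm lN ker[OF na(2)] ridD(3)[OF N na(1)] na(3) by auto
qed

lemma rhombus_module_quotient:
  assumes R: "tiling_rhombus w u y v" and l: "l \<in> walks" "g \<in> walks" "last l = hd g" "l @ tl g = [w, u, y]"
    and N: "rid N" and F': "rid F'" "W g 1 \<in> F'" and F: "F \<subseteq> F'"
    and img: "\<And>m. m \<in> F' \<Longrightarrow> W l 1 \<otimes> m \<in> right_ideal A (W l 1 \<otimes> W g 1)"
    and ker: "\<And>m. m \<in> F' \<Longrightarrow> W l 1 \<otimes> m = \<zero> \<longleftrightarrow> m \<in> F"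
  shows "rhombus_module s (quotient_module (mod_of F') F)"
proof -
  note q = quotient_left_mult[OF W_carrier[OF l(1)] F' img ker F]
  have "W l 1 \<otimes> W g 1 = walk_class s [w, u, y]"
    using W_mult[OF l(1,2), of 1 1] l(3,4) by (simp add: walk_class_eq)
  then show ?thesis
    using q R unfolding rhombus_module_def A_eq[symmetric] by metis
qed

end

theorem lemma10:
  fixes s :: "3 \<Rightarrow> real^2 \<Rightarrow> int" and z :: "real^2" and x :: "nat \<Rightarrow> real^2"
  assumes "sign_choice s"
    and "n_vertex 5 z"
    and "ccw_labelling 5 z x"
  shows "let A = (rauzy_algebra s :: 'k::field path_comb set ring);
             b = (\<lambda>j. walk_class s [z, x j]);
             b_bar = (\<lambda>j. walk_class s [x j, z]);
             b1A_b2A = sub_module (regular_module A)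
                         (right_ideal A (b 1) <+>\<^bsub>A\<^esub> right_ideal A (b 2));
             e_zA = sub_module (regular_module A) (right_ideal A (walk_class s [z]));
             b4_barA = sub_module (regular_module A) (right_ideal A (b_bar 4))
         in (\<exists>f g. short_exact A b1A_b2A f e_zA g b4_barA) \<and>
            has_rhombus_filtration s e_zA \<and>
            (\<exists>(P :: ('k path_comb set, 'k path_comb set) module) \<pi>. projective_cover A P \<pi> b4_barA) \<and>
            (\<forall>(P :: ('k path_comb set, 'p) module) \<pi>. projective_cover A P \<pi> b4_barA \<longrightarrow>
               right_iso A (sub_module P (a_kernel P b4_barA \<pi>)) b1A_b2A)"
proof -
  define A where "A = (rauzy_algebra s :: 'k path_comb set ring)"
  interpret rauzy s A
    by unfold_locales (use assms(1) A_def in auto)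
  define x1 x2 x3 x4 x5 where "x1 = x 1" and "x2 = x 2" and "x3 = x 3" and "x4 = x 4" and "x5 = x 5"
  note lab = ccw_labelling_5[OF assms(3), folded x1_def x2_def x3_def x4_def x5_def]
  note adj = lab(3-7) and nadj = lab(8-12)
  note adj' = adj[THEN adj3_sym]
  have nadj': "\<not> adj3 x3 z x1" "\<not> adj3 x4 z x1" "\<not> adj3 x4 z x2" "\<not> adj3 x5 z x2" "\<not> adj3 x5 z x3"
    using nadj adj3_sym by blast+
  have ne: "x1 \<noteq> x2" "x1 \<noteq> x3" "x1 \<noteq> x4" "x1 \<noteq> x5" "x2 \<noteq> x3" "x2 \<noteq> x4" "x2 \<noteq> x5" "x3 \<noteq> x4" "x3 \<noteq> x5" "x4 \<noteq> x5"
    using lab(2) by auto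
  have arr: "(z, t) \<in> arrows \<longleftrightarrow> t = x1 \<or> t = x2 \<or> t = x3 \<or> t = x4 \<or> t = x5" for t
    using lab(1) by blast
  \<comment> \<open>Adjacency among the five edges at \<open>z\<close> is a cycle of length five,
    which contains no triangle.\<close>
  have no_triangle: "\<not> adj3 a z t" if "t \<noteq> a" "t \<noteq> b" "adj3 b z t" "adj3 a z b" "a \<noteq> b" for a b t
  proof -
    have "a \<in> {x1, x2, x3, x4, x5}" "b \<in> {x1, x2, x3, x4, x5}" "t \<in> {x1, x2, x3, x4, x5}"
      using adj3_arrows[OF that(3)] adj3_arrows[OF that(4)] arr by blast+
    then show ?thesis
      using that nadj nadj' by auto
  qed
  define y12 y23 y45 where "y12 = x1 + x2 - z" and "y23 = x2 + x3 - z" and "y45 = x4 + x5 - z"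
  have R12: "tiling_rhombus z x1 y12 x2" and R23: "tiling_rhombus z x2 y23 x3"
    and R34: "tiling_rhombus z x3 (x3 + x4 - z) x4" and R45: "tiling_rhombus z x4 y45 x5"
    and R15: "tiling_rhombus z x1 (x1 + x5 - z) x5"
    using adj adj' ne by (auto simp: y12_def y23_def y45_def intro: tiling_rhombusI)
  note rot3 = tiling_rhombus_rotate[THEN tiling_rhombus_rotate, THEN tiling_rhombus_rotate]
  have zin: "z \<in> vertices"
    using arr arrows_vertices by blast
  have out: "[z, t] \<in> walks" "[t, z] \<in> walks" if "t \<in> {x1, x2, x3, x4, x5}" for t
    using that arr arrows_sym[of z t] arrows_vertices by (auto simp: walks_Cons walks_single)
  note ow = out[of x1, simplified] out[of x2, simplified] out[of x3, simplified] out[of x4, simplified] out[of x5, simplified]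
  have zw: "[z] \<in> walks"
    using zin by (simp add: walks_single)
  define e where "e = W [z] 1"
  define b where "b t = W [z, t] 1" for t
  define B where "B t = W [t, z] 1" for t
  have ec: "e \<in> carrier A" "e \<otimes>\<^bsub>A\<^esub> e = e"
    using W_carrier[OF zw] W_mult[OF zw zw, of 1 1] by (simp_all add: e_def)
  have bc: "b x1 \<in> carrier A" "b x2 \<in> carrier A" "b x3 \<in> carrier A"
    and Bc: "B x3 \<in> carrier A" "B x4 \<in> carrier A" "B x5 \<in> carrier A"
    using ow W_carrier by (simp_all add: b_def B_def)
  have Bb0: "B t \<otimes>\<^bsub>A\<^esub> b t' = \<zero>\<^bsub>A\<^esub>"
    if "t \<in> {x1, x2, x3, x4, x5}" "t' \<in> {x1, x2, x3, x4, x5}" "\<not> adj3 t z t'" "t \<noteq> t'" for t t'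
  proof -
    have "[t, z, t'] \<in> walks"
      using that arr arrows_sym by (auto simp: walks_triple)
    then have "W [t, z, t'] 1 = \<zero>\<^bsub>A\<^esub>"
      using W_zero[OF that(3,4), of "[]" "[]" 1] by simp
    then show ?thesis
      using W_mult[OF out(2)[OF that(1)] out(1)[OF that(2)], of 1 1] by (simp add: b_def B_def)
  qed
  have p12w: "[z, x1, y12] \<in> walks"
    using tiling_rhombus_arrows[OF R12] by (simp add: walks_triple)
  define p12 where "p12 = W [z, x1, y12] 1"
  have p12c: "p12 \<in> carrier A"
    using W_carrier[OF p12w] by (simp add: p12_def)
  define N12 where "N12 = right_ideal A p12"
  define b1A b2A b3A where "b1A = right_ideal A (b x1)" and "b2A = right_ideal A (b x2)" and "b3A = right_ideal A (b x3)"
  define S12 where "S12 = b1A <+>\<^bsub>A\<^esub> b2A"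
  define S123 where "S123 = S12 <+>\<^bsub>A\<^esub> b3A"
  define eA where "eA = right_ideal A e"
  have rid: "rid N12" "rid b1A" "rid b2A" "rid b3A" "rid S12" "rid S123" "rid eA"
    unfolding N12_def b1A_def b2A_def b3A_def S12_def S123_def eA_def
    using p12c bc ec by (auto intro!: rid_right_ideal rid_add)
  have Zb: "Z b1A [z, x1]" "Z b2A [z, x2]" "Z b3A [z, x3]" and Zp: "Z N12 [z, x1, y12]"
    unfolding b1A_def b2A_def b3A_def b_def N12_def p12_def using ow p12w by (simp_all add: Z_right_ideal)
  have sub: "b1A \<subseteq> S12" "b2A \<subseteq> S12" "S12 \<subseteq> S123" "b3A \<subseteq> S123"
    unfolding S12_def S123_def using rid by (simp_all add: subset_add_left subset_add_right S12_def)
  have Zp1: "Z b1A [z, x1, y12]"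
    using Z_append[OF rid(2) Zb(1), of "[y12]"] by simp

  \<comment> \<open>Upper bounds for the five subquotients\<close>
  have M0: "rhombus_mod {\<zero>\<^bsub>A\<^esub>} [z, x1, y12] z x1 y12 x2"
    using no_triangle[of _ x2 x1] by (intro rhombus_mod_corner adj(1) ne(1) y12_def) (use adj'(1) ne(1) in blast)
  have M1: "rhombus_mod N12 [z, x1] x5 z x1 (x1 + x5 - z)"
  proof (rule rhombus_mod_arrow[OF rid(1) adj'(1) ne(1)[symmetric] adj'(5) ne(4) ne(7)])
    show "\<not> adj3 x1 z t" if "t \<noteq> x1" "t \<noteq> x5" "adj3 x5 z t" for t
      using no_triangle[OF that adj'(5) ne(4)] .
    show "Z N12 [z, x1, x2 + x1 - z]"
      using Zp by (simp add: y12_def add.commute)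
  qed
  \<comment> \<open>\<open>N\<close> is kept general: the filtration uses it with
    \<open>b1A\<close>, the nilpotency of the kernel with \<open>N12\<close>.\<close>
  have M2: "rhombus_mod N [z, x2] x3 z x2 (x2 + x3 - z)" if N: "rid N" "Z N [z, x1, y12]" for N
  proof (rule rhombus_mod_arrow[OF N(1) adj(1) ne(1) adj(2) ne(5) ne(2)])
    show "\<not> adj3 x2 z t" if "t \<noteq> x2" "t \<noteq> x3" "adj3 x3 z t" for t
      using no_triangle[OF that adj(2) ne(5)] .
    show "Z N [z, x2, x1 + x2 - z]"
      using Z_commute[OF R12, of N "[]" "[]"] N(2) y12_def by simp
  qed
  have M3: "rhombus_mod S12 [z, x3] x4 z x3 (x3 + x4 - z)"
  proof (rule rhombus_mod_arrow[OF rid(5) adj(2) ne(5) adj(3) ne(8) ne(6)])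
    show "\<not> adj3 x3 z t" if "t \<noteq> x3" "t \<noteq> x4" "adj3 x4 z t" for t
      using no_triangle[OF that adj(3) ne(8)] .
    have "Z S12 [z, x2, y23]"
      using Z_append[OF rid(5) Z_mono[OF Zb(2) sub(2)], of "[y23]"] by simp
    then show "Z S12 [z, x3, x2 + x3 - z]"
      using Z_commute[OF R23, of S12 "[]" "[]"] y23_def by simp
  qed
  have M4: "rhombus_mod S123 [z] y45 x4 z x5"
    unfolding y45_def
  proof (rule rhombus_mod_vertex)
    fix t assume t: "t \<noteq> x4" "t \<noteq> x5"
    show "Z S123 [z, t]"
    proof (cases "(z, t) \<in> arrows")
      case True
      then show ?thesis
        using t arr Zb Z_mono sub by (metis subset_trans)
    qed (simp add: Z_def walks_Cons)
  qed (use rid adj ne in auto)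

  \<comment> \<open>Left multipliers that kill the ideals of the chain\<close>
  have ann12: "B x4 \<otimes>\<^bsub>A\<^esub> n = \<zero>\<^bsub>A\<^esub>" if "n \<in> S12" for n
    using that unfolding S12_def
    by (rule annihilate_add[OF Bc(2) rid(2,3), rotated 2])
      (use annihilate_right_ideal[OF Bc(2)] bc Bb0 nadj' ne b1A_def b2A_def in auto)
  have ann1: "B x3 \<otimes>\<^bsub>A\<^esub> n = \<zero>\<^bsub>A\<^esub>" if "n \<in> b1A" for n
    using annihilate_right_ideal[OF Bc(1) bc(1) Bb0] that nadj' ne b1A_def by auto
  \<comment> \<open>The edges to \<open>x5\<close> and \<open>x1\<close> are adjacent, so the path
    is first rewritten through \<open>x2\<close>, which is not adjacent to
    \<open>x5\<close>.\<close>
  have ann0: "B x5 \<otimes>\<^bsub>A\<^esub> n = \<zero>\<^bsub>A\<^esub>" if "n \<in> N12" for n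
  proof -
    have w: "[x5, z] @ [x1, y12] \<in> walks"
      using walks_append(1)[OF ow(10) p12w] by simp
    have "[x5] @ [z, x2, y12] @ [] \<in> walks"
      using w rhombus_walks[OF R12, of "[x5]" "[]"] rhombus_walks[OF tiling_rhombus_reflect[OF R12], of "[x5]" "[]"] by simp
    then have "W [x5, z, x2, y12] 1 = \<zero>\<^bsub>A\<^esub>"
      using W_zero[of x5 z x2 "[]" "[y12]" 1] nadj'(4) ne(7) by simp
    then have "W [x5, z, x1, y12] 1 = \<zero>\<^bsub>A\<^esub>"
      using W_commute[OF R12, of "[x5]" "[]" 1] w by simp
    then have "B x5 \<otimes>\<^bsub>A\<^esub> p12 = \<zero>\<^bsub>A\<^esub>"
      using W_mult[OF ow(10) p12w, of 1 1] by (simp add: B_def p12_def)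
    then show ?thesis
      using annihilate_right_ideal[OF Bc(3) p12c] that N12_def by auto
  qed
  have cw: "[y45, x4, z] \<in> walks"
    using tiling_rhombus_arrows[OF R45] by (simp add: walks_triple)
  define c where "c = W [y45, x4, z] 1"
  have cc: "c \<in> carrier A"
    using W_carrier[OF cw] by (simp add: c_def)
  have y4: "[y45, x4] \<in> walks" "[y45, x5] \<in> walks"
    using tiling_rhombus_arrows[OF R45] arrows_vertices by (auto simp: walks_Cons walks_single)
  \<comment> \<open>Both ways around the rhombus are needed: through \<open>x4\<close> the path
    kills \<open>b x1\<close> and \<open>b x2\<close>, through \<open>x5\<close> it kills
    \<open>b x2\<close> and \<open>b x3\<close>.\<close>
  have c4: "c = W [y45, x4] 1 \<otimes>\<^bsub>A\<^esub> B x4" and c5: "c = W [y45, x5] 1 \<otimes>\<^bsub>A\<^esub> B x5"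
    using W_mult[OF y4(1) ow(8), of 1 1] W_mult[OF y4(2) ow(10), of 1 1]
      W_commute[OF tiling_rhombus_opposite[OF R45], of "[]" "[]" 1] cw by (simp_all add: c_def B_def)
  have cb: "c \<otimes>\<^bsub>A\<^esub> b t = \<zero>\<^bsub>A\<^esub>" if "t \<in> {x1, x2, x3}" for t
  proof -
    have "B x4 \<otimes>\<^bsub>A\<^esub> b t = \<zero>\<^bsub>A\<^esub> \<or> B x5 \<otimes>\<^bsub>A\<^esub> b t = \<zero>\<^bsub>A\<^esub>"
      using that Bb0[of x4] Bb0[of x5] nadj' ne by auto
    then show ?thesis
      using c4 c5 Bc bc that W_carrier[OF y4(1), of 1] W_carrier[OF y4(2), of 1] m_assoc[of "W [y45, x4] 1" "B x4" "b t"]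
        m_assoc[of "W [y45, x5] 1" "B x5" "b t"] by auto
  qed
  have ann123: "c \<otimes>\<^bsub>A\<^esub> n = \<zero>\<^bsub>A\<^esub>" if "n \<in> S123" for n
  proof (rule annihilate_add[OF cc rid(5,4)])
    show "n \<in> S12 <+>\<^bsub>A\<^esub> b3A"
      using that by (simp add: S123_def)
    show "c \<otimes>\<^bsub>A\<^esub> m = \<zero>\<^bsub>A\<^esub>" if "m \<in> b3A" for m
      using annihilate_right_ideal[OF cc bc(3) cb, of m] that by (simp add: b3A_def)
    show "c \<otimes>\<^bsub>A\<^esub> m = \<zero>\<^bsub>A\<^esub>" if m: "m \<in> S12" for m
    proof (rule annihilate_add[OF cc rid(2,3)])
      show "m \<in> b1A <+>\<^bsub>A\<^esub> b2A"
        using m by (simp add: S12_def)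
    qed (use annihilate_right_ideal[OF cc bc(1) cb] annihilate_right_ideal[OF cc bc(2) cb]
        in \<open>simp_all add: b1A_def b2A_def\<close>)
  qed

  \<comment> \<open>Kernels of the left multiplications\<close>
  have K1: "b x1 \<otimes>\<^bsub>A\<^esub> a \<in> N12" if "a \<in> carrier A" "B x5 \<otimes>\<^bsub>A\<^esub> (b x1 \<otimes>\<^bsub>A\<^esub> a) = \<zero>\<^bsub>A\<^esub>" for a
    unfolding b_def by (rule rhombus_kernel[OF M1 ow(10)]) (use that ann0 in \<open>auto simp: b_def B_def\<close>)
  have K2: "b x2 \<otimes>\<^bsub>A\<^esub> a \<in> b1A" if "a \<in> carrier A" "B x3 \<otimes>\<^bsub>A\<^esub> (b x2 \<otimes>\<^bsub>A\<^esub> a) = \<zero>\<^bsub>A\<^esub>" for a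
    unfolding b_def by (rule rhombus_kernel[OF M2[OF rid(2) Zp1] ow(6)]) (use that ann1 in \<open>auto simp: b_def B_def\<close>)
  have K3: "b x3 \<otimes>\<^bsub>A\<^esub> a \<in> S12" if "a \<in> carrier A" "B x4 \<otimes>\<^bsub>A\<^esub> (b x3 \<otimes>\<^bsub>A\<^esub> a) = \<zero>\<^bsub>A\<^esub>" for a
    unfolding b_def by (rule rhombus_kernel[OF M3 ow(8)]) (use that ann12 in \<open>auto simp: b_def B_def\<close>)
  have K4: "e \<otimes>\<^bsub>A\<^esub> a \<in> S123" if "a \<in> carrier A" "c \<otimes>\<^bsub>A\<^esub> (e \<otimes>\<^bsub>A\<^esub> a) = \<zero>\<^bsub>A\<^esub>" for a
    unfolding e_def by (rule rhombus_kernel[OF M4 cw]) (use that ann123 in \<open>auto simp: e_def c_def\<close>)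

  have be: "e \<otimes>\<^bsub>A\<^esub> b t = b t" if "t \<in> {x1, x2, x3, x4, x5}" for t
    using W_mult[OF zw out(1)[OF that], of 1 1] by (simp add: e_def b_def)
  have b_eA: "b t \<in> eA" if "t \<in> {x1, x2, x3}" for t
    using be[of t] that bc unfolding eA_def right_ideal_def by (metis (no_types, lifting) image_eqI insertCI insertE empty_iff)
  have S123_eA: "S123 \<subseteq> eA"
  proof -
    have "b1A \<subseteq> eA" "b2A \<subseteq> eA" "b3A \<subseteq> eA"
      unfolding b1A_def b2A_def b3A_def using b_eA by (auto intro!: right_ideal_subset[OF rid(7)] del: subsetI)
    then show ?thesis
      using ridD(3)[OF rid(7)] by (auto simp: S123_def S12_def set_add_def' subset_iff)
  qed
  have eA_e: "e \<otimes>\<^bsub>A\<^esub> a = a" "a \<in> carrier A" if "a \<in> eA" for a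
    using that ec by (auto simp: eA_def right_ideal_def simp flip: m_assoc)

  have kernel: "B x4 \<otimes>\<^bsub>A\<^esub> a = \<zero>\<^bsub>A\<^esub> \<longleftrightarrow> a \<in> S12" if a: "a \<in> eA" for a
  proof
    assume Ba: "B x4 \<otimes>\<^bsub>A\<^esub> a = \<zero>\<^bsub>A\<^esub>"
    \<comment> \<open>The kernel is found by descending the chain: \<open>c\<close> is a left
      multiple of \<open>B x4\<close>, which puts \<open>a\<close> into \<open>S123\<close>, and
      \<open>K3\<close> then removes the part from \<open>b3A\<close>.\<close>
    have "c \<otimes>\<^bsub>A\<^esub> a = \<zero>\<^bsub>A\<^esub>"
      using c4 Ba Bc W_carrier[OF y4(1), of 1] eA_e(2)[OF a] by (simp add: m_assoc)
    then have "a \<in> S123"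
      using K4[of a] eA_e[OF a] by simp
    then show "a \<in> S12"
      using add_right_ideal_kernel(2)[OF Bc(2) bc(3) rid(5) ann12 K3, of a] Ba unfolding S123_def b3A_def by blast
  qed (rule ann12)

  \<comment> \<open>Modulo \<open>N12\<close>, a path from \<open>z\<close> through
    \<open>x1\<close> or \<open>x2\<close> that returns to \<open>z\<close> can only go on to
    \<open>x5\<close> or \<open>x3\<close>, so \<open>k\<close> multiplies \<open>b x1\<close> and
    \<open>b x2\<close> into \<open>N12\<close>. Elements of \<open>N12\<close> multiply both of
    them to zero. Thus k k lies in \<open>N12\<close> and the third factor annihilates it.\<close>
  have nil: "k \<otimes>\<^bsub>A\<^esub> k \<otimes>\<^bsub>A\<^esub> k = \<zero>\<^bsub>A\<^esub>" if k: "k \<in> S12" "k \<otimes>\<^bsub>A\<^esub> e = k" for k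
  proof -
    obtain a1 a2 where a: "a1 \<in> carrier A" "a2 \<in> carrier A" "k = b x1 \<otimes>\<^bsub>A\<^esub> a1 \<oplus>\<^bsub>A\<^esub> b x2 \<otimes>\<^bsub>A\<^esub> a2"
      using k(1) by (auto simp: S12_def b1A_def b2A_def right_ideal_def set_add_def')
    have kc: "k \<in> carrier A"
      using a bc by simp
    have irrefl: "(t, t) \<notin> arrows" for t
      using arrowsE[of t t] by (metis add_cancel_right_right st_nonzero)
    have xz: "x1 \<noteq> z" "x2 \<noteq> z" "y12 \<noteq> z"
      using arr irrefl tiling_rhombusD(6)[OF R12] by blast+
    note M2' = M2[OF rid(1) Zp]
    have kb: "k \<otimes>\<^bsub>A\<^esub> b t \<in> N12" if t: "t \<in> {x1, x2}" for t
    proof -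
      have "(z, t) \<in> arrows" "t \<noteq> x5" "t \<noteq> x3" "b t \<in> carrier A"
        using t arr ne bc by auto
      then show ?thesis
        using rhombus_mult[OF M1 a(1), of z t] rhombus_mult[OF M2' a(2), of z t] xz ridD(3)[OF rid(1)] bc a(1,2)
        unfolding a(3) b_def by (simp add: l_distr)
    qed
    have split: "m \<otimes>\<^bsub>A\<^esub> k = (m \<otimes>\<^bsub>A\<^esub> b x1) \<otimes>\<^bsub>A\<^esub> a1 \<oplus>\<^bsub>A\<^esub> (m \<otimes>\<^bsub>A\<^esub> b x2) \<otimes>\<^bsub>A\<^esub> a2" if "m \<in> carrier A" for m
      unfolding a(3) using that bc a(1,2) by (simp add: r_distr m_assoc)
    have "k \<otimes>\<^bsub>A\<^esub> k \<in> N12"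
      unfolding split[OF kc] using kb ridD(3,5)[OF rid(1)] a(1,2) by simp
    then obtain a where a': "a \<in> carrier A" "k \<otimes>\<^bsub>A\<^esub> k = p12 \<otimes>\<^bsub>A\<^esub> a"
      by (auto simp: N12_def right_ideal_def)
    have "k \<otimes>\<^bsub>A\<^esub> k \<otimes>\<^bsub>A\<^esub> b t = \<zero>\<^bsub>A\<^esub>" if t: "t \<in> {x1, x2}" for t
      using rhombus_mult[OF M0 a'(1), of z t] t arr xz unfolding a'(2) b_def p12_def by auto
    then show ?thesis
      using split[of "k \<otimes>\<^bsub>A\<^esub> k"] kc a(1,2) by simp
  qed

  \<comment> \<open>The projective cover and the exact sequence\<close>
  define T where "T = mod_of (right_ideal A (B x4))"
  define \<pi> where "\<pi> a = B x4 \<otimes>\<^bsub>A\<^esub> a" for a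
  have ridT: "rid (right_ideal A (B x4))"
    using Bc by (intro rid_right_ideal)
  have "B x4 \<otimes>\<^bsub>A\<^esub> e = B x4"
    using W_mult[OF ow(8) zw, of 1 1] by (simp add: B_def e_def)
  then have img: "\<pi> ` eA = right_ideal A (B x4)"
    using Bc ec unfolding \<pi>_def eA_def right_ideal_def image_image by (intro image_cong refl) (simp flip: m_assoc)
  have pi_hom: "\<pi> \<in> right_hom A (mod_of eA) T"
    unfolding \<pi>_def T_def using img by (intro left_mult_hom Bc rid) (auto simp: \<pi>_def)
  interpret cover: idempotent_cover A e \<pi> T
    by unfold_locales
      (use ec pi_hom img right_module_mod_of[OF ridT] nil kernel in \<open>auto simp: T_def eA_def \<pi>_def\<close>)
  have K: "a_kernel (mod_of eA) T \<pi> = S12"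
    using kernel S123_eA sub(3) by (auto simp: a_kernel_def' T_def \<pi>_def)
  have exact: "short_exact A (mod_of S12) (\<lambda>a. a) (mod_of eA) \<pi> T"
  proof -
    have "(\<lambda>a. a) \<in> right_hom A (mod_of S12) (mod_of eA)"
      using S123_eA sub(3) by (intro right_homI) auto
    then show ?thesis
      unfolding short_exact_def K
      using img pi_hom right_module_mod_of[OF rid(5)] right_module_mod_of[OF rid(7)] right_module_mod_of[OF ridT]
      by (simp add: T_def)
  qed

  \<comment> \<open>The rhombus filtration\<close>
  have filtration: "has_rhombus_filtration s (mod_of eA)"
  proof -
    define F where "F j = (if j = 0 then {\<zero>\<^bsub>A\<^esub>} else if j = 1 then N12 else if j = 2 then b1A else if j = 3 then S12
      else if j = 4 then S123 else eA)" for j :: nat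
    have rF: "rid (F j)" for j
      using rid rid_zero by (simp add: F_def)
    have "p12 \<in> b1A"
      using Zp1 p12w by (simp add: Z_def p12_def)
    then have N12b1: "N12 \<subseteq> b1A"
      unfolding N12_def using right_ideal_subset[OF rid(2)] by simp
    have zero_in: "\<zero>\<^bsub>A\<^esub> \<in> N12"
      using ridD(2)[OF rid(1)] .
    have subs: "F j \<subseteq> F (Suc j)" if "j < 5" for j
      using that N12b1 sub S123_eA zero_in by (auto simp: F_def less_Suc_eq numeral_eq_Suc)
    have FeA: "F j \<subseteq> eA" for j
    proof -
      have "{\<zero>\<^bsub>A\<^esub>} \<subseteq> N12" "N12 \<subseteq> eA" "b1A \<subseteq> eA" "S12 \<subseteq> eA"
        using N12b1 sub S123_eA zero_in by blast+
      then show ?thesis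
        using S123_eA by (auto simp: F_def)
    qed
    have N12_e: "e \<otimes>\<^bsub>A\<^esub> m = m" if "m \<in> N12" for m
      using that N12b1 sub S123_eA eA_e(1) by blast
    \<comment> \<open>The bottom factor is already a rhombus module, so the multiplier is
      \<open>e\<close>, which acts on it as the identity.\<close>
    have Q0: "rhombus_module s (quotient_module (mod_of N12) {\<zero>\<^bsub>A\<^esub>})"
      by (rule rhombus_module_quotient[OF R12 zw p12w])
        (use rid right_ideal_refl[OF p12c] zero_in N12_e in \<open>auto simp: N12_def p12_def simp flip: e_def\<close>)
    have Q1: "rhombus_module s (quotient_module (mod_of b1A) N12)"
    proof (rule rhombus_module_quotient[OF rot3[OF R15] ow(10) ow(1)])
      show "W [x5, z] 1 \<otimes>\<^bsub>A\<^esub> m \<in> right_ideal A (W [x5, z] 1 \<otimes>\<^bsub>A\<^esub> W [z, x1] 1)" if "m \<in> b1A" for m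
        using that Bc bc by (auto simp: b1A_def right_ideal_def m_assoc simp flip: b_def B_def)
      show "W [x5, z] 1 \<otimes>\<^bsub>A\<^esub> m = \<zero>\<^bsub>A\<^esub> \<longleftrightarrow> m \<in> N12" if "m \<in> b1A" for m
        using that ann0 K1 by (auto simp: b1A_def right_ideal_def simp flip: b_def B_def)
    qed (use rid N12b1 right_ideal_refl[OF bc(1)] in \<open>auto simp: b1A_def b_def\<close>)
    have Q2: "rhombus_module s (quotient_module (mod_of S12) b1A)"
    proof (rule rhombus_module_quotient[OF rot3[OF R23] ow(6) ow(3) _ _ rid(2) rid(5)])
      have step: "B x3 \<otimes>\<^bsub>A\<^esub> m \<in> right_ideal A (B x3 \<otimes>\<^bsub>A\<^esub> b x2)" "B x3 \<otimes>\<^bsub>A\<^esub> m = \<zero>\<^bsub>A\<^esub> \<longleftrightarrow> m \<in> b1A"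
        if "m \<in> S12" for m
        using add_right_ideal_kernel[OF Bc(1) bc(2) rid(2) ann1 K2, of m] that unfolding S12_def b2A_def by blast+
      show "W [x3, z] 1 \<otimes>\<^bsub>A\<^esub> m \<in> right_ideal A (W [x3, z] 1 \<otimes>\<^bsub>A\<^esub> W [z, x2] 1)" if "m \<in> S12" for m
        using step(1)[OF that] by (simp only: b_def B_def)
      show "W [x3, z] 1 \<otimes>\<^bsub>A\<^esub> m = \<zero>\<^bsub>A\<^esub> \<longleftrightarrow> m \<in> b1A" if "m \<in> S12" for m
        using step(2)[OF that] by (simp only: B_def)
      show "W [z, x2] 1 \<in> S12"
        using right_ideal_refl[OF bc(2)] sub(2) unfolding b2A_def b_def by blast
    qed (simp_all add: sub(1))
    have Q3: "rhombus_module s (quotient_module (mod_of S123) S12)"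
    proof (rule rhombus_module_quotient[OF rot3[OF R34] ow(8) ow(5) _ _ rid(5) rid(6)])
      have step: "B x4 \<otimes>\<^bsub>A\<^esub> m \<in> right_ideal A (B x4 \<otimes>\<^bsub>A\<^esub> b x3)" "B x4 \<otimes>\<^bsub>A\<^esub> m = \<zero>\<^bsub>A\<^esub> \<longleftrightarrow> m \<in> S12"
        if "m \<in> S123" for m
        using add_right_ideal_kernel[OF Bc(2) bc(3) rid(5) ann12 K3, of m] that unfolding S123_def b3A_def by blast+
      show "W [x4, z] 1 \<otimes>\<^bsub>A\<^esub> m \<in> right_ideal A (W [x4, z] 1 \<otimes>\<^bsub>A\<^esub> W [z, x3] 1)" if "m \<in> S123" for m
        using step(1)[OF that] by (simp only: b_def B_def)
      show "W [x4, z] 1 \<otimes>\<^bsub>A\<^esub> m = \<zero>\<^bsub>A\<^esub> \<longleftrightarrow> m \<in> S12" if "m \<in> S123" for m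
        using step(2)[OF that] by (simp only: B_def)
      show "W [z, x3] 1 \<in> S123"
        using right_ideal_refl[OF bc(3)] sub(4) unfolding b3A_def b_def by blast
    qed (simp_all add: sub(3))
    have Q4: "rhombus_module s (quotient_module (mod_of eA) S123)"
    proof (rule rhombus_module_quotient[OF tiling_rhombus_opposite[OF R45] cw zw])
      show "W [y45, x4, z] 1 \<otimes>\<^bsub>A\<^esub> m \<in> right_ideal A (W [y45, x4, z] 1 \<otimes>\<^bsub>A\<^esub> W [z] 1)" if "m \<in> eA" for m
        using that cc ec by (auto simp: eA_def right_ideal_def m_assoc simp flip: c_def e_def)
      show "W [y45, x4, z] 1 \<otimes>\<^bsub>A\<^esub> m = \<zero>\<^bsub>A\<^esub> \<longleftrightarrow> m \<in> S123" if "m \<in> eA" for m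
        using that ann123 K4 by (auto simp: eA_def right_ideal_def simp flip: c_def e_def)
    qed (use rid S123_eA right_ideal_refl[OF ec(1)] in \<open>auto simp: eA_def e_def\<close>)
    have "rhombus_module s (quotient_module (mod_of (F (Suc j))) (F j))" if j: "j < 5" for j
    proof -
      have "j = 0 \<or> j = 1 \<or> j = 2 \<or> j = 3 \<or> j = 4"
        using j by auto
      then show ?thesis
        using Q0 Q1 Q2 Q3 Q4 by (auto simp: F_def)
    qed
    moreover have "F 0 = {\<zero>\<^bsub>A\<^esub>}" "F 5 = eA"
      by (simp_all add: F_def)
    moreover have "submodule (F j) A (mod_of eA)" for j
      using submodule_mod_of[OF rid(7) rF FeA] .
    ultimately show ?thesis
      unfolding has_rhombus_filtration_def A_def[symmetric] using right_module_mod_of[OF rid(7)] subs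
      by (intro conjI exI[of _ 5] exI[of _ F]) auto
  qed

  have eqs: "walk_class s [z] = e" "\<And>j. walk_class s [z, x j] = b (x j)" "\<And>j. walk_class s [x j, z] = B (x j)"
    by (simp_all add: walk_class_eq e_def b_def B_def)
  show ?thesis
    unfolding Let_def A_def[symmetric] eqs x1_def[symmetric] x2_def[symmetric] x4_def[symmetric]
      b1A_def[symmetric] b2A_def[symmetric] S12_def[symmetric] eA_def[symmetric] T_def[symmetric]
    using exact filtration cover.projective_cover_exists cover.projective_cover_kernel[folded eA_def, unfolded K]
    by blast
qed

end
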